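(* Let $\lambda$ be a shifted pavable partition with 2-quotient $(\mu,\nu)$. Then $$\sum_{T}x^T = Q_{\mu}\,Q_{\nu},$$ where the sum runs over all shifted domino tableaux $T$ of shape $\lambda$.
   Context: Diagrams. A partition is a finite non-increasing sequence of positive integers; its length is its number of parts. The Young diagram of $\lambda=(\lambda_1,\dots,\lambda_\ell)$ is drawn in $\mathbb{R}^2$ with the first row at the bottom: it consists of the unit cells with lower-left corners $(x,y)$, $0\le y<\ell$, $0\le x<\lambda_{y+1}$. For an integer $k$, $D_k$ is the line of equation $Y=X+k$; the cell with lower-left corner $(x,y)$ is cut by the unique diagonal $D_{y-x}$. The part $\mathrm{up}(\lambda)$ consists of the cells cut by $D_k$ with $k>0$; the other cells form $\mathrm{down}(\lambda)$. 2-core and 2-quotient. A domino is a $1\times2$ or $2\times1$ rectangle of cells. The 2-core of $\lambda$ is obtained by successively removing from the diagram dominoes having no cell above them or to their right, until this is no longer possible (the result does not depend on the order). $\lambda$ is pavable if its 2-core is empty. The 2-quotient $(\mu,\nu)$ of $\lambda=(\lambda_1,\dots,\lambda_\ell)$ is defined as follows: let $L$ be the $\ell$-tuple with $L_i=\lambda_i+\ell-i$; let $M$ be obtained from $L$ by replacing, from right to left, the even entries successively by $0,2,4,\dots$ and the odd entries successively by $1,3,5,\dots$; then $\mu$ is the sequence of the values $(L_i-M_i)/2$ over the $i$ with $L_i$ even, and $\nu$ the sequence of these values over the $i$ with $L_i$ odd (zero parts are dropped). Pavings. A paving of a pavable partition $\lambda$ is a tiling of its diagram by dominoes. Each domino is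 cut by exactly one diagonal of even index $D_{2k}$; it is said to be on $D_{2k}$. In a paving, $\mathrm{up}'(\lambda)$ is the set of dominoes on $D_{2k}$ with $k>0$, and $\mathrm{down}'(\lambda)$ is the set of the remaining dominoes. Shifted pavable partitions. A pavable partition $\lambda$ with 2-quotient $(\mu,\nu)$ is a shifted pavable partition if the last part of $\mu$ is at least the length of $\mu$ and the last part of $\nu$ is at least the length of $\nu$ (an empty partition being allowed), and it is considered only with pavings satisfying: there is no vertical domino $d$ on $D_0$ which has adjacent dominoes on its left, all of them belonging to $\mathrm{up}'(\lambda)$. Shifted domino tableaux. A shifted domino tableau of shape $\lambda$ is a paving of $\lambda$ satisfying this last condition, together with a filling of the dominoes of $\mathrm{up}'(\lambda)$ by the symbol $X$ and of the dominoes of $\mathrm{down}'(\lambda)$ by letters of the ordered alphabet $\{1'<1<2'<2<\cdots\}$ such that, disregarding the $X$'s: rows are non-decreasing from left to right and columns are non-decreasing from bottom to top; each unprimed letter appears in at most one domino of each column; each primed letter appears in at most one domino of each row. Two shifted domino tableaux of shape $\lambda$ whose labelled dominoes in $\mathrm{down}'(\lambda)$ coincide are regarded as equal (only the lower part matters). Shifted Young tableaux and Q-Schur functions. For a partition $\mu$ whose last part is at least its length $\ell$ (or $\mu$ empty), a shifted Young tableau of shape $\mu$ is a filling of the cells of $\mathrm{up}(\mu)$ by $X$ and of the cells of $\mathrm{down}(\mu)$ by letters of $\{1'<1<2'<2<\cdots\}$ such that, disregarding the $X$'s: rows are non-decreasing from left to right and columns non-decreasing from bottom to top; each unprimed letter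 appears at most once in each column; each primed letter appears at most once in each row. (Deleting the $X$'s gives a usual shifted tableau on the shifted diagram of the strict partition $(\mu_1,\mu_2-1,\dots,\mu_\ell-\ell+1)$.) For a shifted Young tableau or shifted domino tableau $T$, put $x^T=x_1^{a_1}x_2^{a_2}\cdots$, where $a_i$ is the number of cells (respectively dominoes) of $T$ labelled $i$ or $i'$. Then $Q_\mu=\sum_t x^t$, the sum being over all shifted Young tableaux $t$ of shape $\mu$; equivalently, $Q_\mu$ is the usual Q-Schur function of the strict partition $(\mu_1,\mu_2-1,\dots,\mu_\ell-\ell+1)$. *)

theory Defs
  imports "HOL-Library.Multiset" "HOL-Library.Disjoint_Sets"
begin

section \<open>Partitions and diagrams\<close>

text \<open>Lists are indexed from 0, so row \<open>y\<close> of the diagram has \<open>lam ! y\<close> cells.\<close>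

definition is_partition :: "nat list \<Rightarrow> bool" where
  "is_partition lam \<longleftrightarrow> sorted_wrt (\<ge>) lam \<and> 0 \<notin> set lam"

text \<open>A cell is represented by its lower-left corner.\<close>

type_synonym cell = "nat \<times> nat"

definition diagram :: "nat list \<Rightarrow> cell set" where
  "diagram lam = {(x, y). y < length lam \<and> x < lam ! y}"

text \<open>The cell \<open>c\<close> is cut by the line \<open>D\<^sub>k\<close>, of equation \<open>Y = X + k\<close>, for \<open>k = diag c\<close> only.\<close>

definition diag :: "cell \<Rightarrow> int" where
  "diag c = int (snd c) - int (fst c)"

definition up :: "nat list \<Rightarrow> cell set" where
  "up lam = {c \<in> diagram lam. diag c > 0}"

definition down :: "nat list \<Rightarrow> cell set" where
  "down lam = diagram lam - up lam"


section \<open>Dominoes, 2-core and 2-quotient\<close>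

definition horizontal_domino :: "cell set \<Rightarrow> bool" where
  "horizontal_domino d \<longleftrightarrow> (\<exists>x y. d = {(x, y), (x + 1, y)})"

definition vertical_domino :: "cell set \<Rightarrow> bool" where
  "vertical_domino d \<longleftrightarrow> (\<exists>x y. d = {(x, y), (x, y + 1)})"

definition domino :: "cell set \<Rightarrow> bool" where
  "domino d \<longleftrightarrow> horizontal_domino d \<or> vertical_domino d"

definition removable :: "cell set \<Rightarrow> cell set \<Rightarrow> bool" where
  "removable A d \<longleftrightarrow> domino d \<and> d \<subseteq> A \<and>
     \<not> (\<exists>(x, y) \<in> d. \<exists>(x', y') \<in> A - d. (x' = x \<and> y < y') \<or> (y' = y \<and> x < x'))"

definition remove_domino :: "cell set \<Rightarrow> cell set \<Rightarrow> bool" where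
  "remove_domino A B \<longleftrightarrow> (\<exists>d. removable A d \<and> B = A - d)"

text \<open>A relation, so that no uniqueness of the result has to be built into the definition.\<close>

definition is_two_core :: "nat list \<Rightarrow> cell set \<Rightarrow> bool" where
  "is_two_core lam C \<longleftrightarrow> remove_domino\<^sup>*\<^sup>* (diagram lam) C \<and> \<not> (\<exists>B. remove_domino C B)"

definition pavable :: "nat list \<Rightarrow> bool" where
  "pavable lam \<longleftrightarrow> is_two_core lam {}"

definition quotient_L :: "nat list \<Rightarrow> nat list" where
  "quotient_L lam = map (\<lambda>i. lam ! i + (length lam - Suc i)) [0..<length lam]"

text \<open>Going from right to left, an entry is replaced by the first of \<open>0, 2, 4, \<dots>\<close>
  (respectively \<open>1, 3, 5, \<dots>\<close>) not yet used by the entries of the same parity on its right.\<close>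

fun quotient_M :: "nat list \<Rightarrow> nat list" where
  "quotient_M [] = []"
| "quotient_M (a # as) = (a mod 2 + 2 * length (filter (\<lambda>b. even b = even a) as)) # quotient_M as"

text \<open>The truncated subtraction below is harmless: \<open>L\<close> is strictly decreasing, so that
  \<open>M\<^sub>i \<le> L\<^sub>i\<close>.\<close>

definition two_quotient :: "nat list \<Rightarrow> nat list \<times> nat list" where
  "two_quotient lam =
     (let L = quotient_L lam;
          LM = zip L (quotient_M L);
          parts = (\<lambda>P. filter (\<lambda>k. k \<noteq> 0) (map (\<lambda>(l, m). (l - m) div 2) (filter (\<lambda>(l, m). P l) LM)))
      in (parts even, parts odd))"


section \<open>Pavings\<close>

definition paving :: "nat list \<Rightarrow> cell set set \<Rightarrow> bool" where
  "paving lam P \<longleftrightarrow> partition_on (diagram lam) P \<and> (\<forall>d\<in>P. domino d)"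

definition on_diag :: "cell set \<Rightarrow> int \<Rightarrow> bool" where
  "on_diag d j \<longleftrightarrow> (\<exists>c\<in>d. diag c = j)"

definition up_dominoes :: "cell set set \<Rightarrow> cell set set" where
  "up_dominoes P = {d \<in> P. \<exists>k>0. on_diag d (2 * k)}"

definition down_dominoes :: "cell set set \<Rightarrow> cell set set" where
  "down_dominoes P = P - up_dominoes P"

definition left_adjacent :: "cell set set \<Rightarrow> cell set \<Rightarrow> cell set set" where
  "left_adjacent P d = {e \<in> P. e \<noteq> d \<and> (\<exists>x y. (x, y) \<in> e \<and> (x + 1, y) \<in> d)}"

definition shifted_paving :: "nat list \<Rightarrow> cell set set \<Rightarrow> bool" where
  "shifted_paving lam P \<longleftrightarrow> paving lam P \<and>
     \<not> (\<exists>d\<in>P. vertical_domino d \<and> on_diag d 0 \<and>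
          left_adjacent P d \<noteq> {} \<and> left_adjacent P d \<subseteq> up_dominoes P)"

definition shiftable :: "nat list \<Rightarrow> bool" where
  "shiftable mu \<longleftrightarrow> mu = [] \<or> last mu \<ge> length mu"

definition shifted_pavable :: "nat list \<Rightarrow> bool" where
  "shifted_pavable lam \<longleftrightarrow> is_partition lam \<and> pavable lam \<and>
     shiftable (fst (two_quotient lam)) \<and> shiftable (snd (two_quotient lam))"


section \<open>The alphabet\<close>

datatype letter = Primed (index: nat) | Unprimed (index: nat)

text \<open>The order is \<open>1' < 1 < 2' < 2 < \<dots>\<close>.\<close>

fun rank :: "letter \<Rightarrow> nat" where
  "rank (Primed i) = 2 * i"
| "rank (Unprimed i) = 2 * i + 1"

lemma rank_inject: "rank a = rank b \<longleftrightarrow> a = b"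
  by (cases a; cases b; simp; presburger)

instantiation letter :: linorder
begin

definition less_eq_letter :: "letter \<Rightarrow> letter \<Rightarrow> bool" where
  "a \<le> b \<longleftrightarrow> rank a \<le> rank b"

definition less_letter :: "letter \<Rightarrow> letter \<Rightarrow> bool" where
  "a < b \<longleftrightarrow> rank a < rank b"

instance
  by standard (auto simp: less_eq_letter_def less_letter_def rank_inject)

end

definition alphabet :: "letter set" where
  "alphabet = {a. index a \<ge> 1}"

datatype entry = X | Letter (letter_of: letter)


section \<open>Tableaux\<close>

text \<open>A filling is a partial map from boxes (cells or dominoes) to entries, and \<open>reg\<close> gives the
  set of cells of a box. Only the boxes containing a letter are constrained.\<close>

definition tableau_rule :: "('b \<Rightarrow> cell set) \<Rightarrow> ('b \<rightharpoonup> entry) \<Rightarrow> bool" where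
  "tableau_rule reg T \<longleftrightarrow>
     (\<forall>p q a b. T p = Some (Letter a) \<and> T q = Some (Letter b) \<longrightarrow>
        (\<forall>x x' y. (x, y) \<in> reg p \<and> (x', y) \<in> reg q \<and> x \<le> x' \<longrightarrow> a \<le> b) \<and>
        (\<forall>x y y'. (x, y) \<in> reg p \<and> (x, y') \<in> reg q \<and> y \<le> y' \<longrightarrow> a \<le> b)) \<and>
     (\<forall>p q i x y y'. T p = Some (Letter (Unprimed i)) \<and> T q = Some (Letter (Unprimed i)) \<and>
        (x, y) \<in> reg p \<and> (x, y') \<in> reg q \<longrightarrow> p = q) \<and>
     (\<forall>p q i x x' y. T p = Some (Letter (Primed i)) \<and> T q = Some (Letter (Primed i)) \<and>
        (x, y) \<in> reg p \<and> (x', y) \<in> reg q \<longrightarrow> p = q)"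

definition shifted_young_tableaux :: "nat list \<Rightarrow> (cell \<rightharpoonup> entry) set" where
  "shifted_young_tableaux mu = {t. dom t = diagram mu \<and>
     (\<forall>c \<in> up mu. t c = Some X) \<and>
     (\<forall>c \<in> down mu. \<exists>a\<in>alphabet. t c = Some (Letter a)) \<and>
     tableau_rule (\<lambda>c. {c}) t}"

text \<open>The underlying paving of a domino tableau is the domain of the map.\<close>

definition shifted_domino_fillings :: "nat list \<Rightarrow> (cell set \<rightharpoonup> entry) set" where
  "shifted_domino_fillings lam = {T. shifted_paving lam (dom T) \<and>
     (\<forall>d \<in> up_dominoes (dom T). T d = Some X) \<and>
     (\<forall>d \<in> down_dominoes (dom T). \<exists>a\<in>alphabet. T d = Some (Letter a)) \<and>
     tableau_rule (\<lambda>d. d) T}"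

text \<open>Fillings whose labelled lower dominoes coincide are regarded as the same shifted domino
  tableau, which is thus represented by these labelled dominoes alone.\<close>

definition lower_part :: "(cell set \<rightharpoonup> entry) \<Rightarrow> (cell set \<rightharpoonup> entry)" where
  "lower_part T = T |` down_dominoes (dom T)"

definition shifted_domino_tableaux :: "nat list \<Rightarrow> (cell set \<rightharpoonup> entry) set" where
  "shifted_domino_tableaux lam = lower_part ` shifted_domino_fillings lam"


section \<open>Generating series\<close>

text \<open>A formal power series in \<open>x\<^sub>1, x\<^sub>2, \<dots>\<close> is given by its coefficients; a monomial is
  the multiset of the indices of its variables.\<close>

type_synonym monomial = "nat multiset"

type_synonym series = "monomial \<Rightarrow> int"

definition series_times :: "series \<Rightarrow> series \<Rightarrow> series"  (infixl "\<star>" 70) where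
  "f \<star> g = (\<lambda>m. \<Sum>k | k \<subseteq># m. f k * g (m - k))"

definition letters :: "('b \<rightharpoonup> entry) \<Rightarrow> 'b set" where
  "letters T = {p. \<exists>a. T p = Some (Letter a)}"

text \<open>The monomial \<open>x\<^sup>T\<close>.\<close>

definition weight :: "('b \<rightharpoonup> entry) \<Rightarrow> monomial" where
  "weight T = image_mset (\<lambda>p. index (letter_of (the (T p)))) (mset_set (letters T))"

text \<open>The series \<open>\<Sum>T\<in>A. x\<^sup>T\<close>. As \<open>card\<close> is 0 on infinite sets, it is meaningful only if
  finitely many elements of \<open>A\<close> have a given weight; see the last two lemmas below.\<close>

definition gen_series :: "('b \<rightharpoonup> entry) set \<Rightarrow> series" where
  "gen_series A = (\<lambda>m. int (card {T \<in> A. weight T = m}))"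

definition Q :: "nat list \<Rightarrow> series" where
  "Q mu = gen_series (shifted_young_tableaux mu)"

lemma finite_diagram: "finite (diagram lam)"
proof -
  have "diagram lam \<subseteq> (\<Union>y<length lam. {..<lam ! y} \<times> {y})"
    by (auto simp: diagram_def)
  then show ?thesis
    by (rule finite_subset) auto
qed

lemma finite_fillings:
  assumes "finite D" and "\<And>T. T \<in> A \<Longrightarrow> dom T \<subseteq> D"
  shows "finite {T \<in> A. weight T = m}"
proof -
  define E where "E = insert X (Letter ` (Primed ` set_mset m \<union> Unprimed ` set_mset m))"
  have "{T \<in> A. weight T = m} \<subseteq> (\<Union>S\<in>Pow D. {T. dom T = S \<and> ran T \<subseteq> E})"
  proof clarify
    fix T assume T: "T \<in> A" and m: "m = weight T"
    have "finite (letters T)"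
      by (rule finite_subset[of _ D]) (use assms T in \<open>auto simp: letters_def\<close>)
    then have idx: "index a \<in> set_mset m" if "T p = Some (Letter a)" for p a
      using that unfolding m weight_def by (force simp: letters_def)
    have "e \<in> E" if "T p = Some e" for p e
    proof (cases e)
      case (Letter a)
      with idx[of p a] that show ?thesis
        by (cases a) (auto simp: E_def)
    qed (simp add: E_def)
    then have "ran T \<subseteq> E"
      by (auto simp: ran_def)
    then show "T \<in> (\<Union>S\<in>Pow D. {T. dom T = S \<and> ran T \<subseteq> E})"
      using assms(2)[OF T] by blast
  qed
  moreover have "finite (\<Union>S\<in>Pow D. {T. dom T = S \<and> ran T \<subseteq> E})"
    using assms(1) by (intro finite_UN_I finite_set_of_finite_maps) (auto simp: E_def intro: finite_subset)
  ultimately show ?thesis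
    by (rule finite_subset)
qed

lemma finite_shifted_young_tableaux:
  "finite {t \<in> shifted_young_tableaux mu. weight t = m}"
  by (rule finite_fillings[OF finite_diagram]) (auto simp: shifted_young_tableaux_def)

lemma finite_shifted_domino_tableaux:
  "finite {T \<in> shifted_domino_tableaux lam. weight T = m}"
proof (rule finite_fillings)
  show "finite (Pow (diagram lam))"
    by (simp add: finite_diagram)
next
  fix T assume "T \<in> shifted_domino_tableaux lam"
  then obtain T' where T': "shifted_paving lam (dom T')" and "T = lower_part T'"
    by (auto simp: shifted_domino_tableaux_def shifted_domino_fillings_def)
  then have "dom T \<subseteq> dom T'"
    by (auto simp: lower_part_def)
  moreover have "dom T' \<subseteq> Pow (diagram lam)"
    using T' by (auto simp: shifted_paving_def paving_def partition_on_def)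
  ultimately show "dom T \<subseteq> Pow (diagram lam)"
    by blast
qed

end

theory Submission
  imports Defs "HOL-Library.Product_Lexorder"
begin

text \<open>A shifted Young tableau is determined by the sets of letters on its diagonals
  \<open>D\<^sub>0, D\<^bsub>-1\<^esub>, D\<^bsub>-2\<^esub>, \<dots>\<close>: the letters increase strictly along each diagonal, and the row and column
  conditions say that the sets on consecutive diagonals interlace. Likewise a shifted domino tableau
  is determined by the sets \<open>R 0, R 1, R 2, \<dots>\<close> of letters, where \<open>R i\<close> belongs to the labelled
  dominoes with cells on \<open>D\<^bsub>1-i\<^esub>\<close> and \<open>D\<^bsub>-i\<^esub>\<close>. Inserting the dominoes in the order of their letters,
  a domino moves a vertical step of the boundary path by two positions, so that the two parity
  classes of positions do not interact: the conditions on the family say that \<open>R i\<close> and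
  \<open>R (i + 2)\<close> interlace. Such families are pairs of families of the Young kind, and the numbers of
  elements prescribed by \<open>\<lambda>\<close> are the lengths of the diagonals of its 2-quotient.\<close>

section \<open>Ranks and insertion times\<close>

text \<open>Call \<open>x - y\<close> the offset of a cell. The cells of offset \<open>c\<close> lie
  in dominoes at positions \<open>c\<close> and \<open>c + 1\<close>, so below the main diagonal the
  number of them present at a given time is a sum of two ranks. That the inserted cells form a
  diagram is a comparison of the sums for \<open>c\<close> and \<open>c + 1\<close>; the shared
  summand cancels, and a condition on positions \<open>c\<close> and \<open>c + 2\<close> remains.
  This cancellation is what separates the parity classes.

  The obstacle is the main diagonal. A labelled domino at position 0 also covers a cell above it,
  where letters give no direct control. Its orientation has to be recovered from the letters: it is
  vertical exactly when no domino at position 1 was inserted earlier, and the condition on vertical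
  dominoes enforces this. Conversely, to build a tableau from a family, times for the X dominoes
  must be invented that complete the growth to all of \<open>lam\<close>. Their numbers fit the
  diagram above the main diagonal because both quotient partitions are shiftable, while pavability
  provides the balance between even and odd beta-numbers.\<close>

definition below :: "'a::linorder set \<Rightarrow> 'a \<Rightarrow> nat" where
  "below S t = card {u \<in> S. u < t}"

lemma below_mono: "finite S \<Longrightarrow> s \<le> t \<Longrightarrow> below S s \<le> below S t"
  unfolding below_def by (rule card_mono) auto

lemma below_strict: "finite S \<Longrightarrow> s \<in> S \<Longrightarrow> s < t \<Longrightarrow> below S s < below S t"
  unfolding below_def by (rule psubset_card_mono) auto

lemma below_less_iff:
  assumes "finite S" "s \<in> S" shows "below S s < below S t \<longleftrightarrow> s < t"
  using below_strict[OF assms] below_mono[OF assms(1), of t s] by force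

lemma below_eqD: "finite S \<Longrightarrow> s \<in> S \<Longrightarrow> t \<in> S \<Longrightarrow> below S s = below S t \<Longrightarrow> s = t"
  by (metis below_strict less_irrefl neqE)

lemma below_less_card: "finite S \<Longrightarrow> s \<in> S \<Longrightarrow> below S s < card S"
  unfolding below_def by (rule psubset_card_mono) auto

lemma below_le_card: "finite S \<Longrightarrow> below S s \<le> card S"
  unfolding below_def by (rule card_mono) auto

lemma bij_betw_below:
  assumes "finite S" shows "bij_betw (below S) S {..<card S}"
proof -
  have inj: "inj_on (below S) S"
    using below_eqD[OF assms] by (rule inj_onI)
  moreover have "below S ` S = {..<card S}"
    using below_less_card[OF assms] card_image[OF inj] by (intro card_subset_eq) auto
  ultimately show ?thesis by (simp add: bij_betw_def)
qed

lemma ex_below_eq: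
  assumes "finite S" "k < card S" obtains s where "s \<in> S" "below S s = k"
proof -
  have "k \<in> below S ` S"
    using bij_betw_below[OF assms(1)] assms(2) by (simp add: bij_betw_def)
  then show thesis using that by blast
qed

lemma below_Un:
  "finite S \<Longrightarrow> finite S' \<Longrightarrow> S \<inter> S' = {} \<Longrightarrow> below (S \<union> S') t = below S t + below S' t"
  unfolding below_def by (subst card_Un_disjoint[symmetric]) (auto intro!: arg_cong[where f=card])

text \<open>\<open>below S\<close> maps \<open>S\<close> increasingly onto an initial segment of the
  naturals, so the survivors below \<open>t\<close> correspond to the interval from \<open>j\<close>
  to \<open>below S t\<close>. The truncation is meaningful: the count stays 0 until
  \<open>j\<close> elements have passed.\<close>

lemma below_drop:
  assumes "finite S"
  shows "below {s \<in> S. j \<le> below S s} t = below S t - j"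
proof -
  let ?B = "{s \<in> S. s < t}"
  have bij: "bij_betw (below S) ?B {..<below S t}"
  proof (rule bij_betw_subset[OF bij_betw_below[OF assms], THEN bij_betw_cong[THEN iffD1, rotated]])
    show "below S ` ?B = {..<below S t}"
    proof (intro equalityI subsetI)
      fix k assume "k \<in> {..<below S t}"
      then have k: "k < below S t" by simp
      with below_le_card[OF assms, of t] obtain s where "s \<in> S" "below S s = k"
        using ex_below_eq[OF assms, of k] by (metis order_less_le_trans)
      with k show "k \<in> below S ` ?B"
        using below_less_iff[OF assms] by auto
    qed (use below_strict[OF assms] in auto)
  qed auto
  have "below {s \<in> S. j \<le> below S s} t = card {s \<in> ?B. j \<le> below S s}"
    unfolding below_def by (rule arg_cong[where f=card]) auto
  also have "\<dots> = card {k \<in> {..<below S t}. j \<le> k}"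
    by (rule bij_betw_same_card[of "below S"])
      (use bij in \<open>auto simp: bij_betw_def inj_on_def\<close>)
  also have "{k \<in> {..<below S t}. j \<le> k} = {j..<below S t}" by auto
  finally show ?thesis by simp
qed

lemma card_drop:
  assumes "finite S"
  shows "card {s \<in> S. j \<le> below S s} = card S - j"
proof -
  have "card {s \<in> S. j \<le> below S s} = card {k \<in> {..<card S}. j \<le> k}"
    by (rule bij_betw_same_card[of "below S"])
      (use bij_betw_below[OF assms] in \<open>auto simp: bij_betw_def inj_on_def\<close>)
  also have "{k \<in> {..<card S}. j \<le> k} = {j..<card S}" by auto
  finally show ?thesis by simp
qed

lemma below_strict_mono_image:
  fixes f :: "nat \<Rightarrow> 'a::linorder"
  assumes "strict_mono_on {..<d} f" "y < d"
  shows "below (f ` {..<d}) (f y) = y"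
proof -
  have "{u \<in> f ` {..<d}. u < f y} = f ` {..<y}"
    using strict_mono_on_less[OF assms(1)] assms(2) by auto
  moreover have "inj_on f {..<y}"
    using strict_mono_on_imp_inj_on[OF assms(1)] assms(2) by (auto intro: inj_on_subset)
  ultimately show ?thesis
    by (simp add: below_def card_image)
qed

section \<open>Insertion times and interlacing\<close>

type_synonym time = "nat \<times> int"

text \<open>A box on the \<open>i\<close>-th diagonal whose letter has rank \<open>r\<close> is inserted at time \<open>tm i r\<close>: among
  equal letters, unprimed ones (odd rank) are inserted from left to right and primed ones from
  right to left.\<close>

definition tm :: "nat \<Rightarrow> nat \<Rightarrow> time" where
  "tm i r = (r, if odd r then int i else - int i)"

lemma tm_eq_iff [simp]: "tm i r = tm j s \<longleftrightarrow> i = j \<and> r = s"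
  by (auto simp: tm_def)

lemma fst_tm [simp]: "fst (tm i r) = r"
  by (simp add: tm_def)

lemma inj_on_tm: "inj_on (tm i) P"
  by (auto simp: inj_on_def)

text \<open>The second component is an integer, so \<open>(fst t, snd t + 1)\<close> is the
  immediate successor of \<open>t\<close> in the lexicographic order. Counting below it describes
  the state just after the insertion at \<open>t\<close>.\<close>

lemma less_succ_time_iff: "u < (fst t, snd t + 1) \<longleftrightarrow> u \<le> (t :: time)"
  by (cases u; cases t) (auto simp: less_prod_def less_eq_prod_def)

lemma below_succ_time:
  assumes "finite S" "s \<in> S" shows "below S (fst s, snd s + 1) = Suc (below S (s :: time))"
proof -
  have "{u \<in> S. u < (fst s, snd s + 1)} = insert s {u \<in> S. u < s}"
    using assms(2) unfolding less_succ_time_iff by auto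
  then show ?thesis
    using assms(1) by (simp add: below_def)
qed

lemma below_tm:
  assumes "finite P"
  shows "below (tm i ` P) (r, z) = (if snd (tm i r) < z then below P (Suc r) else below P r)"
proof -
  have "{u \<in> tm i ` P. u < (r, z)} = tm i ` {s \<in> P. s < r \<or> s = r \<and> snd (tm i r) < z}"
    by (auto simp: tm_def less_prod_def)
  then have "below (tm i ` P) (r, z) = card {s \<in> P. s < r \<or> s = r \<and> snd (tm i r) < z}"
    by (simp add: below_def card_image[OF inj_on_tm])
  moreover have "{s \<in> P. s < r \<or> s = r \<and> snd (tm i r) < z}
      = {s \<in> P. s < (if snd (tm i r) < z then Suc r else r)}"
    by auto
  ultimately show ?thesis
    by (auto simp: below_def)
qed

text \<open>This is interlacing of insertion times rewritten in ranks. The positions have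
  disappeared, so one relation serves consecutive diagonals of Young tableaux and every second
  position of domino tableaux. The clauses for odd and even \<open>r\<close> describe the moment
  between the two insertions of a letter common to both sets.\<close>

definition interlacing :: "nat set \<Rightarrow> nat set \<Rightarrow> bool" where
  "interlacing P P' \<longleftrightarrow> (\<forall>r. below P' r \<le> below P r \<and> below P r \<le> Suc (below P' r) \<and>
     (odd r \<longrightarrow> below P (Suc r) \<le> Suc (below P' r)) \<and> (even r \<longrightarrow> below P' (Suc r) \<le> below P r))"

lemma interlacing_iff:
  assumes "finite P" "finite P'" "i < j"
  shows "interlacing P P' \<longleftrightarrow>
    (\<forall>t. below (tm j ` P') t \<le> below (tm i ` P) t \<and> below (tm i ` P) t \<le> Suc (below (tm j ` P') t))"
    (is "_ \<longleftrightarrow> (\<forall>t. ?I t)")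
proof
  assume *: "interlacing P P'"
  show "\<forall>t. ?I t"
  proof
    fix t :: time
    obtain r z where t: "t = (r, z)" by (cases t)
    have r: "below P' r \<le> below P r" "below P r \<le> Suc (below P' r)"
      "odd r \<Longrightarrow> below P (Suc r) \<le> Suc (below P' r)" "even r \<Longrightarrow> below P' (Suc r) \<le> below P r"
      "below P' (Suc r) \<le> below P (Suc r)" "below P (Suc r) \<le> Suc (below P' (Suc r))"
      using * unfolding interlacing_def by blast+
    have s: "below P r \<le> below P (Suc r)" "below P' r \<le> below P' (Suc r)"
      using assms by (simp_all add: below_mono)
    show "?I t"
      unfolding t below_tm[OF assms(1)] below_tm[OF assms(2)]
      using r s assms(3) by (cases "odd r") (auto simp: tm_def)
  qed
next
  assume *: "\<forall>t. ?I t"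
  show "interlacing P P'"
    unfolding interlacing_def
  proof (intro allI conjI impI)
    fix r
    have z: "?I (r, z)" for z using * by blast
    note z = this[unfolded below_tm[OF assms(1)] below_tm[OF assms(2)]]
    \<comment> \<open>Probe times: at \<open>- int j\<close> no letter of rank \<open>r\<close> has
      been inserted yet; at \<open>int j\<close> an unprimed one has been inserted at
      \<open>i\<close> but not at \<open>j\<close>; at \<open>- int i\<close> a primed one at
      \<open>j\<close> but not at \<open>i\<close>.\<close>
    show "below P' r \<le> below P r" "below P r \<le> Suc (below P' r)"
      using z[of "- int j"] assms(3) by (auto simp: tm_def split: if_splits)
    show "below P (Suc r) \<le> Suc (below P' r)" if "odd r"
      using z[of "int j"] assms(3) that by (auto simp: tm_def)
    show "below P' (Suc r) \<le> below P r" if "even r"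
      using z[of "- int i"] assms(3) that by (auto simp: tm_def)
  qed
qed

text \<open>Two piles grow with time, the first never lower than the second. Just after
  \<open>s'\<close> the second pile has passed the common height; if \<open>s\<close> came later,
  the first would not have. The offsets \<open>b\<close> and \<open>b'\<close> make this serve both
  rows and columns.\<close>

lemma equal_height_le:
  fixes S S' :: "time set"
  assumes "finite S" "finite S'" and le: "\<And>t. b' + below S' t \<le> b + below S t"
    and "s \<in> S" "s' \<in> S'" "b + below S s = b' + below S' s'"
  shows "s \<le> s'"
proof (rule ccontr)
  assume "\<not> s \<le> s'"
  let ?t = "(fst s', snd s' + 1)"
  have "?t \<le> s"
    by (metis \<open>\<not> s \<le> s'\<close> less_succ_time_iff linorder_not_less)
  then have "below S ?t \<le> below S s"
    by (rule below_mono[OF assms(1)])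
  with le[of ?t] below_succ_time[OF assms(2,5)] assms(6) show False
    by simp
qed

text \<open>Shifting by \<open>k\<close>: every index of \<open>f\<close> beyond the first
  \<open>k\<close> with value below \<open>t\<close> comes from an index of \<open>g\<close> with
  value below \<open>t\<close>.\<close>

lemma below_image_le:
  fixes f g :: "nat \<Rightarrow> 'a::linorder"
  assumes f: "strict_mono_on {..<m} f" and g: "strict_mono_on {..<n} g"
    and le: "\<And>y. y + k < m \<Longrightarrow> y < n \<and> g y \<le> f (y + k)"
  shows "below (f ` {..<m}) t \<le> below (g ` {..<n}) t + k"
proof -
  have f': "below (f ` {..<m}) t = card {y. y < m \<and> f y < t}"
  proof -
    have "{u \<in> f ` {..<m}. u < t} = f ` {y. y < m \<and> f y < t}" by auto
    moreover have "inj_on f {y. y < m \<and> f y < t}"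
      by (rule inj_on_subset[OF strict_mono_on_imp_inj_on[OF f]]) auto
    ultimately show ?thesis by (simp add: below_def card_image)
  qed
  have g': "below (g ` {..<n}) t = card {y. y < n \<and> g y < t}"
  proof -
    have "{u \<in> g ` {..<n}. u < t} = g ` {y. y < n \<and> g y < t}" by auto
    moreover have "inj_on g {y. y < n \<and> g y < t}"
      by (rule inj_on_subset[OF strict_mono_on_imp_inj_on[OF g]]) auto
    ultimately show ?thesis by (simp add: below_def card_image)
  qed
  have "{y. y < m \<and> f y < t} \<subseteq> {..<k} \<union> (\<lambda>y. y + k) ` {y. y < n \<and> g y < t}"
  proof
    fix y assume y: "y \<in> {y. y < m \<and> f y < t}"
    show "y \<in> {..<k} \<union> (\<lambda>y. y + k) ` {y. y < n \<and> g y < t}"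
    proof (cases "y < k")
      case False
      then have "y = (y - k) + k" by simp
      moreover have "y - k < n \<and> g (y - k) < t"
        using le[of "y - k"] False y by auto
      ultimately show ?thesis by blast
    qed simp
  qed
  then have "card {y. y < m \<and> f y < t} \<le> card ({..<k} \<union> (\<lambda>y. y + k) ` {y. y < n \<and> g y < t})"
    by (intro card_mono) auto
  also have "\<dots> \<le> card {..<k} + card ((\<lambda>y. y + k) ` {y. y < n \<and> g y < t})"
    by (rule card_Un_le)
  also have "\<dots> \<le> k + card {y. y < n \<and> g y < t}"
    by (simp add: card_image_le)
  finally show ?thesis
    using f' g' by simp
qed

section \<open>Tableaux as families of interlacing sets\<close>

fun letter_of_rank :: "nat \<Rightarrow> letter" where
  "letter_of_rank r = (if odd r then Unprimed (r div 2) else Primed (r div 2))"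

lemma rank_letter_of_rank [simp]: "rank (letter_of_rank r) = r"
  by simp

declare letter_of_rank.simps [simp del]

lemma index_eq_rank_div_2: "index a = rank a div 2"
  by (cases a) auto

lemma mem_alphabet_iff: "a \<in> alphabet \<longleftrightarrow> 2 \<le> rank a"
  by (cases a) (auto simp: alphabet_def)

section \<open>The tableau conditions in terms of ranks and times\<close>

lemma tableau_rule_rowD:
  assumes "tableau_rule reg T" "T p = Some (Letter a)" "T q = Some (Letter b)"
    and "(x, y) \<in> reg p" "(x', y) \<in> reg q" "x \<le> x'"
  shows "rank a \<le> rank b" and "rank a = rank b \<Longrightarrow> even (rank a) \<Longrightarrow> p = q"
proof -
  have "a \<le> b"
    using assms(1)[unfolded tableau_rule_def, THEN conjunct1, rule_format, of p a q b, THEN conjunct1]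
      assms(2-) by blast
  then show "rank a \<le> rank b"
    by (simp add: less_eq_letter_def)
  show "p = q" if eq: "rank a = rank b" and parity: "even (rank a)"
  proof (cases a)
    case (Primed i)
    have ba: "a = Primed i" "b = Primed i"
      using eq Primed by (auto simp: rank_inject simp del: rank.simps)
    then show ?thesis
      using assms(1)[unfolded tableau_rule_def, THEN conjunct2, THEN conjunct2, rule_format, of p i q]
        assms(2-) ba by auto
  qed (use parity in auto)
qed

lemma tableau_rule_colD:
  assumes "tableau_rule reg T" "T p = Some (Letter a)" "T q = Some (Letter b)"
    and "(x, y) \<in> reg p" "(x, y') \<in> reg q" "y \<le> y'"
  shows "rank a \<le> rank b" and "rank a = rank b \<Longrightarrow> odd (rank a) \<Longrightarrow> p = q"
proof -
  have "a \<le> b"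
    using assms(1)[unfolded tableau_rule_def, THEN conjunct1, rule_format, of p a q b, THEN conjunct2]
      assms(2-) by blast
  then show "rank a \<le> rank b"
    by (simp add: less_eq_letter_def)
  show "p = q" if eq: "rank a = rank b" and parity: "odd (rank a)"
  proof (cases a)
    case (Unprimed i)
    have ba: "a = Unprimed i" "b = Unprimed i"
      using eq Unprimed by (auto simp: rank_inject simp del: rank.simps)
    then show ?thesis
      using assms(1)[unfolded tableau_rule_def, THEN conjunct2, THEN conjunct1, rule_format, of p i q]
        assms(2-) ba by auto
  qed (use parity in auto)
qed

text \<open>For equal letters, time and geometry pull in opposite directions. For two primed letters
  in a row, the time order makes positions weakly decrease to the right while the geometry makes
  them weakly increase, so they agree and \<open>inj\<close> identifies the boxes. Unprimed letters
  in a column are dual. Allowing both \<open>pos p - 1\<close> and \<open>pos p\<close> covers cells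
  and dominoes at once.\<close>

lemma tableau_rule_timeI:
  fixes pos :: "'b \<Rightarrow> int" and reg :: "'b \<Rightarrow> cell set"
  defines "time \<equiv> \<lambda>p a. tm (nat (pos p)) (rank a)"
  assumes pos: "\<And>p a x y. T p = Some (Letter a) \<Longrightarrow> (x, y) \<in> reg p \<Longrightarrow>
      0 \<le> pos p \<and> int x - int y \<in> {pos p - 1, pos p}"
    and row: "\<And>p q a b x x' y. T p = Some (Letter a) \<Longrightarrow> T q = Some (Letter b) \<Longrightarrow>
      (x, y) \<in> reg p \<Longrightarrow> (x', y) \<in> reg q \<Longrightarrow> x \<le> x' \<Longrightarrow> time p a \<le> time q b"
    and col: "\<And>p q a b x y y'. T p = Some (Letter a) \<Longrightarrow> T q = Some (Letter b) \<Longrightarrow>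
      (x, y) \<in> reg p \<Longrightarrow> (x, y') \<in> reg q \<Longrightarrow> y \<le> y' \<Longrightarrow> time p a \<le> time q b"
    and disj: "\<And>p q a b x y. T p = Some (Letter a) \<Longrightarrow> T q = Some (Letter b) \<Longrightarrow>
      (x, y) \<in> reg p \<Longrightarrow> (x, y) \<in> reg q \<Longrightarrow> p = q"
    and inj: "\<And>p q a. T p = Some (Letter a) \<Longrightarrow> T q = Some (Letter a) \<Longrightarrow> pos p = pos q \<Longrightarrow> p = q"
  shows "tableau_rule reg T"
proof -
  have le: "rank a \<le> rank b" if "time p a \<le> time q b" for p q a b
    using that by (auto simp: time_def tm_def less_eq_prod_def)
  have primed: "p = q"
    if T: "T p = Some (Letter (Primed i))" "T q = Some (Letter (Primed i))"
      and xy: "(x, y) \<in> reg p" "(x', y) \<in> reg q" and "x \<le> x'" for p q i x x' y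
  proof (cases "x = x'")
    case False
    have "time p (Primed i) \<le> time q (Primed i)"
      using row T xy \<open>x \<le> x'\<close> by blast
    then have "pos q \<le> pos p"
      using pos[OF T(1) xy(1)] pos[OF T(2) xy(2)] by (auto simp: time_def tm_def less_eq_prod_def)
    moreover have "pos p \<le> pos q"
      using pos[OF T(1) xy(1)] pos[OF T(2) xy(2)] False \<open>x \<le> x'\<close> by auto
    ultimately have "pos p = pos q" by simp
    with T show ?thesis by (rule inj)
  qed (use disj T xy in blast)
  have unprimed: "p = q"
    if T: "T p = Some (Letter (Unprimed i))" "T q = Some (Letter (Unprimed i))"
      and xy: "(x, y) \<in> reg p" "(x, y') \<in> reg q" and "y \<le> y'" for p q i x y y'
  proof (cases "y = y'")
    case False
    have "time p (Unprimed i) \<le> time q (Unprimed i)"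
      using col T xy \<open>y \<le> y'\<close> by blast
    then have "pos p \<le> pos q"
      using pos[OF T(1) xy(1)] pos[OF T(2) xy(2)] by (auto simp: time_def tm_def less_eq_prod_def)
    moreover have "pos q \<le> pos p"
      using pos[OF T(1) xy(1)] pos[OF T(2) xy(2)] False \<open>y \<le> y'\<close> by auto
    ultimately have "pos p = pos q" by simp
    with T show ?thesis by (rule inj)
  qed (use disj T xy in blast)
  show ?thesis
    unfolding tableau_rule_def less_eq_letter_def
  proof (intro conjI allI impI; (elim conjE)?)
    fix p q a b x x' y assume "T p = Some (Letter a)" "T q = Some (Letter b)"
      "(x, y) \<in> reg p" "(x', y) \<in> reg q" "x \<le> x'"
    then show "rank a \<le> rank b" by (rule le[OF row])
  next
    fix p q a b x y y' assume "T p = Some (Letter a)" "T q = Some (Letter b)"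
      "(x, y) \<in> reg p" "(x, y') \<in> reg q" "y \<le> y'"
    then show "rank a \<le> rank b" by (rule le[OF col])
  next
    fix p q i x y y' assume "T p = Some (Letter (Unprimed i))" "T q = Some (Letter (Unprimed i))"
      "(x, y) \<in> reg p" "(x, y') \<in> reg q"
    then show "p = q" using unprimed[of p i q x y y'] unprimed[of q i p x y' y] nat_le_linear[of y y'] by blast
  next
    fix p q i x x' y assume "T p = Some (Letter (Primed i))" "T q = Some (Letter (Primed i))"
      "(x, y) \<in> reg p" "(x', y) \<in> reg q"
    then show "p = q" using primed[of p i q x y x'] primed[of q i p x' y x] nat_le_linear[of x x'] by blast
  qed
qed

text \<open>A family \<open>R\<close> records the ranks of the letters on each diagonal. The gap \<open>g\<close> is 1 for Young
  tableaux and 2 for domino tableaux.\<close>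

definition families :: "nat \<Rightarrow> (nat \<Rightarrow> nat) \<Rightarrow> (nat \<Rightarrow> nat set) set" where
  "families g n = {R. \<forall>i. finite (R i) \<and> card (R i) = n i \<and> (\<forall>r\<in>R i. 2 \<le> r) \<and>
     interlacing (R i) (R (i + g))}"

definition family_weight :: "(nat \<Rightarrow> nat set) \<Rightarrow> monomial" where
  "family_weight R = image_mset (\<lambda>(i, r). r div 2) (mset_set {(i, r). r \<in> R i})"

definition ranks_at :: "('b \<Rightarrow> int) \<Rightarrow> ('b \<rightharpoonup> entry) \<Rightarrow> nat \<Rightarrow> nat set" where
  "ranks_at pos T i = {rank a | a. \<exists>p. T p = Some (Letter a) \<and> pos p = int i}"

text \<open>A labelled box is recovered from its position and letter, so reindexing the multiset by
  these pairs changes no multiplicity.\<close>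

lemma weight_eq_family_weight:
  assumes pos: "\<And>p a. T p = Some (Letter a) \<Longrightarrow> 0 \<le> pos p"
    and inj: "\<And>p q a. T p = Some (Letter a) \<Longrightarrow> T q = Some (Letter a) \<Longrightarrow> pos p = pos q \<Longrightarrow> p = q"
  shows "weight T = family_weight (ranks_at pos T)"
proof -
  let ?h = "\<lambda>p. (nat (pos p), rank (letter_of (the (T p))))"
  have "inj_on ?h (letters T)"
  proof (rule inj_onI)
    fix p q assume "p \<in> letters T" "q \<in> letters T" and eq: "?h p = ?h q"
    then obtain a b where ab: "T p = Some (Letter a)" "T q = Some (Letter b)"
      by (auto simp: letters_def)
    with eq have "a = b" "pos p = pos q"
      using pos[OF ab(1)] pos[OF ab(2)] by (auto simp: rank_inject)
    with ab show "p = q" using inj by blast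
  qed
  moreover have "?h ` letters T = {(i, r). r \<in> ranks_at pos T i}"
    using pos by (force simp: letters_def ranks_at_def)
  ultimately have "mset_set {(i, r). r \<in> ranks_at pos T i} = image_mset ?h (mset_set (letters T))"
    by (simp add: image_mset_mset_set)
  then show ?thesis
    by (simp add: weight_def family_weight_def index_eq_rank_div_2 image_mset.compositionality comp_def)
qed

section \<open>Diagonals of a diagram and their growth in time\<close>

lemma sorted_nth_mono: "sorted_wrt (\<ge>) (mu :: nat list) \<Longrightarrow> i \<le> j \<Longrightarrow> j < length mu \<Longrightarrow> mu ! j \<le> mu ! i"
  by (cases "i = j") (auto simp: sorted_wrt_iff_nth_less)

lemma diagram_downward:
  assumes "sorted_wrt (\<ge>) mu" "(x, y) \<in> diagram mu" "x' \<le> x" "y' \<le> y"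
  shows "(x', y') \<in> diagram mu"
  using assms sorted_nth_mono[OF assms(1), of y' y] by (auto simp: diagram_def)

lemma mem_iff_less_card:
  assumes "finite S" "\<And>y z :: nat. y \<in> S \<Longrightarrow> z \<le> y \<Longrightarrow> z \<in> S"
  shows "y \<in> S \<longleftrightarrow> y < card S"
proof
  assume "y \<in> S"
  then have "card {..y} \<le> card S"
    using assms by (intro card_mono) auto
  then show "y < card S" by simp
next
  assume *: "y < card S"
  show "y \<in> S"
  proof (rule ccontr)
    assume "y \<notin> S"
    then have "S \<subseteq> {..<y}"
      using assms(2) by (meson lessThan_iff linorder_not_le subsetI)
    then have "card S \<le> y"
      using card_mono[of "{..<y}" S] by simp
    with * show False by simp
  qed
qed

definition diag_length :: "nat list \<Rightarrow> nat \<Rightarrow> nat" where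
  "diag_length mu c = card {y. (c + y, y) \<in> diagram mu}"

lemma mem_diagram_iff:
  assumes "sorted_wrt (\<ge>) mu"
  shows "(c + y, y) \<in> diagram mu \<longleftrightarrow> y < diag_length mu c"
proof -
  have "finite {y. (c + y, y) \<in> diagram mu}"
    by (rule finite_subset[of _ "{..<length mu}"]) (auto simp: diagram_def)
  moreover have "(c + z, z) \<in> diagram mu" if "(c + y, y) \<in> diagram mu" "z \<le> y" for y z
    using diagram_downward[OF assms that(1), of "c + z" z] that(2) by simp
  ultimately show ?thesis
    unfolding diag_length_def
    by (subst mem_iff_less_card[symmetric]) blast+
qed

text \<open>The common skeleton of both kinds of tableaux: \<open>f c y\<close> plays the role of
  the time of cell \<open>(c + y, y)\<close>. Row and column steps are weak because the two cells of
  a domino share a time; the diagonal step is strict because a domino never contains two cells of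
  one diagonal.\<close>

locale growing_diagonals =
  fixes d :: "nat \<Rightarrow> nat" and f :: "nat \<Rightarrow> nat \<Rightarrow> time"
  assumes right: "y < d (Suc c) \<Longrightarrow> y < d c \<and> f c y \<le> f (Suc c) y"
    and above: "Suc y < d c \<Longrightarrow> y < d (Suc c) \<and> f (Suc c) y \<le> f c (Suc y)"
    and diagonal: "Suc y < d c \<Longrightarrow> f c y < f c (Suc y)"
begin

abbreviation times :: "nat \<Rightarrow> time set" where
  "times c \<equiv> f c ` {..<d c}"

lemma strict_mono_on_diagonal: "strict_mono_on {..<d c} (f c)"
proof (rule strict_mono_onI)
  fix y z assume "z \<in> {..<d c}" "y < z"
  then show "f c y < f c z"
  proof (induction z)
    case (Suc z)
    then show ?case
      using diagonal[of z c] by (cases "y = z") (auto intro: less_trans)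
  qed simp
qed

lemma below_times: "y < d c \<Longrightarrow> below (times c) (f c y) = y"
  by (rule below_strict_mono_image[OF strict_mono_on_diagonal])

lemma card_times: "card (times c) = d c"
  using strict_mono_on_imp_inj_on[OF strict_mono_on_diagonal] by (simp add: card_image)

lemma below_times_le:
  "below (times (Suc c)) t \<le> below (times c) t" "below (times c) t \<le> Suc (below (times (Suc c)) t)"
proof -
  have "below (times (Suc c)) t \<le> below (times c) t + 0"
    by (rule below_image_le[OF strict_mono_on_diagonal strict_mono_on_diagonal])
      (use right in simp)
  then show "below (times (Suc c)) t \<le> below (times c) t" by simp
  have "below (times c) t \<le> below (times (Suc c)) t + 1"
    by (rule below_image_le[OF strict_mono_on_diagonal strict_mono_on_diagonal])
      (use above in simp)
  then show "below (times c) t \<le> Suc (below (times (Suc c)) t)" by simp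
qed

end

section \<open>Shifted Young tableaux\<close>

definition offset :: "cell \<Rightarrow> int" where
  "offset p = int (fst p) - int (snd p)"

lemma families_times_le:
  assumes "R \<in> families g n" "0 < g"
  shows "below (tm (i + g) ` R (i + g)) t \<le> below (tm i ` R i) t"
    and "below (tm i ` R i) t \<le> Suc (below (tm (i + g) ` R (i + g)) t)"
proof -
  have "finite (R i)" "finite (R (i + g))" "interlacing (R i) (R (i + g))"
    using assms(1) by (simp_all add: families_def)
  then have "\<forall>t. below (tm (i + g) ` R (i + g)) t \<le> below (tm i ` R i) t \<and>
      below (tm i ` R i) t \<le> Suc (below (tm (i + g) ` R (i + g)) t)"
    using interlacing_iff[of "R i" "R (i + g)" i "i + g"] assms(2) by simp
  then show "below (tm (i + g) ` R (i + g)) t \<le> below (tm i ` R i) t"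
    and "below (tm i ` R i) t \<le> Suc (below (tm (i + g) ` R (i + g)) t)"
    by blast+
qed

lemma young_cell_label:
  assumes "t \<in> shifted_young_tableaux mu"
  shows "(\<exists>a. t (x, y) = Some (Letter a)) \<longleftrightarrow> (x, y) \<in> diagram mu \<and> y \<le> x"
proof -
  consider "(x, y) \<notin> diagram mu" | "(x, y) \<in> up mu" "x < y" | "(x, y) \<in> down mu" "y \<le> x" "(x, y) \<in> diagram mu"
    by (fastforce simp: down_def up_def diag_def)
  then show ?thesis
  proof cases
    case 1
    then have "(x, y) \<notin> dom t"
      using assms by (simp add: shifted_young_tableaux_def)
    with 1 show ?thesis by (simp add: domIff)
  next
    case 2
    then have "t (x, y) = Some X"
      using assms by (simp add: shifted_young_tableaux_def)
    with 2 show ?thesis by simp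
  next
    case 3
    then have "\<exists>a\<in>alphabet. t (x, y) = Some (Letter a)"
      using assms by (simp add: shifted_young_tableaux_def)
    with 3 show ?thesis by blast
  qed
qed

text \<open>Equal neighbours in a row are unprimed and equal neighbours in a column are primed; in
  both cases \<open>tm\<close> breaks the tie in the required direction. A step to the right
  followed by a step up gives strict growth on a diagonal.\<close>

lemma young_growing_diagonals:
  assumes t: "t \<in> shifted_young_tableaux mu" and mu: "sorted_wrt (\<ge>) mu"
  defines "f \<equiv> \<lambda>c y. tm c (rank (letter_of (the (t (c + y, y)))))"
  shows "growing_diagonals (diag_length mu) f"
    and "f c ` {..<diag_length mu c} = tm c ` ranks_at offset t c"
proof -
  have rule: "tableau_rule (\<lambda>c. {c}) t"
    using t by (simp add: shifted_young_tableaux_def)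
  have lab: "\<exists>a. t (c + y, y) = Some (Letter a) \<and> f c y = tm c (rank a)"
    if "y < diag_length mu c" for c y
    using young_cell_label[OF t, of "c + y" y] that mem_diagram_iff[OF mu, of c y]
    by (auto simp: f_def)
  have right: "y < diag_length mu c \<and> f c y < f (Suc c) y" if prem: "y < diag_length mu (Suc c)" for c y
  proof -
    have y: "y < diag_length mu c"
      using that diagram_downward[OF mu, of "Suc c + y" y "c + y" y]
      by (simp flip: mem_diagram_iff[OF mu])
    obtain a b where a: "t (c + y, y) = Some (Letter a)" "f c y = tm c (rank a)"
      and b: "t (Suc c + y, y) = Some (Letter b)" "f (Suc c) y = tm (Suc c) (rank b)"
      using lab[OF y] lab[OF prem] by blast
    have "rank a \<le> rank b" "rank a = rank b \<Longrightarrow> odd (rank a)"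
      using tableau_rule_rowD[OF rule a(1) b(1), of "c + y" y "Suc c + y"] by auto
    then show ?thesis
      using y a(2) b(2) by (cases "rank a = rank b") (auto simp: tm_def less_prod_def)
  qed
  have above: "y < diag_length mu (Suc c) \<and> f (Suc c) y < f c (Suc y)"
    if prem: "Suc y < diag_length mu c" for c y
  proof -
    have y: "y < diag_length mu (Suc c)"
      using that diagram_downward[OF mu, of "c + Suc y" "Suc y" "Suc c + y" y]
      by (simp flip: mem_diagram_iff[OF mu])
    obtain a b where a: "t (Suc c + y, y) = Some (Letter a)" "f (Suc c) y = tm (Suc c) (rank a)"
      and b: "t (c + Suc y, Suc y) = Some (Letter b)" "f c (Suc y) = tm c (rank b)"
      using lab[OF y] lab[OF prem] by blast
    have "rank a \<le> rank b" "rank a = rank b \<Longrightarrow> even (rank a)"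
      using tableau_rule_colD[OF rule a(1) b(1), of "Suc c + y" y "Suc y"] by auto
    then show ?thesis
      using y a(2) b(2) by (cases "rank a = rank b") (auto simp: tm_def less_prod_def)
  qed
  show "growing_diagonals (diag_length mu) f"
  proof
    show "y < diag_length mu c \<and> f c y \<le> f (Suc c) y" if "y < diag_length mu (Suc c)" for c y
      using right[OF that] by (simp add: less_imp_le)
    show "y < diag_length mu (Suc c) \<and> f (Suc c) y \<le> f c (Suc y)" if "Suc y < diag_length mu c" for c y
      using above[OF that] by (simp add: less_imp_le)
    show "f c y < f c (Suc y)" if "Suc y < diag_length mu c" for c y
      using above[OF that] right[of y c] by (auto intro: less_trans)
  qed
  show "f c ` {..<diag_length mu c} = tm c ` ranks_at offset t c"
  proof (intro equalityI subsetI)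
    fix u assume "u \<in> f c ` {..<diag_length mu c}"
    then obtain y where "y < diag_length mu c" "u = f c y" by auto
    then obtain a where a: "t (c + y, y) = Some (Letter a)" "u = tm c (rank a)"
      using lab by blast
    then have "rank a \<in> ranks_at offset t c"
      unfolding ranks_at_def offset_def
      by (intro CollectI exI[of _ a] conjI exI[of _ "(c + y, y)"]) auto
    with a show "u \<in> tm c ` ranks_at offset t c" by blast
  next
    fix u assume "u \<in> tm c ` ranks_at offset t c"
    then obtain a p where "t p = Some (Letter a)" "offset p = int c" "u = tm c (rank a)"
      unfolding ranks_at_def by blast
    then obtain x y where a: "t (x, y) = Some (Letter a)" "int x - int y = int c" "u = tm c (rank a)"
      by (cases p) (auto simp: offset_def)
    then have x: "x = c + y" by simp
    have "y < diag_length mu c"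
      using young_cell_label[OF t, of x y] a x mem_diagram_iff[OF mu, of c y] by auto
    then show "u \<in> f c ` {..<diag_length mu c}"
      by (intro image_eqI[of _ _ y]) (use a x in \<open>simp_all add: f_def\<close>)
  qed
qed

lemma ranks_at_young:
  assumes t: "t \<in> shifted_young_tableaux mu" and mu: "sorted_wrt (\<ge>) mu"
  shows "ranks_at offset t \<in> families 1 (diag_length mu)"
proof -
  define f where "f \<equiv> \<lambda>c y. tm c (rank (letter_of (the (t (c + y, y)))))"
  interpret growing_diagonals "diag_length mu" f
    unfolding f_def by (rule young_growing_diagonals[OF t mu])
  have times: "times c = tm c ` ranks_at offset t c" for c
    unfolding f_def by (rule young_growing_diagonals(2)[OF t mu])
  have fin: "finite (ranks_at offset t c)" for c
    by (rule finite_imageD[OF _ inj_on_tm[of c]]) (simp flip: times)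
  have "card (ranks_at offset t c) = diag_length mu c" for c
    using card_times[of c] unfolding times by (simp add: card_image[OF inj_on_tm])
  moreover have "2 \<le> r" if r: "r \<in> ranks_at offset t c" for r c
  proof -
    obtain a p where "t p = Some (Letter a)" "r = rank a"
      using r unfolding ranks_at_def by blast
    then obtain x y where a: "t (x, y) = Some (Letter a)" "r = rank a"
      by (cases p) auto
    then have "(x, y) \<in> down mu"
      using young_cell_label[OF t, of x y] by (auto simp: down_def up_def diag_def)
    with t a show ?thesis
      by (force simp: shifted_young_tableaux_def simp flip: mem_alphabet_iff)
  qed
  moreover have "interlacing (ranks_at offset t c) (ranks_at offset t (c + 1))" for c
    using below_times_le[of c] interlacing_iff[OF fin fin, of c "Suc c"] unfolding times by auto
  ultimately show ?thesis
    using fin by (auto simp: families_def)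
qed

text \<open>The cell at height \<open>y\<close> of a diagonal carries the \<open>y\<close>-th
  smallest time of that diagonal, counted from 0, so the sets determine the letters; the other
  entries depend on \<open>mu\<close> alone.\<close>

lemma ranks_at_young_inj:
  assumes t: "t \<in> shifted_young_tableaux mu" and t': "t' \<in> shifted_young_tableaux mu"
    and mu: "sorted_wrt (\<ge>) mu" and eq: "ranks_at offset t = ranks_at offset t'"
  shows "t = t'"
proof
  fix p :: cell
  obtain x y where p: "p = (x, y)" by (cases p)
  let ?f = "\<lambda>t c y. tm c (rank (letter_of (the (t (c + y, y)))))"
  note gd = young_growing_diagonals(1)[OF t mu] young_growing_diagonals(1)[OF t' mu]
  show "t p = t' p"
  proof (cases "p \<in> diagram mu \<and> y \<le> x")
    case True
    define c where "c = x - y"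
    have x: "x = c + y" and y: "y < diag_length mu c"
      using True p mem_diagram_iff[OF mu, of c y] by (auto simp: c_def)
    let ?S = "tm c ` ranks_at offset t c"
    have S: "?f t c ` {..<diag_length mu c} = ?S" "?f t' c ` {..<diag_length mu c} = ?S"
      using young_growing_diagonals(2)[OF t mu, of c] young_growing_diagonals(2)[OF t' mu, of c] eq
      by simp_all
    have "below ?S (?f t c y) = y" "below ?S (?f t' c y) = y"
      using growing_diagonals.below_times[OF gd(1) y] growing_diagonals.below_times[OF gd(2) y]
      unfolding S .
    moreover have "?f t c y \<in> ?S" "?f t' c y \<in> ?S"
      using y S by blast+
    moreover have "finite ?S"
      unfolding S(1)[symmetric] by simp
    ultimately have "?f t c y = ?f t' c y"
      by (metis below_eqD)
    moreover obtain a a' where "t p = Some (Letter a)" "t' p = Some (Letter a')"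
      using young_cell_label[OF t, of x y] young_cell_label[OF t', of x y] True p by auto
    ultimately show ?thesis
      by (auto simp: p x rank_inject)
  next
    case False
    have "t p = (if p \<in> diagram mu then Some X else None)" if "t \<in> shifted_young_tableaux mu" for t
    proof (cases "p \<in> diagram mu")
      case True
      then have "p \<in> up mu" using False p by (auto simp: up_def diag_def)
      with that True show ?thesis by (simp add: shifted_young_tableaux_def)
    next
      case nmem: False
      then have "p \<notin> dom t" using that by (simp add: shifted_young_tableaux_def)
      with nmem show ?thesis by (simp add: domIff)
    qed
    from this[OF t] this[OF t'] show ?thesis by simp
  qed
qed

text \<open>The candidate sorts each set along its diagonal, \<open>el c y\<close> being the element
  with exactly \<open>y\<close> earlier ones. Neighbouring cells are compared by
  \<open>equal_height_le\<close>, distant ones through intermediate cells, which lie in the diagram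
  by downward closure.\<close>

lemma ranks_at_young_surj:
  assumes R: "R \<in> families 1 (diag_length mu)" and mu: "sorted_wrt (\<ge>) mu"
  obtains t where "t \<in> shifted_young_tableaux mu" "ranks_at offset t = R"
proof -
  let ?S = "\<lambda>c. tm c ` R c"
  have fin: "finite (R c)" and cardR: "card (R c) = diag_length mu c" and two: "r \<in> R c \<Longrightarrow> 2 \<le> r" for c r
    using R by (auto simp: families_def)
  have cardS: "card (?S c) = diag_length mu c" for c
    using cardR by (simp add: card_image[OF inj_on_tm])
  define el where "el c y = (SOME r. r \<in> R c \<and> below (?S c) (tm c r) = y)" for c y
  have el: "el c y \<in> R c" "below (?S c) (tm c (el c y)) = y" if "y < diag_length mu c" for c y
  proof -
    have "\<exists>r. r \<in> R c \<and> below (?S c) (tm c r) = y"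
      using ex_below_eq[of "?S c" y] that fin cardS by (metis finite_imageI imageE)
    from someI_ex[OF this] show "el c y \<in> R c" "below (?S c) (tm c (el c y)) = y"
      by (auto simp: el_def)
  qed
  define t where "t p = (if p \<notin> diagram mu then None else if fst p < snd p then Some X
    else Some (Letter (letter_of_rank (el (fst p - snd p) (snd p)))))" for p
  have lab: "t (x, y) = Some (Letter a) \<longleftrightarrow>
      (\<exists>c. x = c + y \<and> y < diag_length mu c \<and> a = letter_of_rank (el c y))" for x y a
  proof (cases "y \<le> x")
    case True
    then obtain c where "x = c + y" by (metis le_add_diff_inverse2)
    then show ?thesis
      using mem_diagram_iff[OF mu, of c y] by (auto simp: t_def)
  qed (auto simp: t_def)
  define s where "s c y = tm c (el c y)" for c y
  have step: "below (?S (Suc c)) u \<le> below (?S c) u" "below (?S c) u \<le> Suc (below (?S (Suc c)) u)" for c u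
    using families_times_le[OF R, of c u] by simp_all
  have row1: "s c y \<le> s (Suc c) y" if "y < diag_length mu (Suc c)" "y < diag_length mu c" for c y
    unfolding s_def
    by (rule equal_height_le[of "?S c" "?S (Suc c)" 0 0]) (use that step el fin in auto)
  \<comment> \<open>The offset 1 accounts for \<open>(c, Suc y)\<close> being one row above
    \<open>(Suc c, y)\<close>.\<close>
  have col1: "s (Suc c) y \<le> s c (Suc y)" if "y < diag_length mu (Suc c)" "Suc y < diag_length mu c" for c y
    unfolding s_def
    by (rule equal_height_le[of "?S (Suc c)" "?S c" 0 1]) (use that step el fin in auto)
  have row: "s c y \<le> s (c + k) y" if "y < diag_length mu (c + k)" for c k y
    using that
  proof (induction k)
    case (Suc k)
    then have "(c + Suc k + y, y) \<in> diagram mu"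
      using mem_diagram_iff[OF mu, of "c + Suc k" y] by simp
    then have "(c + k + y, y) \<in> diagram mu"
      by (rule diagram_downward[OF mu]) auto
    then have "y < diag_length mu (c + k)"
      using mem_diagram_iff[OF mu, of "c + k" y] by simp
    with Suc row1[of y "c + k"] show ?case by auto
  qed simp
  have col: "s (c + k) y \<le> s c (y + k)" if "y + k < diag_length mu c" for c k y
    using that
  proof (induction k arbitrary: c)
    case (Suc k)
    then have "(c + (y + Suc k), y + Suc k) \<in> diagram mu"
      using mem_diagram_iff[OF mu, of c "y + Suc k"] by simp
    then have "(Suc c + (y + k), y + k) \<in> diagram mu"
      by (rule diagram_downward[OF mu]) auto
    then have "y + k < diag_length mu (Suc c)"
      using mem_diagram_iff[OF mu, of "Suc c" "y + k"] by simp
    with Suc.IH[of "Suc c"] Suc.prems col1[of "y + k" c] show ?case by auto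
  qed simp
  have time: "s c y = tm (nat (offset (x, y))) (rank a)" if "x = c + y" "a = letter_of_rank (el c y)" for c x y a
    using that by (simp add: s_def offset_def)
  have "tableau_rule (\<lambda>c. {c}) t"
  proof (rule tableau_rule_timeI[where pos = offset])
    fix p a x y assume "t p = Some (Letter a)" "(x, y) \<in> {p}"
    then show "0 \<le> offset p \<and> int x - int y \<in> {offset p - 1, offset p}"
      by (auto simp: lab offset_def)
  next
    fix p q a b x x' y
    assume *: "t p = Some (Letter a)" "t q = Some (Letter b)" "(x, y) \<in> {p}" "(x', y) \<in> {q}" "x \<le> x'"
    then obtain c c' where c: "x = c + y" "a = letter_of_rank (el c y)"
      and c': "x' = c' + y" "b = letter_of_rank (el c' y)" and "y < diag_length mu c'"
      by (auto simp: lab)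
    then show "tm (nat (offset p)) (rank a) \<le> tm (nat (offset q)) (rank b)"
      using row[of y c "c' - c"] time[OF c] time[OF c'] * by auto
  next
    fix p q a b x y y'
    assume *: "t p = Some (Letter a)" "t q = Some (Letter b)" "(x, y) \<in> {p}" "(x, y') \<in> {q}" "y \<le> y'"
    obtain c where c: "x = c + y" "a = letter_of_rank (el c y)"
      using *(1,3) lab[of x y a] by auto
    moreover obtain c' where c': "x = c' + y'" "b = letter_of_rank (el c' y')"
      and "y' < diag_length mu c'"
      using *(2,4) lab[of x y' b] by auto
    moreover have "c = c' + (y' - y)" "y' = y + (y' - y)"
      using c c' * by auto
    ultimately show "tm (nat (offset p)) (rank a) \<le> tm (nat (offset q)) (rank b)"
      using col[of y "y' - y" c'] time[OF c] time[OF c'] * by auto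
  next
    fix p q a assume *: "t p = Some (Letter a)" "t q = Some (Letter a)" "offset p = offset q"
    obtain x y x' y' where pq: "p = (x, y)" "q = (x', y')" by (cases p; cases q)
    then obtain c c' where c: "x = c + y" "a = letter_of_rank (el c y)" "y < diag_length mu c"
      and c': "x' = c' + y'" "a = letter_of_rank (el c' y')" "y' < diag_length mu c'"
      using * by (auto simp: lab)
    have "c = c'" using *(3) pq c(1) c'(1) by (simp add: offset_def)
    note c' = c'[folded \<open>c = c'\<close>]
    have "el c y = el c y'"
      using c(2) c'(2) by (metis rank_letter_of_rank)
    then have "y = y'"
      using el(2)[OF c(3)] el(2)[OF c'(3)] by metis
    with c(1) c'(1) show "p = q" by (simp add: pq)
  qed auto
  moreover have "dom t = diagram mu"
    by (auto simp: t_def domIff split: if_splits)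
  moreover have "t p = Some X" if "p \<in> up mu" for p
    using that by (auto simp: t_def up_def diag_def)
  moreover have "\<exists>a\<in>alphabet. t p = Some (Letter a)" if p: "p \<in> down mu" for p
  proof -
    obtain x y where xy: "p = (x, y)" by (cases p)
    define c where "c = x - y"
    have x: "x = c + y" and "(c + y, y) \<in> diagram mu"
      using p by (auto simp: xy c_def down_def up_def diag_def)
    then have y: "y < diag_length mu c"
      by (simp add: mem_diagram_iff[OF mu])
    then have "t p = Some (Letter (letter_of_rank (el c y)))"
      using x by (auto simp: xy lab)
    moreover have "letter_of_rank (el c y) \<in> alphabet"
      using two[OF el(1)[OF y]] by (simp add: mem_alphabet_iff)
    ultimately show ?thesis by blast
  qed
  ultimately have "t \<in> shifted_young_tableaux mu"
    by (simp add: shifted_young_tableaux_def)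
  moreover have "ranks_at offset t = R"
  proof
    fix c
    show "ranks_at offset t c = R c"
    proof (intro equalityI subsetI)
      fix r assume "r \<in> ranks_at offset t c"
      then show "r \<in> R c"
        using el(1) by (auto simp: ranks_at_def offset_def lab)
    next
      fix r assume r: "r \<in> R c"
      define y where "y = below (?S c) (tm c r)"
      have y: "y < diag_length mu c"
        using below_less_card[of "?S c" "tm c r"] fin r cardS by (simp add: y_def)
      have "tm c (el c y) = tm c r"
        by (rule below_eqD[of "?S c"]) (use fin el[OF y] r in \<open>auto simp: y_def\<close>)
      then have "t (c + y, y) = Some (Letter (letter_of_rank r))"
        using y by (auto simp: lab)
      then show "r \<in> ranks_at offset t c"
        unfolding ranks_at_def offset_def
        by (intro CollectI exI[of _ "letter_of_rank r"] conjI exI[of _ "(c + y, y)"]) auto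
    qed
  qed
  ultimately show thesis by (rule that)
qed

lemma weight_young:
  assumes t: "t \<in> shifted_young_tableaux mu" and mu: "sorted_wrt (\<ge>) mu"
  shows "weight t = family_weight (ranks_at offset t)"
proof (rule weight_eq_family_weight)
  fix p a assume "t p = Some (Letter a)"
  then show "0 \<le> offset p"
    using young_cell_label[OF t, of "fst p" "snd p"] by (auto simp: offset_def)
next
  fix p q a assume *: "t p = Some (Letter a)" "t q = Some (Letter a)" "offset p = offset q"
  obtain x y x' y' where pq: "p = (x, y)" "q = (x', y')" by (cases p; cases q)
  define c where "c = x - y"
  have "(x, y) \<in> diagram mu \<and> y \<le> x" "(x', y') \<in> diagram mu \<and> y' \<le> x'"
    using young_cell_label[OF t, of x y] young_cell_label[OF t, of x' y'] * pq by auto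
  moreover from this have "x = c + y" "x' = c + y'"
    using *(3) pq by (auto simp: offset_def c_def)
  ultimately have c: "x = c + y" "y < diag_length mu c" "x' = c + y'" "y' < diag_length mu c"
    using mem_diagram_iff[OF mu, of c y] mem_diagram_iff[OF mu, of c y']
    by auto
  note gd = young_growing_diagonals(1)[OF t mu]
  have "y = y'"
    using growing_diagonals.below_times[OF gd c(2)] growing_diagonals.below_times[OF gd c(4)] * pq c
    by simp
  with c show "p = q" by (simp add: pq)
qed

lemma bij_betw_card_filter:
  assumes "bij_betw h A B" "\<And>x. x \<in> A \<Longrightarrow> w x = w' (h x)"
  shows "card {x \<in> A. w x = m} = card {y \<in> B. w' y = m}"
proof (rule bij_betw_same_card)
  show "bij_betw h {x \<in> A. w x = m} {y \<in> B. w' y = m}"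
    using assms by (auto simp: bij_betw_def intro: inj_on_subset)
qed

lemma bij_betw_young:
  assumes mu: "sorted_wrt (\<ge>) mu"
  shows "bij_betw (ranks_at offset) (shifted_young_tableaux mu) (families 1 (diag_length mu))"
  unfolding bij_betw_def
proof
  show "inj_on (ranks_at offset) (shifted_young_tableaux mu)"
    using ranks_at_young_inj[OF _ _ mu] by (auto intro: inj_onI)
  show "ranks_at offset ` shifted_young_tableaux mu = families 1 (diag_length mu)"
  proof (intro equalityI subsetI)
    fix R assume "R \<in> families 1 (diag_length mu)"
    then obtain t where t: "t \<in> shifted_young_tableaux mu" "ranks_at offset t = R"
      by (rule ranks_at_young_surj[OF _ mu])
    then show "R \<in> ranks_at offset ` shifted_young_tableaux mu"
      by (intro image_eqI[of _ _ t]) auto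
  qed (use ranks_at_young[OF _ mu] in auto)
qed

lemma Q_eq_card_families:
  assumes "sorted_wrt (\<ge>) mu"
  shows "Q mu m = int (card {R \<in> families 1 (diag_length mu). family_weight R = m})"
    and "finite {R \<in> families 1 (diag_length mu). family_weight R = m}"
proof -
  show "Q mu m = int (card {R \<in> families 1 (diag_length mu). family_weight R = m})"
    unfolding Q_def gen_series_def
    using bij_betw_card_filter[OF bij_betw_young[OF assms], of weight family_weight m]
      weight_young[OF _ assms] by simp
  have "{R \<in> families 1 (diag_length mu). family_weight R = m}
      \<subseteq> ranks_at offset ` {t \<in> shifted_young_tableaux mu. weight t = m}"
  proof clarify
    fix R assume R: "R \<in> families 1 (diag_length mu)" and m: "m = family_weight R"
    from R obtain t where t: "t \<in> shifted_young_tableaux mu" "ranks_at offset t = R"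
      by (rule ranks_at_young_surj[OF _ assms])
    then have "weight t = family_weight R"
      using weight_young[OF t(1) assms] by simp
    with t show "R \<in> ranks_at offset ` {t \<in> shifted_young_tableaux mu. weight t = family_weight R}"
      by (intro image_eqI[of _ _ t]) auto
  qed
  then show "finite {R \<in> families 1 (diag_length mu). family_weight R = m}"
    by (rule finite_subset) (simp add: finite_shifted_young_tableaux)
qed

section \<open>Pavings obtained by inserting dominoes\<close>

text \<open>Here \<open>A i\<close> is the set of insertion times of the dominoes at position \<open>i\<close>, those whose two cells
  have offsets \<open>i - 1\<close> and \<open>i\<close>. The cell of offset \<open>c\<close> of a domino inserted at time \<open>t\<close> lies above
  \<open>nat (- c)\<close> rows in which there is no cell of this offset, and above the cells inserted before.\<close>

definition cell_at :: "int \<Rightarrow> nat \<Rightarrow> cell" where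
  "cell_at c y = (nat (c + int y), y)"

definition height :: "(int \<Rightarrow> time set) \<Rightarrow> int \<Rightarrow> time \<Rightarrow> nat" where
  "height A c t = nat (- c) + below (A c \<union> A (c + 1)) t"

definition domino_at :: "(int \<Rightarrow> time set) \<Rightarrow> int \<Rightarrow> time \<Rightarrow> cell set" where
  "domino_at A i t = {cell_at (i - 1) (height A (i - 1) t), cell_at i (height A i t)}"

text \<open>A domino covers two consecutive offsets. Recording the larger one makes the dominoes of
  nonnegative position exactly those that carry letters.\<close>

definition position :: "cell set \<Rightarrow> int" where
  "position d = Max (offset ` d)"

lemma cell_at_height_iff: "(x, y) = cell_at c (height A c t) \<longleftrightarrow> int x - int y = c \<and> height A c t = y"
  by (auto simp: cell_at_def height_def)

lemma mem_domino_at_iff: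
  "(x, y) \<in> domino_at A i t \<longleftrightarrow>
    int x - int y \<in> {i - 1, i} \<and> height A (int x - int y) t = y"
  unfolding domino_at_def insert_iff cell_at_height_iff by auto

lemma position_domino_at [simp]: "position (domino_at A i t) = i"
proof -
  have "offset (cell_at c (height A c t)) = c" for c
    by (auto simp: offset_def cell_at_def height_def)
  then show ?thesis
    by (simp add: position_def domino_at_def)
qed

lemma offset_image_domino:
  assumes "domino d" shows "offset ` d = {position d - 1, position d}"
  using assms by (auto simp: domino_def horizontal_domino_def vertical_domino_def position_def offset_def)

lemma domino_offset:
  assumes "domino d" "(x, y) \<in> d"
  shows "int x - int y \<in> {position d - 1, position d}"
  using offset_image_domino[OF assms(1)] assms(2) by (force simp: offset_def)

lemma ex_offset_domino:
  assumes "domino d" "c \<in> {position d - 1, position d}"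
  obtains x y where "(x, y) \<in> d" "int x - int y = c"
  using offset_image_domino[OF assms(1)] assms(2) by (force simp: offset_def)

lemma domino_offset_inj:
  assumes "domino d" "p \<in> d" "q \<in> d" "offset p = offset q"
  shows "p = q"
  using assms by (auto simp: domino_def horizontal_domino_def vertical_domino_def offset_def)

text \<open>The diagonals met by \<open>d\<close> have the consecutive indices
  \<open>- position d\<close> and \<open>1 - position d\<close>, one of them even. At position 0 the
  even index is 0, which still belongs to the lower part.\<close>

lemma mem_up_dominoes_iff:
  assumes "domino d"
  shows "d \<in> up_dominoes P \<longleftrightarrow> d \<in> P \<and> position d < 0"
proof -
  have diag: "diag p = - offset p" for p
    by (simp add: diag_def offset_def)
  have on: "on_diag d j \<longleftrightarrow> - j = position d \<or> - j = position d - 1" for j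
  proof -
    have "on_diag d j \<longleftrightarrow> - j \<in> offset ` d"
      unfolding on_diag_def diag by force
    then show ?thesis using offset_image_domino[OF assms] by auto
  qed
  have "(\<exists>k>0. on_diag d (2 * k)) \<longleftrightarrow> position d < 0"
    unfolding on by presburger
  then show ?thesis
    by (auto simp: up_dominoes_def)
qed

lemma vertical_domino_fst: "vertical_domino d \<Longrightarrow> p \<in> d \<Longrightarrow> q \<in> d \<Longrightarrow> fst p = fst q"
  by (auto simp: vertical_domino_def)

text \<open>At each time the heights describe the boundary of the cells inserted so far: as
  \<open>c\<close> grows they drop by 0 or 1 per step, like a lattice path bounding a diagram.
  Disjointness lets the time of a cell determine its domino, and the last assumption says that the
  growth ends in \<open>lam\<close>.\<close>

locale domino_growth =
  fixes lam :: "nat list" and A :: "int \<Rightarrow> time set"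
  assumes sorted: "sorted_wrt (\<ge>) lam"
    and finite_A: "finite (A i)"
    and disjoint_A: "A i \<inter> A (i + 1) = {}"
    and height_le: "height A (c + 1) t \<le> height A c t"
    and height_le_Suc: "height A c t \<le> Suc (height A (c + 1) t)"
    and mem_diagram: "(x, y) \<in> diagram lam \<longleftrightarrow>
      y < nat (int y - int x) + card (A (int x - int y) \<union> A (int x - int y + 1))"
begin

lemma cell_in_diagram:
  assumes "s \<in> A c \<union> A (c + 1)" "int x - int y = c" "height A c s = y"
  shows "(x, y) \<in> diagram lam"
  using below_less_card[of "A c \<union> A (c + 1)" s] assms finite_A
  by (auto simp: mem_diagram height_def)

lemma ex_time:
  assumes "(x, y) \<in> diagram lam"
  obtains s where "s \<in> A (int x - int y) \<union> A (int x - int y + 1)" "height A (int x - int y) s = y"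
proof -
  let ?S = "A (int x - int y) \<union> A (int x - int y + 1)"
  have "nat (int y - int x) \<le> y" by simp
  moreover have "y < nat (int y - int x) + card ?S"
    using assms by (simp only: mem_diagram)
  ultimately have "y - nat (int y - int x) < card ?S" by linarith
  then obtain s where "s \<in> ?S" "below ?S s = y - nat (int y - int x)"
    using ex_below_eq[of ?S] finite_A by (metis finite_UnI)
  then show thesis
    using that[of s] \<open>nat (int y - int x) \<le> y\<close> by (simp add: height_def)
qed

lemma height_eqD:
  assumes "s \<in> A c \<union> A (c + 1)" "s' \<in> A c \<union> A (c + 1)" "height A c s = height A c s'"
  shows "s = s'"
  by (rule below_eqD[of "A c \<union> A (c + 1)"]) (use assms finite_A in \<open>auto simp: height_def\<close>)

text \<open>For neighbouring cells of a row this is \<open>equal_height_le\<close> applied to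
  \<open>height_le\<close>. The induction passes through every intermediate cell of the row,
  whatever its domino carries.\<close>

lemma row_mono:
  assumes "x \<le> x'"
    and "s \<in> A (int x - int y) \<union> A (int x - int y + 1)" "height A (int x - int y) s = y"
    and "s' \<in> A (int x' - int y) \<union> A (int x' - int y + 1)" "height A (int x' - int y) s' = y"
  shows "s \<le> s'"
  using assms
proof (induction x' arbitrary: s' rule: dec_induct)
  case base
  then have "s = s'"
    by (metis height_eqD)
  then show ?case by simp
next
  case (step x')
  have S: "int (Suc x') - int y = int x' - int y + 1" by simp
  have "(Suc x', y) \<in> diagram lam"
    using cell_in_diagram[OF step.prems(3) _ step.prems(4)] by simp
  then have "(x', y) \<in> diagram lam"
    by (rule diagram_downward[OF sorted]) auto
  then obtain u where u: "u \<in> A (int x' - int y) \<union> A (int x' - int y + 1)"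
    "height A (int x' - int y) u = y"
    by (rule ex_time)
  have "s \<le> u"
    using step u by blast
  also have "u \<le> s'"
  proof (rule equal_height_le)
    show "nat (- (int x' - int y + 1)) + below (A (int x' - int y + 1) \<union> A (int x' - int y + 1 + 1)) t
        \<le> nat (- (int x' - int y)) + below (A (int x' - int y) \<union> A (int x' - int y + 1)) t" for t
      using height_le[of "int x' - int y" t] by (simp only: height_def)
  qed (use u step.prems finite_A in \<open>simp_all only: S height_def finite_Un simp_thms\<close>)
  finally show ?case .
qed

lemma col_mono:
  assumes "y \<le> y'"
    and "s \<in> A (int x - int y) \<union> A (int x - int y + 1)" "height A (int x - int y) s = y"
    and "s' \<in> A (int x - int y') \<union> A (int x - int y' + 1)" "height A (int x - int y') s' = y'"
  shows "s \<le> s'"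
  using assms
proof (induction y' arbitrary: s' rule: dec_induct)
  case base
  then have "s = s'"
    by (metis height_eqD)
  then show ?case by simp
next
  case (step y')
  define c where "c = int x - int (Suc y')"
  have S: "int x - int (Suc y') = c" "int x - int y' = c + 1" by (simp_all add: c_def)
  have "(x, Suc y') \<in> diagram lam"
    using cell_in_diagram[OF step.prems(3) _ step.prems(4)] by simp
  then have "(x, y') \<in> diagram lam"
    by (rule diagram_downward[OF sorted]) auto
  then obtain u where u: "u \<in> A (int x - int y') \<union> A (int x - int y' + 1)"
    "height A (int x - int y') u = y'"
    by (rule ex_time)
  have "s \<le> u"
    using step u by blast
  also have "u \<le> s'"
  proof (rule equal_height_le)
    show "nat (- c) + below (A c \<union> A (c + 1)) t
        \<le> Suc (nat (- (c + 1))) + below (A (c + 1) \<union> A (c + 1 + 1)) t" for t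
      using height_le_Suc[of c t] by (simp only: height_def add_Suc)
  qed (use u step.prems finite_A in \<open>simp_all only: S height_def finite_Un simp_thms add_Suc\<close>)
  finally show ?case .
qed

section \<open>The paving formed by the inserted dominoes\<close>

definition dominoes :: "cell set set" where
  "dominoes = {domino_at A i s | i s. s \<in> A i}"

text \<open>The height of a cell determines its time, and the two time sets that can supply a domino
  covering it are disjoint.\<close>

lemma domino_at_common_cell:
  assumes "s \<in> A i" "s' \<in> A j" "(x, y) \<in> domino_at A i s" "(x, y) \<in> domino_at A j s'"
  shows "i = j \<and> s = s'"
proof -
  let ?c = "int x - int y"
  have s: "s \<in> A ?c \<union> A (?c + 1)" "s' \<in> A ?c \<union> A (?c + 1)" "height A ?c s = height A ?c s'"
    and ij: "i = ?c \<or> i = ?c + 1" "j = ?c \<or> j = ?c + 1"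
    using assms by (auto simp: mem_domino_at_iff)
  have "s = s'"
    by (rule height_eqD[OF s])
  with ij assms(1,2) disjoint_A[of ?c] show ?thesis by auto
qed

lemma domino_domino_at: "domino (domino_at A i s)"
proof -
  define h where "h = height A i s"
  have h: "nat (- i) \<le> h" "nat (- (i - 1)) \<le> height A (i - 1) s"
    by (simp_all add: h_def height_def)
  \<comment> \<open>Equal heights on the two diagonals give a horizontal domino, a difference of one
    a vertical domino.\<close>
  consider "height A (i - 1) s = h" | "height A (i - 1) s = Suc h"
    using height_le[of "i - 1" s] height_le_Suc[of "i - 1" s] unfolding h_def by (metis diff_add_cancel le_SucE le_antisym)
  then show ?thesis
  proof cases
    case 1
    then have "domino_at A i s = {(nat (i - 1 + int h), h), (nat (i - 1 + int h) + 1, h)}"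
      using h by (auto simp: domino_at_def cell_at_def simp flip: h_def)
    then show ?thesis unfolding domino_def horizontal_domino_def by blast
  next
    case 2
    then have "domino_at A i s = {(nat (i + int h), h), (nat (i + int h), h + 1)}"
      by (auto simp: domino_at_def cell_at_def algebra_simps simp flip: h_def)
    then show ?thesis unfolding domino_def vertical_domino_def by blast
  qed
qed

lemma ex_domino_at:
  assumes "(x, y) \<in> diagram lam"
  obtains i s where "s \<in> A i" "(x, y) \<in> domino_at A i s"
    "i \<in> {int x - int y, int x - int y + 1}"
proof -
  obtain s where s: "s \<in> A (int x - int y) \<union> A (int x - int y + 1)" "height A (int x - int y) s = y"
    using assms by (rule ex_time)
  then show thesis
    using that[of s "int x - int y"] that[of s "int x - int y + 1"] by (auto simp: mem_domino_at_iff)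
qed

lemma domino_at_subset:
  assumes "s \<in> A i" shows "domino_at A i s \<subseteq> diagram lam"
proof
  fix p assume "p \<in> domino_at A i s"
  then show "p \<in> diagram lam"
    using assms cell_in_diagram[of s "int (fst p) - int (snd p)" "fst p" "snd p"]
    by (cases p) (auto simp: mem_domino_at_iff)
qed

lemma paving_dominoes: "paving lam dominoes"
  unfolding paving_def
proof
  show "partition_on (diagram lam) dominoes"
  proof (rule partition_onI)
    show "\<Union>dominoes = diagram lam"
    proof
      show "\<Union>dominoes \<subseteq> diagram lam"
        using domino_at_subset unfolding dominoes_def by blast
      show "diagram lam \<subseteq> \<Union>dominoes"
      proof clarify
        fix x y assume "(x, y) \<in> diagram lam"
        then obtain i s where "s \<in> A i" "(x, y) \<in> domino_at A i s"
          by (rule ex_domino_at)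
        then show "(x, y) \<in> \<Union>dominoes"
          unfolding dominoes_def by blast
      qed
    qed
    show "{} \<notin> dominoes"
      by (auto simp: dominoes_def domino_at_def)
  next
    fix d e assume "d \<in> dominoes" "e \<in> dominoes" "d \<noteq> e"
    then obtain i s j s' where *: "d = domino_at A i s" "e = domino_at A j s'" "s \<in> A i" "s' \<in> A j"
      unfolding dominoes_def by blast
    show "disjnt d e"
      unfolding disjnt_iff
    proof (clarify)
      fix x y assume "(x, y) \<in> d" "(x, y) \<in> e"
      then have "i = j \<and> s = s'"
        using domino_at_common_cell[of s i s' j x y] * by simp
      with * \<open>d \<noteq> e\<close> show False by blast
    qed
  qed
  show "\<forall>d\<in>dominoes. domino d"
    using domino_domino_at by (auto simp: dominoes_def)
qed

lemma domino_at_eqD: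
  assumes "s \<in> A i" "s' \<in> A j" "domino_at A i s = domino_at A j s'"
  shows "i = j" "s = s'"
proof -
  obtain x y where xy: "cell_at i (height A i s) = (x, y)"
    by (cases "cell_at i (height A i s)")
  then have "(x, y) \<in> domino_at A i s" "(x, y) \<in> domino_at A j s'"
    unfolding assms(3)[symmetric] by (simp_all add: domino_at_def)
  from domino_at_common_cell[OF assms(1,2) this] show "i = j" "s = s'" by blast+
qed

end

section \<open>From families to domino tableaux\<close>

text \<open>The dominoes filled with \<open>X\<close> get insertion times as well. Inserting a domino on \<open>D\<^sub>0\<close> inserts a
  whole strip of dominoes on the diagonals above, which reaches one step further for each domino
  of the same parity class inserted on \<open>D\<^sub>0\<close> before. So position \<open>- 2 * j\<close> gets
  the times of position 0, except for the \<open>j\<close> smallest ones, and similarly for odd positions.\<close>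

definition extension :: "(nat \<Rightarrow> nat set) \<Rightarrow> int \<Rightarrow> time set" where
  "extension R i = (if 0 \<le> i then tm (nat i) ` R (nat i)
     else {s \<in> tm (nat (i mod 2)) ` R (nat (i mod 2)).
       nat ((1 - i) div 2) \<le> below (tm (nat (i mod 2)) ` R (nat (i mod 2))) s})"

lemma extension_nonneg [simp]: "extension R (int i) = tm i ` R i"
  by (simp add: extension_def)

text \<open>Positions 0 and 1 fit the same formula, because \<open>(1 - i) div 2\<close> is 0 there
  and nothing is dropped.\<close>

lemma below_extension:
  assumes "finite (R (nat (i mod 2)))" "i \<le> 1"
  shows "below (extension R i) t = below (tm (nat (i mod 2)) ` R (nat (i mod 2))) t - nat ((1 - i) div 2)"
proof (cases "0 \<le> i")
  case True
  then have "i = 0 \<or> i = 1" using assms(2) by auto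
  then show ?thesis by (auto simp: extension_def)
next
  case False
  then show ?thesis
    using assms(1) by (simp add: extension_def below_drop)
qed

lemma card_extension:
  assumes "finite (R (nat (i mod 2)))" "i \<le> 1"
  shows "card (extension R i) = card (R (nat (i mod 2))) - nat ((1 - i) div 2)"
proof (cases "0 \<le> i")
  case True
  then have "i = 0 \<or> i = 1" using assms(2) by auto
  then show ?thesis by (auto simp: extension_def card_image[OF inj_on_tm])
next
  case False
  then show ?thesis
    using assms(1) by (simp add: extension_def card_drop card_image[OF inj_on_tm])
qed

lemma finite_extension: "(\<And>i. finite (R i)) \<Longrightarrow> finite (extension R i)"
  by (simp add: extension_def)

text \<open>Neighbouring positions borrow their times from different base positions
  \<open>k i\<close>, and \<open>tm\<close> keeps the sets of different base positions
  apart.\<close>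

lemma disjoint_extension: "extension R i \<inter> extension R (i + 1) = {}"
proof -
  define k where "k i = (if 0 \<le> i then nat i else nat (i mod 2))" for i :: int
  have "extension R i \<subseteq> tm (k i) ` R (k i)" for i
    by (auto simp: extension_def k_def)
  moreover have "k i \<noteq> k (i + 1)"
  proof (cases "0 \<le> i")
    case False
    then show ?thesis
      by (cases "i = - 1") (auto simp: k_def nat_eq_iff, presburger+)
  qed (auto simp: k_def)
  then have "tm (k i) ` R (k i) \<inter> tm (k (i + 1)) ` R (k (i + 1)) = {}"
    by auto
  ultimately show ?thesis by blast
qed

text \<open>The interface between the shape and the tableaux. \<open>n i\<close> is the number of
  dominoes at position \<open>i\<close>. In the last assumption the two truncated differences are
  the cardinalities of \<open>extension R (- int k)\<close> and
  \<open>extension R (1 - int k)\<close>; for the actual shape it is derived from the shiftability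
  of the quotient.\<close>

locale shifted_shape =
  fixes lam :: "nat list" and n :: "nat \<Rightarrow> nat"
  assumes sorted: "sorted_wrt (\<ge>) lam"
    and diag_length: "diag_length lam c = n c + n (Suc c)"
    and upper: "0 < k \<Longrightarrow> (x, x + k) \<in> diagram lam \<longleftrightarrow>
      x < (n (k mod 2) - Suc k div 2) + (n (Suc k mod 2) - k div 2)"
begin

lemma height_extension_nonneg:
  assumes "R \<in> families g n"
  shows "height (extension R) (int c) t = below (tm c ` R c) t + below (tm (Suc c) ` R (Suc c)) t"
proof -
  have "finite (R i)" for i using assms by (simp add: families_def)
  moreover have "extension R (int c + 1) = tm (Suc c) ` R (Suc c)"
    using extension_nonneg[of R "Suc c"] by (simp add: add.commute)
  moreover have "tm c ` R c \<inter> tm (Suc c) ` R (Suc c) = {}"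
    by auto
  ultimately show ?thesis
    by (simp add: height_def below_Un)
qed

lemma domino_growth_extension:
  assumes R: "R \<in> families 2 n"
  shows "domino_growth lam (extension R)"
proof
  have fin: "finite (R i)" and card: "card (R i) = n i" for i
    using R by (auto simp: families_def)
  show "sorted_wrt (\<ge>) lam" by (rule sorted)
  show finA: "finite (extension R i)" for i
    by (rule finite_extension[OF fin])
  show disj: "extension R i \<inter> extension R (i + 1) = {}" for i
    by (rule disjoint_extension)
  have height: "height (extension R) c t = nat (- c) + below (extension R c) t + below (extension R (c + 1)) t"
    for c t
    by (simp add: height_def below_Un finA disj)
  have *: "height (extension R) (c + 1) t \<le> height (extension R) c t \<and>
      height (extension R) c t \<le> Suc (height (extension R) (c + 1) t)" for c t
  proof (cases "0 \<le> c")
    case True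
    then obtain k where c: "c = int k" by (metis nonneg_int_cases)
    then have "c + 1 = int (Suc k)" by simp
    then show ?thesis
      using families_times_le[OF R, of k t] unfolding c
      by (simp only: height_extension_nonneg[OF R]) simp
  next
    case False
    \<comment> \<open>The summand of position \<open>c + 1\<close> is common to both heights. The
      rest differs by \<open>1 + (p - Suc j) - (p - j)\<close>, which is 0 if \<open>j < p\<close>
      and, thanks to truncation, 1 otherwise.\<close>
    define p where "p = below (tm (nat (c mod 2)) ` R (nat (c mod 2))) t"
    define j where "j = nat ((1 - (c + 1 + 1)) div 2)"
    have "nat ((1 - c) div 2) = Suc j" "nat (- c) = Suc (nat (- (c + 1)))"
      using False by (auto simp: j_def)
    moreover have "below (extension R c) t = p - nat ((1 - c) div 2)"
      using False by (simp add: below_extension[OF fin] p_def)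
    moreover have "(c + 1 + 1) mod 2 = c mod 2" by presburger
    then have "below (extension R (c + 1 + 1)) t = p - j"
      using False by (subst below_extension[OF fin]) (simp_all add: p_def j_def)
    ultimately show ?thesis
      unfolding height by (simp, arith)
  qed
  then show "height (extension R) (c + 1) t \<le> height (extension R) c t"
    and "height (extension R) c t \<le> Suc (height (extension R) (c + 1) t)" for c t
    by blast+
  show "(x, y) \<in> diagram lam \<longleftrightarrow>
      y < nat (int y - int x) + card (extension R (int x - int y) \<union> extension R (int x - int y + 1))" for x y
  proof -
    have cardU: "card (extension R c \<union> extension R (c + 1)) = card (extension R c) + card (extension R (c + 1))" for c
      by (rule card_Un_disjoint[OF finA finA disj])
    show ?thesis
    proof (cases "y \<le> x")
      case True
      then obtain k where x: "x = k + y" by (metis le_add_diff_inverse2)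
      have "int x - int y = int k" "int x - int y + 1 = int (Suc k)" using x by auto
      then have "card (extension R (int x - int y)) + card (extension R (int x - int y + 1)) = n k + n (Suc k)"
        by (simp only: extension_nonneg card_image[OF inj_on_tm] card)
      then show ?thesis
        using True mem_diagram_iff[OF sorted, of k y] diag_length[of k] unfolding cardU x by simp
    next
      case False
      define k where "k = y - x"
      have k: "0 < k" and y: "y = x + k" using False by (auto simp: k_def)
      have c: "int x - int y = - int k" using y by simp
      have mod: "(- int k) mod 2 = int (k mod 2)" "(- int k + 1) mod 2 = int (Suc k mod 2)"
        by presburger+
      have div: "(1 - (- int k)) div 2 = int (Suc k div 2)" "(1 - (- int k + 1)) div 2 = int (k div 2)"
        by presburger+
      have le: "- int k \<le> 1" "- int k + 1 \<le> 1"
        using k by simp_all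
      have "card (extension R (- int k)) = n (k mod 2) - Suc k div 2"
        by (simp only: card_extension[OF fin le(1)] card mod div nat_int)
      moreover have "card (extension R (- int k + 1)) = n (Suc k mod 2) - k div 2"
        by (simp only: card_extension[OF fin le(2)] card mod div nat_int)
      ultimately have "card (extension R (- int k)) + card (extension R (- int k + 1)) =
          n (k mod 2) - Suc k div 2 + (n (Suc k mod 2) - k div 2)"
        by (simp only:)
      then show ?thesis
        using upper[OF k, of x] unfolding cardU c by (simp add: y)
    qed
  qed
qed

lemma ex_filling:
  assumes R: "R \<in> families 2 n"
  obtains T where "T \<in> shifted_domino_fillings lam" "ranks_at position T = R"
proof -
  define A where "A = extension R"
  interpret domino_growth lam A
    unfolding A_def by (rule domino_growth_extension[OF R])
  have fin: "finite (R i)" and two: "r \<in> R i \<Longrightarrow> 2 \<le> r" for i r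
    using R by (auto simp: families_def)
  have A_nonneg: "A (int i) = tm i ` R i" for i
    by (simp add: A_def)
  define T where "T d = (if d \<notin> dominoes then None else if position d < 0 then Some X
    else Some (Letter (letter_of_rank (THE r. r \<in> R (nat (position d)) \<and>
      d = domino_at A (position d) (tm (nat (position d)) r)))))" for d
  have dom: "dom T = dominoes"
    by (auto simp: T_def domIff split: if_splits)
  have T_eq: "T (domino_at A (int i) (tm i r)) = Some (Letter (letter_of_rank r))" if r: "r \<in> R i" for i r
  proof -
    have "tm i r \<in> A (int i)"
      using r by (simp add: A_nonneg)
    then have "domino_at A (int i) (tm i r) \<in> dominoes"
      unfolding dominoes_def by blast
    moreover have "(THE r'. r' \<in> R i \<and> domino_at A (int i) (tm i r) = domino_at A (int i) (tm i r')) = r"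
    proof (rule the_equality)
      fix r' assume "r' \<in> R i \<and> domino_at A (int i) (tm i r) = domino_at A (int i) (tm i r')"
      then have "tm i r = tm i r'"
        using domino_at_eqD(2)[of "tm i r" "int i" "tm i r'" "int i"] r by (simp add: A_nonneg)
      then show "r' = r" by simp
    qed (use r in simp)
    ultimately show ?thesis
      by (simp add: T_def)
  qed
  have T_letter: "\<exists>i r. p = domino_at A (int i) (tm i r) \<and> r \<in> R i \<and> a = letter_of_rank r"
    if T: "T p = Some (Letter a)" for p a
  proof -
    have "p \<in> dominoes" "0 \<le> position p"
      using T by (auto simp: T_def split: if_splits)
    then obtain i s where p: "p = domino_at A i s" "s \<in> A i" "0 \<le> i"
      unfolding dominoes_def by force
    then obtain k where i: "i = int k" by (metis nonneg_int_cases)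
    obtain r where "r \<in> R k" "s = tm k r"
      using p(2) unfolding i A_nonneg by blast
    then show ?thesis
      using T_eq[of r k] T p(1) i by auto
  qed
  have domino: "domino d" if "d \<in> dominoes" for d
    using paving_dominoes that by (auto simp: paving_def)
  have "shifted_paving lam dominoes"
    unfolding shifted_paving_def
  proof (intro conjI paving_dominoes notI)
    assume "\<exists>d\<in>dominoes. vertical_domino d \<and> on_diag d 0 \<and>
      left_adjacent dominoes d \<noteq> {} \<and> left_adjacent dominoes d \<subseteq> up_dominoes dominoes"
    then obtain d where d: "d \<in> dominoes" "vertical_domino d" "on_diag d 0"
      and left: "left_adjacent dominoes d \<noteq> {}" "left_adjacent dominoes d \<subseteq> up_dominoes dominoes"
      by blast
    have no_left: False if "e \<in> dominoes" "e \<noteq> d" "(x, y) \<in> e" "(x + 1, y) \<in> d" "0 \<le> position e" for e x y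
    proof -
      have "e \<in> left_adjacent dominoes d"
        using that unfolding left_adjacent_def by blast
      with left(2) mem_up_dominoes_iff[OF domino[OF that(1)]] that(5) show False by auto
    qed
    obtain i s where i: "d = domino_at A i s" "s \<in> A i"
      using d(1) unfolding dominoes_def by blast
    obtain h where h: "(h, h) \<in> d"
      using d(3) by (auto simp: on_diag_def diag_def)
    have hs: "height A 0 s = h" and "i = 0 \<or> i = 1"
      using h unfolding i(1) mem_domino_at_iff by auto
    from \<open>i = 0 \<or> i = 1\<close> show False
    proof
      \<comment> \<open>At position 1 the lower cell of \<open>d\<close> has its left neighbour on
        the main diagonal. A domino meeting the main diagonal has position 0 or 1, so this neighbour
        carries a letter.\<close>
      assume i1: "i = 1"
      let ?h = "height A 1 s"
      have "(Suc ?h, ?h) \<in> d"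
        unfolding i(1) mem_domino_at_iff i1 by simp
      then have hh: "h = Suc ?h"
        using vertical_domino_fst[OF d(2) h] by simp
      have "(h, h) \<in> diagram lam"
        using domino_at_subset[OF i(2)] h i(1) by blast
      then have "(?h, ?h) \<in> diagram lam"
        by (rule diagram_downward[OF sorted]) (simp_all add: hh)
      then obtain j u where u: "u \<in> A j" "(?h, ?h) \<in> domino_at A j u" "j = 0 \<or> j = 1"
        by (rule ex_domino_at) auto
      have "(?h, ?h) \<notin> d"
        using hs hh unfolding i(1) mem_domino_at_iff by simp
      moreover have "domino_at A j u \<in> dominoes"
        using u(1) unfolding dominoes_def by blast
      moreover have "domino_at A j u \<noteq> d"
        using u(2) calculation(1) by metis
      ultimately show False
        using no_left[of "domino_at A j u" ?h ?h] u \<open>(Suc ?h, ?h) \<in> d\<close> by auto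
    next
      \<comment> \<open>At position 0, being vertical forces \<open>below (A 1) s = 0\<close>: no
        domino at position 1 came earlier. If \<open>d\<close> has a left neighbour, then
        \<open>h = Suc k\<close>, and the domino of \<open>(k, k)\<close> is earlier still, hence at
        position 0 and vertical by the same computation. It covers \<open>(k, h)\<close>, directly
        left of \<open>(h, h)\<close>, and it carries a letter.\<close>
      assume i0: "i = 0"
      have "(height A (- 1) s - 1, height A (- 1) s) \<in> d"
        unfolding i(1) mem_domino_at_iff i0 by (auto simp: height_def)
      then have "height A (- 1) s - 1 = h"
        using vertical_domino_fst[OF d(2) h] by simp
      moreover have "0 < height A (- 1) s" by (simp add: height_def)
      ultimately have h1: "height A (- 1) s = Suc h" by simp
      have disj: "A i \<inter> A (i + 1) = {}" for i by (rule disjoint_A)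
      have height0: "height A 0 u = below (A 0) u + below (A 1) u" for u
        using below_Un[OF finite_A finite_A disj, of 0 u] by (simp add: height_def)
      have "below (A (- 1)) u = below (A 1) u - 1" for u
        using below_extension[of R "- 1" u] fin extension_nonneg[of R 1] by (simp add: A_def)
      then have height1: "height A (- 1) u = Suc (below (A 1) u - 1 + below (A 0) u)" for u
        using below_Un[OF finite_A finite_A disj, of "- 1" u] by (simp add: height_def)
      have b1: "below (A 1) s = 0"
        using hs h1 unfolding height0 height1 by linarith
      obtain x y where "(x + 1, y) \<in> d"
        using left(1) unfolding left_adjacent_def by blast
      then have "0 < h"
        using vertical_domino_fst[OF d(2) h] by fastforce
      then obtain k where hk: "h = Suc k" by (metis gr0_implies_Suc)
      have "(h, h) \<in> diagram lam"
        using domino_at_subset[OF i(2)] h i(1) by blast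
      then have "(k, k) \<in> diagram lam"
        by (rule diagram_downward[OF sorted]) (simp_all add: hk)
      then obtain u where u: "u \<in> A 0 \<union> A 1" "height A 0 u = k"
        using ex_time[of k k] by auto
      have "u < s"
      proof (rule ccontr)
        assume "\<not> u < s"
        then have "height A 0 s \<le> height A 0 u"
          unfolding height_def using finite_A by (intro add_left_mono below_mono) auto
        with hs hk u(2) show False by simp
      qed
      have "u \<notin> A 1"
        using below_strict[OF finite_A _ \<open>u < s\<close>] b1 by fastforce
      with u(1) have u0: "u \<in> A 0" by blast
      have "below (A 1) u = 0"
        using below_mono[OF finite_A[of 1] less_imp_le[OF \<open>u < s\<close>]] b1 by simp
      then have "height A (- 1) u = h"
        using u(2) hk unfolding height0 height1 by simp
      then have "(k, h) \<in> domino_at A 0 u"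
        unfolding mem_domino_at_iff by (simp add: hk)
      moreover have "domino_at A 0 u \<noteq> d"
        using domino_at_eqD(2)[OF u0 i(2)] i0 \<open>u < s\<close> unfolding i(1) by auto
      moreover have "domino_at A 0 u \<in> dominoes"
        using u0 unfolding dominoes_def by blast
      ultimately show False
        using no_left[of "domino_at A 0 u" k h] h hk by simp
    qed
  qed
  moreover have "T d = Some X" if "d \<in> up_dominoes dominoes" for d
    using that mem_up_dominoes_iff[OF domino, of d] by (auto simp: T_def up_dominoes_def)
  moreover have "\<exists>a\<in>alphabet. T d = Some (Letter a)" if d: "d \<in> down_dominoes dominoes" for d
  proof -
    have "d \<in> dominoes" "0 \<le> position d"
      using d mem_up_dominoes_iff[OF domino, of d dominoes] by (auto simp: down_dominoes_def)
    then obtain i s where p: "d = domino_at A i s" "s \<in> A i" "0 \<le> i"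
      unfolding dominoes_def by force
    then obtain k where i: "i = int k" by (metis nonneg_int_cases)
    obtain r where r: "r \<in> R k" "s = tm k r"
      using p(2) unfolding i A_nonneg by blast
    then have "T d = Some (Letter (letter_of_rank r))"
      using T_eq[of r k] p(1) i by simp
    moreover have "letter_of_rank r \<in> alphabet"
      using two[OF r(1)] by (simp add: mem_alphabet_iff)
    ultimately show ?thesis by blast
  qed
  moreover have "tableau_rule (\<lambda>d. d) T"
  proof (rule tableau_rule_timeI[where pos = position])
    fix p a x y assume "T p = Some (Letter a)" "(x, y) \<in> p"
    then obtain i r where "p = domino_at A (int i) (tm i r)" "(x, y) \<in> p"
      using T_letter by blast
    then show "0 \<le> position p \<and> int x - int y \<in> {position p - 1, position p}"
      by (simp add: mem_domino_at_iff)
  next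
    fix p q a b x x' y
    assume *: "T p = Some (Letter a)" "T q = Some (Letter b)" "(x, y) \<in> p" "(x', y) \<in> q" "x \<le> x'"
    obtain i r where p: "p = domino_at A (int i) (tm i r)" "r \<in> R i" "a = letter_of_rank r"
      using T_letter[OF *(1)] by blast
    obtain j u where q: "q = domino_at A (int j) (tm j u)" "u \<in> R j" "b = letter_of_rank u"
      using T_letter[OF *(2)] by blast
    have "tm i r \<in> A (int i)" "tm j u \<in> A (int j)"
      using p(2) q(2) by (simp_all add: A_nonneg)
    with * p(1) q(1) have "tm i r \<le> tm j u"
      by (intro row_mono[of x x' _ y]) (auto simp: mem_domino_at_iff)
    then show "tm (nat (position p)) (rank a) \<le> tm (nat (position q)) (rank b)"
      by (simp add: p q)
  next
    fix p q a b x y y'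
    assume *: "T p = Some (Letter a)" "T q = Some (Letter b)" "(x, y) \<in> p" "(x, y') \<in> q" "y \<le> y'"
    obtain i r where p: "p = domino_at A (int i) (tm i r)" "r \<in> R i" "a = letter_of_rank r"
      using T_letter[OF *(1)] by blast
    obtain j u where q: "q = domino_at A (int j) (tm j u)" "u \<in> R j" "b = letter_of_rank u"
      using T_letter[OF *(2)] by blast
    have "tm i r \<in> A (int i)" "tm j u \<in> A (int j)"
      using p(2) q(2) by (simp_all add: A_nonneg)
    with * p(1) q(1) have "tm i r \<le> tm j u"
      by (intro col_mono[of y y' _ x]) (auto simp: mem_domino_at_iff)
    then show "tm (nat (position p)) (rank a) \<le> tm (nat (position q)) (rank b)"
      by (simp add: p q)
  next
    fix p q a b x y
    assume *: "T p = Some (Letter a)" "T q = Some (Letter b)" "(x, y) \<in> p" "(x, y) \<in> q"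
    then have "p \<in> dominoes" "q \<in> dominoes" using dom by blast+
    with paving_dominoes *(3,4) show "p = q"
      unfolding paving_def partition_on_def disjoint_def by blast
  next
    fix p q a assume *: "T p = Some (Letter a)" "T q = Some (Letter a)" "position p = position q"
    obtain i r where p: "p = domino_at A (int i) (tm i r)" "r \<in> R i" "a = letter_of_rank r"
      using T_letter[OF *(1)] by blast
    obtain j u where q: "q = domino_at A (int j) (tm j u)" "u \<in> R j" "a = letter_of_rank u"
      using T_letter[OF *(2)] by blast
    have "i = j" using *(3) by (simp add: p q)
    moreover have "r = u" using p(3) q(3) by (metis rank_letter_of_rank)
    ultimately show "p = q" by (simp add: p q)
  qed
  ultimately have "T \<in> shifted_domino_fillings lam"
    by (simp add: shifted_domino_fillings_def dom)
  moreover have "ranks_at position T = R"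
  proof
    fix i
    show "ranks_at position T i = R i"
    proof (intro equalityI subsetI)
      fix r assume "r \<in> ranks_at position T i"
      then obtain a p where a: "T p = Some (Letter a)" "position p = int i" "r = rank a"
        unfolding ranks_at_def by blast
      obtain j u where "p = domino_at A (int j) (tm j u)" "u \<in> R j" "a = letter_of_rank u"
        using T_letter[OF a(1)] by blast
      with a show "r \<in> R i" by simp
    next
      fix r assume "r \<in> R i"
      from T_eq[OF this] show "r \<in> ranks_at position T i"
        unfolding ranks_at_def
        by (intro CollectI exI[of _ "letter_of_rank r"] conjI exI[of _ "domino_at A (int i) (tm i r)"]) auto
    qed
  qed
  ultimately show thesis by (rule that)
qed

end

section \<open>From domino tableaux to families\<close>

text \<open>The position tells on which side the second cell lies: here its offset is larger by one,
  so it is to the right or below.\<close>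

lemma domino_neighbour_right:
  assumes "domino d" "(x, y) \<in> d" "position d = int x - int y + 1"
  shows "(Suc x, y) \<in> d \<or> (\<exists>y'. y = Suc y' \<and> (x, y') \<in> d)"
  using assms
  by (auto simp: domino_def horizontal_domino_def vertical_domino_def position_def offset_def)

lemma domino_neighbour_left:
  assumes "domino d" "(x, y) \<in> d" "position d = int x - int y"
  shows "(x, Suc y) \<in> d \<or> (\<exists>x'. x = Suc x' \<and> (x', y) \<in> d)"
  using assms
  by (auto simp: domino_def horizontal_domino_def vertical_domino_def position_def offset_def)

lemma domino_eq_domino_at:
  assumes d: "domino d" and height: "\<And>x y. (x, y) \<in> d \<Longrightarrow> height A (int x - int y) t = y"
  shows "d = domino_at A (position d) t"
proof (intro equalityI subsetI)
  fix p assume "p \<in> d"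
  then show "p \<in> domino_at A (position d) t"
    using domino_offset[OF d] height by (cases p) (auto simp: mem_domino_at_iff)
next
  fix p assume p: "p \<in> domino_at A (position d) t"
  obtain x y where xy: "p = (x, y)" by (cases p)
  have off: "int x - int y \<in> {position d - 1, position d}" and y: "height A (int x - int y) t = y"
    using p unfolding xy mem_domino_at_iff by auto
  obtain x' y' where *: "(x', y') \<in> d" "int x' - int y' = int x - int y"
    using ex_offset_domino[OF d off] by blast
  then have "y' = y"
    using height[OF *(1)] y by simp
  with * xy show "p \<in> d" by simp
qed

text \<open>Offset -1 is where labelled dominoes, those at position 0, reach above the main
  diagonal. The truncated \<open>- 1\<close> is the smallest time of position 1, dropped at position
  -1.\<close>

lemma (in shifted_shape) height_extension_minus_one:
  assumes "R \<in> families g n"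
  shows "height (extension R) (- 1) t = Suc (below (tm 1 ` R 1) t - 1 + below (tm 0 ` R 0) t)"
proof -
  have fin: "finite (R i)" for i using assms by (simp add: families_def)
  have "below (extension R (- 1)) t = below (tm 1 ` R 1) t - 1"
    using below_extension[of R "- 1" t] fin by simp
  moreover have "extension R (- 1) \<inter> extension R 0 = {}"
    using disjoint_extension[of R "- 1"] by simp
  ultimately show ?thesis
    using below_Un[of "extension R (- 1)" "extension R 0" t] finite_extension[of R, OF fin]
      extension_nonneg[of R 0]
    by (simp add: height_def)
qed

locale domino_filling = shifted_shape +
  fixes T :: "cell set \<rightharpoonup> entry"
  assumes filling: "T \<in> shifted_domino_fillings lam"
begin

lemma shifted_paving: "shifted_paving lam (dom T)"
  and rule: "tableau_rule (\<lambda>d. d) T"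
  using filling by (simp_all add: shifted_domino_fillings_def)

lemma paving: "partition_on (diagram lam) (dom T)"
  and domino: "d \<in> dom T \<Longrightarrow> domino d"
  using shifted_paving by (simp_all add: shifted_paving_def paving_def)

lemma cell_in_diagram: "d \<in> dom T \<Longrightarrow> p \<in> d \<Longrightarrow> p \<in> diagram lam"
  using paving by (auto simp: partition_on_def)

lemma domino_unique: "d \<in> dom T \<Longrightarrow> e \<in> dom T \<Longrightarrow> p \<in> d \<Longrightarrow> p \<in> e \<Longrightarrow> d = e"
  using paving unfolding partition_on_def disjoint_def by blast

definition domino_of :: "cell \<Rightarrow> cell set" where
  "domino_of p = (THE d. d \<in> dom T \<and> p \<in> d)"

lemma domino_of_eq: "d \<in> dom T \<Longrightarrow> p \<in> d \<Longrightarrow> domino_of p = d"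
  unfolding domino_of_def using domino_unique by (intro the_equality) blast+

lemma domino_of: "p \<in> diagram lam \<Longrightarrow> domino_of p \<in> dom T" "p \<in> diagram lam \<Longrightarrow> p \<in> domino_of p"
proof -
  assume "p \<in> diagram lam"
  then obtain d where "d \<in> dom T" "p \<in> d"
    using paving unfolding partition_on_def by blast
  then show "domino_of p \<in> dom T" "p \<in> domino_of p"
    using domino_of_eq by simp_all
qed

lemma letter_iff: "(\<exists>a. T d = Some (Letter a)) \<longleftrightarrow> d \<in> dom T \<and> 0 \<le> position d"
proof (cases "d \<in> dom T")
  case True
  note up = mem_up_dominoes_iff[OF domino[OF True], of "dom T"]
  show ?thesis
  proof (cases "position d < 0")
    case neg: True
    then have "T d = Some X"
      using filling up True by (simp add: shifted_domino_fillings_def)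
    with neg show ?thesis by simp
  next
    case False
    then have "d \<in> down_dominoes (dom T)"
      using up True by (simp add: down_dominoes_def)
    then have "\<exists>a. T d = Some (Letter a)"
      using filling by (auto simp: shifted_domino_fillings_def)
    with False True show ?thesis by simp
  qed
qed auto

lemma letter_in_alphabet:
  assumes "T d = Some (Letter a)" shows "a \<in> alphabet"
proof -
  have "d \<in> dom T" "0 \<le> position d"
    using letter_iff[of d] assms by auto
  then have "d \<in> down_dominoes (dom T)"
    using mem_up_dominoes_iff[OF domino, of d "dom T"] by (simp add: down_dominoes_def)
  then show ?thesis
    using filling assms by (force simp: shifted_domino_fillings_def)
qed

lemma position_cases:
  assumes "d \<in> dom T" "(x, y) \<in> d"
  shows "position d = int x - int y \<or> position d = int x - int y + 1"
  using domino_offset[OF domino[OF assms(1)] assms(2)] by auto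

definition time :: "cell set \<Rightarrow> time" where
  "time d = tm (nat (position d)) (rank (letter_of (the (T d))))"

lemma time_eq: "T d = Some (Letter a) \<Longrightarrow> time d = tm (nat (position d)) (rank a)"
  by (simp add: time_def)

text \<open>The delicate case is a tie. It is between unprimed letters, so the position must
  increase. Otherwise both positions agree and \<open>d\<close> also covers the cell below
  \<open>(x, y)\<close>; the letter of the domino \<open>g\<close> at \<open>(Suc x, y')\<close> is
  squeezed between equal ones, and the column rule makes \<open>g\<close> equal to \<open>e\<close>,
  although this cell has an offset that \<open>e\<close> does not meet.\<close>

lemma row_step:
  assumes d: "d \<in> dom T" "(x, y) \<in> d" and e: "e \<in> dom T" "(Suc x, y) \<in> e" and "y \<le> x" "d \<noteq> e"
  shows "time d < time e"
proof -
  define c where "c = int x - int y"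
  have pd: "position d = c \<or> position d = c + 1" and pe: "position e = c + 1 \<or> position e = c + 2"
    using position_cases[OF d] position_cases[OF e] by (auto simp: c_def)
  have "0 \<le> c" using \<open>y \<le> x\<close> by (simp add: c_def)
  then obtain a b where a: "T d = Some (Letter a)" and b: "T e = Some (Letter b)"
    using letter_iff d(1) e(1) pd pe by (metis add_increasing2 zero_le_numeral zero_le_one)
  have ab: "rank a \<le> rank b" "rank a = rank b \<Longrightarrow> even (rank a) \<Longrightarrow> d = e"
    using tableau_rule_rowD[OF rule a b d(2) e(2)] by auto
  show ?thesis
  proof (cases "rank a = rank b")
    case True
    with ab \<open>d \<noteq> e\<close> have odd: "odd (rank a)" by blast
    have "position d < position e"
    proof (rule ccontr)
      assume "\<not> position d < position e"
      with pd pe have pc: "position d = c + 1" "position e = c + 1" by auto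
      have "(Suc x, y) \<notin> d"
        using domino_unique[OF d(1) e(1)] e(2) \<open>d \<noteq> e\<close> by blast
      then obtain y' where y': "y = Suc y'" "(x, y') \<in> d"
        using domino_neighbour_right[OF domino[OF d(1)] d(2)] pc(1) by (auto simp: c_def)
      have "(Suc x, y') \<in> diagram lam"
        by (rule diagram_downward[OF sorted cell_in_diagram[OF e]]) (simp_all add: y')
      then obtain g where g: "g \<in> dom T" "(Suc x, y') \<in> g"
        using domino_of by blast
      then have "0 \<le> position g"
        using position_cases[OF g] \<open>y \<le> x\<close> y' by auto
      then obtain u where u: "T g = Some (Letter u)"
        using letter_iff g(1) by blast
      have "rank a \<le> rank u" "rank u \<le> rank b"
        using tableau_rule_rowD(1)[OF rule a u y'(2) g(2)]
          tableau_rule_colD(1)[OF rule u b g(2) e(2)] y' by auto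
      with True odd have "g = e"
        using tableau_rule_colD(2)[OF rule u b g(2) e(2)] y' by auto
      then show False
        using position_cases[OF e(1), of "Suc x" y'] g pc(2) y' by (simp add: c_def)
    qed
    then show ?thesis
      using True odd pd pe \<open>0 \<le> c\<close> by (auto simp: time_eq[OF a] time_eq[OF b] tm_def less_prod_def)
  next
    case False
    then show ?thesis
      using ab by (auto simp: time_eq[OF a] time_eq[OF b] tm_def less_prod_def)
  qed
qed

text \<open>Dual to the row case: in a tie of primed letters with equal positions, \<open>e\<close>
  would also cover \<open>(Suc x, Suc y)\<close>, and the domino at \<open>(Suc x, y)\<close> would
  be squeezed and equal to \<open>d\<close>. The condition \<open>y < x\<close> keeps both cells on
  or below the main diagonal, so both dominoes carry letters.\<close>

lemma col_step:
  assumes d: "d \<in> dom T" "(x, y) \<in> d" and e: "e \<in> dom T" "(x, Suc y) \<in> e" and "y < x" "d \<noteq> e"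
  shows "time d < time e"
proof -
  define c where "c = int x - int y"
  have pd: "position d = c \<or> position d = c + 1" and pe: "position e = c - 1 \<or> position e = c"
    using position_cases[OF d] position_cases[OF e] by (auto simp: c_def)
  have "1 \<le> c" using \<open>y < x\<close> by (simp add: c_def)
  then have "0 \<le> position d" "0 \<le> position e" using pd pe by auto
  then obtain a b where a: "T d = Some (Letter a)" and b: "T e = Some (Letter b)"
    using letter_iff d(1) e(1) by blast
  have ab: "rank a \<le> rank b" "rank a = rank b \<Longrightarrow> odd (rank a) \<Longrightarrow> d = e"
    using tableau_rule_colD[OF rule a b d(2) e(2)] by auto
  show ?thesis
  proof (cases "rank a = rank b")
    case True
    with ab \<open>d \<noteq> e\<close> have even: "even (rank a)" by blast
    have "position e < position d"
    proof (rule ccontr)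
      assume "\<not> position e < position d"
      with pd pe have pc: "position d = c" "position e = c" by auto
      have "(x, y) \<notin> e"
        using domino_unique[OF d(1) e(1)] d(2) \<open>d \<noteq> e\<close> by blast
      then have e': "(Suc x, Suc y) \<in> e"
        using domino_neighbour_right[OF domino[OF e(1)] e(2)] pc(2) by (auto simp: c_def)
      have "(Suc x, y) \<in> diagram lam"
        by (rule diagram_downward[OF sorted cell_in_diagram[OF e(1) e']]) simp_all
      then obtain g where g: "g \<in> dom T" "(Suc x, y) \<in> g"
        using domino_of by blast
      then have "0 \<le> position g"
        using position_cases[OF g] \<open>y < x\<close> by auto
      then obtain u where u: "T g = Some (Letter u)"
        using letter_iff g(1) by blast
      have "rank a \<le> rank u" "rank u \<le> rank b"
        using tableau_rule_rowD(1)[OF rule a u d(2) g(2)]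
          tableau_rule_colD(1)[OF rule u b g(2) e'] by auto
      with True even have "d = g"
        using tableau_rule_rowD(2)[OF rule a u d(2) g(2)] by auto
      then show False
        using position_cases[OF d(1), of "Suc x" y] g pc(1) by (simp add: c_def)
    qed
    then show ?thesis
      using True even pd pe \<open>1 \<le> c\<close> by (auto simp: time_eq[OF a] time_eq[OF b] tm_def less_prod_def)
  next
    case False
    then show ?thesis
      using ab by (auto simp: time_eq[OF a] time_eq[OF b] tm_def less_prod_def)
  qed
qed

definition diagonal_time :: "nat \<Rightarrow> nat \<Rightarrow> time" where
  "diagonal_time c y = time (domino_of (c + y, y))"

lemma row_step_le:
  assumes "y < diag_length lam (Suc c)"
  shows "y < diag_length lam c"
    and "domino_of (c + y, y) \<noteq> domino_of (Suc c + y, y) \<Longrightarrow> diagonal_time c y < diagonal_time (Suc c) y"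
proof -
  have cell: "(Suc (c + y), y) \<in> diagram lam"
    using assms mem_diagram_iff[OF sorted, of "Suc c" y] by simp
  then have cell': "(c + y, y) \<in> diagram lam"
    by (rule diagram_downward[OF sorted]) auto
  then show "y < diag_length lam c"
    by (simp add: mem_diagram_iff[OF sorted])
  assume "domino_of (c + y, y) \<noteq> domino_of (Suc c + y, y)"
  then show "diagonal_time c y < diagonal_time (Suc c) y"
    using row_step[OF domino_of[OF cell'] domino_of[OF cell]] by (simp add: diagonal_time_def)
qed

lemma col_step_le:
  assumes "Suc y < diag_length lam c"
  shows "y < diag_length lam (Suc c)"
    and "domino_of (Suc c + y, y) \<noteq> domino_of (c + Suc y, Suc y) \<Longrightarrow> diagonal_time (Suc c) y < diagonal_time c (Suc y)"
proof -
  have cell: "(Suc (c + y), Suc y) \<in> diagram lam"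
    using assms mem_diagram_iff[OF sorted, of c "Suc y"] by simp
  then have cell': "(Suc (c + y), y) \<in> diagram lam"
    by (rule diagram_downward[OF sorted]) auto
  then show "y < diag_length lam (Suc c)"
    using mem_diagram_iff[OF sorted, of "Suc c" y] by simp
  assume "domino_of (Suc c + y, y) \<noteq> domino_of (c + Suc y, Suc y)"
  then show "diagonal_time (Suc c) y < diagonal_time c (Suc y)"
    using col_step[OF domino_of[OF cell'] domino_of[OF cell]] by (simp add: diagonal_time_def)
qed

sublocale growing_diagonals "diag_length lam" diagonal_time
proof
  have row: "diagonal_time c y \<le> diagonal_time (Suc c) y" if "y < diag_length lam (Suc c)" for c y
    using row_step_le(2)[OF that] by (cases "domino_of (c + y, y) = domino_of (Suc c + y, y)")
      (auto simp: diagonal_time_def less_imp_le)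
  have col: "diagonal_time (Suc c) y \<le> diagonal_time c (Suc y)" if "Suc y < diag_length lam c" for c y
    using col_step_le(2)[OF that] by (cases "domino_of (Suc c + y, y) = domino_of (c + Suc y, Suc y)")
      (auto simp: diagonal_time_def less_imp_le)
  show "y < diag_length lam c \<and> diagonal_time c y \<le> diagonal_time (Suc c) y"
    if "y < diag_length lam (Suc c)" for c y
    using row_step_le(1)[OF that] row[OF that] by blast
  show "y < diag_length lam (Suc c) \<and> diagonal_time (Suc c) y \<le> diagonal_time c (Suc y)"
    if "Suc y < diag_length lam c" for c y
    using col_step_le(1)[OF that] col[OF that] by blast
  \<comment> \<open>From one diagonal cell to the next the way leads right and then up. If neither
    step is strict, one domino contains both diagonal cells, which have the same offset.\<close>
  show "diagonal_time c y < diagonal_time c (Suc y)" if y: "Suc y < diag_length lam c" for c y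
  proof (rule ccontr)
    assume "\<not> ?thesis"
    moreover note col_step_le[OF y] row_step_le(2)[OF col_step_le(1)[OF y]]
      row[OF col_step_le(1)[OF y]] col[OF y]
    ultimately have eq: "domino_of (c + y, y) = domino_of (c + Suc y, Suc y)"
      by (metis order_le_less_trans order_less_le_trans)
    have cells: "(c + y, y) \<in> diagram lam" "(c + Suc y, Suc y) \<in> diagram lam"
      using y by (simp_all add: mem_diagram_iff[OF sorted] del: add_Suc_right)
    show False
      using domino_offset_inj[OF domino[OF domino_of(1)[OF cells(1)]] domino_of(2)[OF cells(1)],
          of "(c + Suc y, Suc y)"] domino_of(2)[OF cells(2)] eq
      by (simp add: offset_def)
  qed
qed

section \<open>The family of a filling\<close>

abbreviation R :: "nat \<Rightarrow> nat set" where
  "R \<equiv> ranks_at position T"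

lemma times_eq: "times c = tm c ` R c \<union> tm (Suc c) ` R (Suc c)"
proof (intro equalityI subsetI)
  fix u assume "u \<in> times c"
  then obtain y where y: "y < diag_length lam c" and u: "u = time (domino_of (c + y, y))"
    by (auto simp: diagonal_time_def)
  define d where "d = domino_of (c + y, y)"
  have d: "d \<in> dom T" "(c + y, y) \<in> d"
    using y domino_of by (simp_all add: d_def mem_diagram_iff[OF sorted])
  have pos: "position d = int c \<or> position d = int (Suc c)"
    using position_cases[OF d] by auto
  then obtain a where a: "T d = Some (Letter a)"
    using letter_iff[of d] d(1) by auto
  have "rank a \<in> R (nat (position d))"
    unfolding ranks_at_def using a pos by (intro CollectI exI[of _ a] conjI exI[of _ d]) auto
  moreover have "u = tm (nat (position d)) (rank a)"
    using time_eq[OF a] u by (simp add: d_def)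
  ultimately show "u \<in> tm c ` R c \<union> tm (Suc c) ` R (Suc c)"
    using pos by (elim disjE) (simp_all del: of_nat_Suc)
next
  fix u assume "u \<in> tm c ` R c \<union> tm (Suc c) ` R (Suc c)"
  then obtain i r where i: "i = c \<or> i = Suc c" and r: "r \<in> R i" and u: "u = tm i r"
    by blast
  obtain a d where a: "T d = Some (Letter a)" "position d = int i" "r = rank a"
    using r unfolding ranks_at_def by blast
  have d: "d \<in> dom T" using a(1) by blast
  have "int c \<in> {position d - 1, position d}"
    using i a(2) by auto
  then obtain x y where xy: "(x, y) \<in> d" "int x - int y = int c"
    by (rule ex_offset_domino[OF domino[OF d]])
  then have x: "x = c + y" by simp
  have "y < diag_length lam c"
    using cell_in_diagram[OF d xy(1)] x by (simp add: mem_diagram_iff[OF sorted])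
  moreover have "u = diagonal_time c y"
    unfolding diagonal_time_def using domino_of_eq[OF d xy(1)] time_eq[OF a(1)] a u x by simp
  ultimately show "u \<in> times c" by blast
qed

lemma finite_R: "finite (R i)"
proof -
  have "finite (tm i ` R i \<union> tm (Suc i) ` R (Suc i))"
    unfolding times_eq[symmetric] by simp
  then show ?thesis
    using finite_imageD[OF _ inj_on_tm] by blast
qed

lemma below_times_eq: "below (times c) t = below (tm c ` R c) t + below (tm (Suc c) ` R (Suc c)) t"
  unfolding times_eq by (rule below_Un) (auto simp: finite_R)

text \<open>A diagonal gives the sum of the cardinalities at two consecutive positions. Far to the
  right both terms vanish, and descending from there separates them.\<close>

lemma card_R: "card (R i) = n i"
proof -
  have sum: "card (R c) + card (R (Suc c)) = n c + n (Suc c)" for c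
  proof -
    have "card (times c) = card (tm c ` R c) + card (tm (Suc c) ` R (Suc c))"
      unfolding times_eq by (rule card_Un_disjoint) (auto simp: finite_R)
    then show ?thesis
      using card_times[of c] diag_length[of c] by (simp add: card_image[OF inj_on_tm])
  qed
  \<comment> \<open>For the empty list \<open>lam ! 0\<close> is an unspecified number, which is
    harmless because the diagram is empty.\<close>
  define N where "N = i + lam ! 0"
  have "(N + 0, 0) \<notin> diagram lam"
    by (simp add: diagram_def N_def)
  then have "diag_length lam N = 0"
    using mem_diagram_iff[OF sorted, of N 0] by simp
  then have N: "card (R N) = n N"
    using sum[of N] diag_length[of N] by simp
  have "i \<le> N" by (simp add: N_def)
  then show ?thesis
  proof (induction rule: inc_induct)
    case base
    show ?case by (rule N)
  next
    case (step k)
    then show ?case using sum[of k] by simp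
  qed
qed

lemma R_in_families: "R \<in> families 2 n"
proof -
  have "2 \<le> r" if "r \<in> R i" for r i
    using that letter_in_alphabet unfolding ranks_at_def by (auto simp flip: mem_alphabet_iff)
  moreover have "interlacing (R i) (R (i + 2))" for i
  proof -
    \<comment> \<open>Diagonals \<open>i\<close> and \<open>i + 1\<close> share the count of
      position \<open>i + 1\<close>; cancelling it leaves positions \<open>i\<close> and
      \<open>i + 2\<close>.\<close>
    have "below (tm (i + 2) ` R (i + 2)) t \<le> below (tm i ` R i) t \<and>
        below (tm i ` R i) t \<le> Suc (below (tm (i + 2) ` R (i + 2)) t)" for t
      using below_times_le[of i t] unfolding below_times_eq by simp
    then show ?thesis
      using interlacing_iff[OF finite_R finite_R, of i "i + 2"] by simp
  qed
  ultimately show ?thesis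
    by (simp add: families_def finite_R card_R)
qed

text \<open>This is where the condition on the vertical dominoes on \<open>D\<^sub>0\<close> is used: it determines the cell
  above \<open>D\<^sub>0\<close> of each labelled domino.\<close>

lemma vertical_on_main_diagonal:
  assumes "(h, h) \<in> diagram lam" "position (domino_of (h, h)) = 0"
  shows "(h, Suc h) \<in> domino_of (h, h) \<longleftrightarrow> (\<forall>k<h. position (domino_of (k, k)) = 0)"
  using assms
proof (induction h rule: less_induct)
  case (less h)
  define d where "d = domino_of (h, h)"
  have d: "d \<in> dom T" "(h, h) \<in> d"
    using domino_of less.prems by (simp_all add: d_def)
  have cell: "(k, k) \<in> diagram lam" if "k < h" for k
    by (rule diagram_downward[OF sorted less.prems(1)]) (use that in auto)
  have not_same: "(k, k) \<notin> d" if "k < h" for k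
    using domino_offset_inj[OF domino[OF d(1)] d(2), of "(k, k)"] that by (auto simp: offset_def)
  show ?case
    unfolding d_def[symmetric]
  proof
    assume all: "\<forall>k<h. position (domino_of (k, k)) = 0"
    show "(h, Suc h) \<in> d"
    proof (rule ccontr)
      assume "(h, Suc h) \<notin> d"
      then obtain k where k: "h = Suc k" "(k, h) \<in> d"
        using domino_neighbour_left[OF domino[OF d(1)] d(2)] less.prems(2) by (auto simp: d_def)
      \<comment> \<open>By induction the previous domino on the main diagonal is vertical and
        already occupies the cell that a horizontal \<open>d\<close> would need.\<close>
      have "(k, Suc k) \<in> domino_of (k, k)"
        using less.IH[of k] cell[of k] all k by simp
      then have "domino_of (k, k) = d"
        using domino_unique[OF domino_of(1)[OF cell[of k]] d(1)] k by simp
      then show False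
        using not_same[of k] domino_of(2)[OF cell[of k]] k by simp
    qed
  next
    assume vert: "(h, Suc h) \<in> d"
    show "\<forall>k<h. position (domino_of (k, k)) = 0"
    proof (rule ccontr)
      assume not_all: "\<not> ?thesis"
      then obtain k where k: "h = Suc k"
        by (cases h) auto
      have "(k, h) \<in> diagram lam"
        by (rule diagram_downward[OF sorted less.prems(1)]) (simp_all add: k)
      then obtain e where e: "e \<in> dom T" "(k, h) \<in> e"
        using domino_of by blast
      have kh: "(k, h) \<notin> d"
        using domino_offset_inj[OF domino[OF d(1)] vert, of "(k, h)"] by (auto simp: offset_def k)
      then have "e \<noteq> d" using e by blast
      \<comment> \<open>If \<open>e\<close> reached down to \<open>(k, k)\<close> it would be
        vertical at position 0, and the induction hypothesis would put all earlier dominoes on the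
        main diagonal at position 0, contrary to \<open>not_all\<close>.\<close>
      have kk: "(k, k) \<notin> e"
      proof
        assume kk: "(k, k) \<in> e"
        then have eq: "domino_of (k, k) = e" by (rule domino_of_eq[OF e(1)])
        have "position e = 0"
          using position_cases[OF e(1) kk] position_cases[OF e] k by auto
        then have "\<forall>j<k. position (domino_of (j, j)) = 0"
          using less.IH[of k] cell[of k] e(2) eq k by simp
        with \<open>position e = 0\<close> eq not_all k show False
          by (auto simp: less_Suc_eq)
      qed
      have hh: "(h, h) \<notin> e"
        using domino_unique[OF d(1) e(1) d(2)] \<open>e \<noteq> d\<close> by blast
      have "position e \<noteq> 0"
        using domino_neighbour_right[OF domino[OF e(1)] e(2)] kk hh k by auto
      then have "position e < 0"
        using position_cases[OF e] k by auto
      have d_eq: "d = {(h, h), (h, h + 1)}"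
        using domino[OF d(1)] d(2) vert
        by (auto simp: domino_def horizontal_domino_def vertical_domino_def)
      \<comment> \<open>Left of \<open>d\<close> there can be \<open>e\<close> and the domino of
        \<open>(k, Suc h)\<close>, whose offset -2 already forces a negative position. So all left
        neighbours carry X, which the paving condition forbids.\<close>
      have "left_adjacent (dom T) d \<subseteq> up_dominoes (dom T)"
      proof
        fix g assume "g \<in> left_adjacent (dom T) d"
        then obtain x y where g: "g \<in> dom T" "(x, y) \<in> g" "(x + 1, y) \<in> d"
          unfolding left_adjacent_def by blast
        then have "x = k \<and> (y = h \<or> y = Suc h)"
          using d_eq k by auto
        then have "position g < 0"
          using domino_unique[OF g(1) e(1)] g(2) e(2) \<open>position e < 0\<close> position_cases[OF g(1,2)] k
          by auto
        then show "g \<in> up_dominoes (dom T)"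
          using mem_up_dominoes_iff[OF domino[OF g(1)]] g(1) by simp
      qed
      moreover have "e \<in> left_adjacent (dom T) d"
        using e \<open>e \<noteq> d\<close> d(2) k unfolding left_adjacent_def by force
      moreover have "vertical_domino d"
        unfolding d_eq vertical_domino_def by blast
      moreover have "on_diag d 0"
        using d(2) by (force simp: on_diag_def diag_def)
      ultimately show False
        using shifted_paving d(1) unfolding shifted_paving_def by blast
    qed
  qed
qed

text \<open>Times increase along the main diagonal, and a domino meeting it is at position 0 or 1.
  So the times of position 1 before that of \<open>(h, h)\<close> belong to the cells
  \<open>(k, k)\<close> with \<open>k < h\<close> whose domino is not at position 0.\<close>

lemma below_main_diagonal_eq_0_iff:
  assumes "h < diag_length lam 0"
  shows "below (tm 1 ` R 1) (diagonal_time 0 h) = 0 \<longleftrightarrow> (\<forall>k<h. position (domino_of (k, k)) = 0)"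
proof -
  have less_iff: "diagonal_time 0 k < diagonal_time 0 h \<longleftrightarrow> k < h" if "k < diag_length lam 0" for k
    using strict_mono_on_less[OF strict_mono_on_diagonal[of 0]] that assms by simp
  have mem_iff: "diagonal_time 0 k \<in> tm 1 ` R 1 \<longleftrightarrow> position (domino_of (k, k)) \<noteq> 0"
    if "k < diag_length lam 0" for k
  proof -
    define d where "d = domino_of (k, k)"
    have d: "d \<in> dom T" "(k, k) \<in> d"
      using that domino_of mem_diagram_iff[OF sorted, of 0 k] by (simp_all add: d_def)
    have pos: "position d = 0 \<or> position d = 1"
      using position_cases[OF d] by auto
    then obtain a where a: "T d = Some (Letter a)"
      using letter_iff[of d] d(1) by auto
    have time: "diagonal_time 0 k = tm (nat (position d)) (rank a)"
      using time_eq[OF a] by (simp add: diagonal_time_def d_def)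
    have "rank a \<in> R 1" if "position d = 1"
      unfolding ranks_at_def using a that by (intro CollectI exI[of _ a] conjI exI[of _ d]) auto
    then show ?thesis
      using pos unfolding time d_def[symmetric] by auto
  qed
  have "below (tm 1 ` R 1) (diagonal_time 0 h) = 0 \<longleftrightarrow> {u \<in> tm 1 ` R 1. u < diagonal_time 0 h} = {}"
    unfolding below_def using finite_R[of 1] by (subst card_eq_0_iff) auto
  also have "\<dots> \<longleftrightarrow> (\<forall>k<h. position (domino_of (k, k)) = 0)"
  proof
    assume none: "{u \<in> tm 1 ` R 1. u < diagonal_time 0 h} = {}"
    show "\<forall>k<h. position (domino_of (k, k)) = 0"
    proof (intro allI impI)
      fix k assume "k < h"
      then have "k < diag_length lam 0" using assms by simp
      from less_iff[OF this] mem_iff[OF this] \<open>k < h\<close> none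
      show "position (domino_of (k, k)) = 0" by blast
    qed
  next
    assume all: "\<forall>k<h. position (domino_of (k, k)) = 0"
    have "\<not> u < diagonal_time 0 h" if u: "u \<in> tm 1 ` R 1" for u
    proof -
      have "u \<in> times 0"
        using u times_eq[of 0] by simp
      then obtain k where k: "k < diag_length lam 0" "u = diagonal_time 0 k"
        by blast
      then show ?thesis
        using less_iff[OF k(1)] mem_iff[OF k(1)] u all by metis
    qed
    then show "{u \<in> tm 1 ` R 1. u < diagonal_time 0 h} = {}" by blast
  qed
  finally show ?thesis .
qed

text \<open>This gives injectivity: the family, the position and the letter recover the whole
  domino, even its cell above the main diagonal. For the other cells the height is a rank within the
  diagonal.\<close>

lemma domino_eq:
  assumes a: "T d = Some (Letter a)"
  shows "d = domino_at (extension R) (position d) (tm (nat (position d)) (rank a))"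
proof (rule domino_eq_domino_at)
  have d: "d \<in> dom T" and pos: "0 \<le> position d"
    using letter_iff[of d] a by auto
  show "domino d" by (rule domino[OF d])
  have nonneg: "height (extension R) (int x - int y) (time d) = y" if "(x, y) \<in> d" "y \<le> x" for x y
  proof -
    define c where "c = x - y"
    have x: "x = c + y" using that(2) by (simp add: c_def)
    have "y < diag_length lam c"
      using cell_in_diagram[OF d that(1)] x by (simp add: mem_diagram_iff[OF sorted])
    from below_times[OF this] have "below (times c) (time d) = y"
      using domino_of_eq[OF d that(1)] x by (simp add: diagonal_time_def)
    then show ?thesis
      using height_extension_nonneg[OF R_in_families, of c "time d"] x by (simp add: below_times_eq)
  qed
  fix x y assume xy: "(x, y) \<in> d"
  have "height (extension R) (int x - int y) (time d) = y"
  proof (cases "y \<le> x")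
    case True
    then show ?thesis using nonneg[OF xy] by blast
  next
    case False
    then have y: "y = Suc x" and pos0: "position d = 0"
      using position_cases[OF d xy] pos by auto
    obtain h where h: "(h, h) \<in> d"
      using ex_offset_domino[OF domino[OF d], of 0] pos0 by auto
    note dh = domino_of_eq[OF d h]
    have cell: "(h, h) \<in> diagram lam" by (rule cell_in_diagram[OF d h])
    then have len: "h < diag_length lam 0"
      using mem_diagram_iff[OF sorted, of 0 h] by simp
    have time: "diagonal_time 0 h = time d"
      by (simp add: diagonal_time_def dh)
    have "height (extension R) 0 (time d) = h"
      using nonneg[OF h] by simp
    then have sum: "below (tm 0 ` R 0) (time d) + below (tm 1 ` R 1) (time d) = h"
      using height_extension_nonneg[OF R_in_families, of 0] by simp
    have vert: "below (tm 1 ` R 1) (time d) = 0 \<longleftrightarrow> (h, Suc h) \<in> d"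
      using vertical_on_main_diagonal[OF cell] below_main_diagonal_eq_0_iff[OF len] pos0
      by (simp add: dh time)
    have "x = h \<or> Suc x = h"
      using domino_neighbour_left[OF domino[OF d] h] pos0
        domino_offset_inj[OF domino[OF d] xy] y by (auto simp: offset_def)
    moreover have "x = h" if "(h, Suc h) \<in> d"
      using domino_offset_inj[OF domino[OF d] xy that] y by (simp add: offset_def)
    moreover have "below (tm 1 ` R 1) (time d) = 0" if "x = h"
      using vert xy y that by simp
    \<comment> \<open>If \<open>d\<close> is vertical, the count at position 1 is 0 and
      \<open>y = Suc h\<close>. If \<open>d\<close> is horizontal, the count is positive, so the
      subtraction is exact and \<open>y = h\<close>.\<close>
    ultimately have "Suc (below (tm 1 ` R 1) (time d) - 1 + below (tm 0 ` R 0) (time d)) = y"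
      using sum vert y by (cases "below (tm 1 ` R 1) (time d) = 0") auto
    moreover have "int x - int y = - 1" using y by simp
    ultimately show ?thesis
      using height_extension_minus_one[OF R_in_families] by simp
  qed
  then show "height (extension R) (int x - int y) (tm (nat (position d)) (rank a)) = y"
    by (simp add: time_eq[OF a])
qed

end

section \<open>The product of the generating series\<close>

lemma finite_subseteq_mset: "finite {k. k \<subseteq># m}"
proof (induction m)
  case (add a m)
  have "{k. k \<subseteq># add_mset a m} \<subseteq> {k. k \<subseteq># m} \<union> add_mset a ` {k. k \<subseteq># m}"
  proof
    fix k assume "k \<in> {k. k \<subseteq># add_mset a m}"
    then have k: "k \<subseteq># add_mset a m" by simp
    show "k \<in> {k. k \<subseteq># m} \<union> add_mset a ` {k. k \<subseteq># m}"
    proof (cases "a \<in># k")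
      case True
      then obtain k' where "k = add_mset a k'" by (metis mset_add)
      with k show ?thesis by simp
    next
      case False
      then have "k \<subseteq># m"
        using k by (metis add_mset_remove_trivial diff_single_trivial subset_eq_diff_conv union_mset_add_mset_right add.right_neutral)
      then show ?thesis by simp
    qed
  qed
  then show ?case
    by (rule finite_subset) (simp add: add)
qed simp

lemma series_times_commute: "f \<star> g = g \<star> f"
proof
  fix m :: monomial
  have "m - (m - k) = k" if "k \<subseteq># m" for k
    using that by (metis add_diff_cancel_left' subset_mset.diff_add)
  then show "(f \<star> g) m = (g \<star> f) m"
    unfolding series_times_def
    by (intro sum.reindex_bij_witness[of _ "\<lambda>k. m - k" "\<lambda>k. m - k"]) (auto simp: mult.commute)
qed

lemma series_times_card:
  fixes w :: "'a \<Rightarrow> monomial" and w' :: "'b \<Rightarrow> monomial"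
  assumes "\<And>m. finite {x \<in> A. w x = m}" "\<And>m. finite {y \<in> B. w' y = m}"
  shows "((\<lambda>m. int (card {x \<in> A. w x = m})) \<star> (\<lambda>m. int (card {y \<in> B. w' y = m}))) m
    = int (card {(x, y). x \<in> A \<and> y \<in> B \<and> w x + w' y = m})"
proof -
  let ?C = "\<lambda>k. {x \<in> A. w x = k} \<times> {y \<in> B. w' y = m - k}"
  have "{(x, y). x \<in> A \<and> y \<in> B \<and> w x + w' y = m} = (\<Union>k\<in>{k. k \<subseteq># m}. ?C k)"
    by (auto simp: subset_mset.add_diff_inverse)
  moreover have "card (\<Union>k\<in>{k. k \<subseteq># m}. ?C k) = (\<Sum>k | k \<subseteq># m. card (?C k))"
    using assms by (intro card_UN_disjoint finite_subseteq_mset) auto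
  ultimately show ?thesis
    by (simp add: series_times_def card_cartesian_product)
qed

definition merge :: "(nat \<Rightarrow> nat set) \<times> (nat \<Rightarrow> nat set) \<Rightarrow> nat \<Rightarrow> nat set" where
  "merge p i = (if even i then fst p (i div 2) else snd p (i div 2))"

text \<open>\<open>interlacing\<close> does not mention positions, so gap 2 at \<open>2 * j\<close>
  or \<open>2 * j + 1\<close> becomes gap 1 at \<open>j\<close>.\<close>

lemma merge_in_families_iff:
  "merge (R, S) \<in> families 2 n \<longleftrightarrow>
    R \<in> families 1 (\<lambda>j. n (2 * j)) \<and> S \<in> families 1 (\<lambda>j. n (2 * j + 1))"
proof -
  have all: "(\<forall>i. P i) \<longleftrightarrow> (\<forall>j. P (2 * j)) \<and> (\<forall>j. P (2 * j + 1))" for P :: "nat \<Rightarrow> bool"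
    by (metis even_two_times_div_two odd_two_times_div_two_succ)
  have "merge (R, S) (2 * j) = R j" "merge (R, S) (2 * j + 2) = R (j + 1)"
    "merge (R, S) (2 * j + 1) = S j" "merge (R, S) (2 * j + 1 + 2) = S (j + 1)" for j
    by (simp_all add: merge_def)
  then show ?thesis
    unfolding families_def mem_Collect_eq by (subst all) (simp only:)
qed

text \<open>The bound \<open>N\<close> makes the supports finite; \<open>mset_set\<close> of an
  infinite set is empty, so weights would otherwise not be meaningful.\<close>

lemma family_weight_merge:
  assumes fin: "\<And>j. finite (R j)" "\<And>j. finite (S j)"
    and empty: "\<And>j. N \<le> j \<Longrightarrow> R j = {} \<and> S j = {}"
  shows "family_weight (merge (R, S)) = family_weight R + family_weight S"
proof -
  let ?D = "\<lambda>R. {(i, r). r \<in> R i}"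
  have finD: "finite (?D R)" if "\<And>j. finite (R j)" "\<And>j. N \<le> j \<Longrightarrow> R j = {}" for R :: "nat \<Rightarrow> nat set"
  proof (rule finite_subset)
    show "?D R \<subseteq> (SIGMA j:{..<N}. R j)"
      using that(2) by (force simp: not_le[symmetric])
  qed (use that(1) in auto)
  have fin': "finite (?D R)" "finite (?D S)"
    using finD fin empty by auto
  define e o' :: "nat \<times> nat \<Rightarrow> nat \<times> nat"
    where "e = (\<lambda>(j, r). (2 * j, r))" and "o' = (\<lambda>(j, r). (2 * j + 1, r))"
  have inj: "inj_on e A" "inj_on o' A" for A
    by (auto simp: e_def o'_def inj_on_def)
  have "?D (merge (R, S)) = e ` ?D R \<union> o' ` ?D S"
  proof (intro equalityI subsetI)
    fix p assume "p \<in> ?D (merge (R, S))"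
    then obtain i r where p: "p = (i, r)" "r \<in> merge (R, S) i" by blast
    show "p \<in> e ` ?D R \<union> o' ` ?D S"
    proof (cases "even i")
      case True
      then have "p = e (i div 2, r)" "r \<in> R (i div 2)"
        using p by (auto simp: e_def merge_def)
      then show ?thesis by blast
    next
      case False
      then have "p = o' (i div 2, r)" "r \<in> S (i div 2)"
        using p by (auto simp: o'_def merge_def)
      then show ?thesis by blast
    qed
  qed (auto simp: e_def o'_def merge_def)
  moreover have "e ` ?D R \<inter> o' ` ?D S = {}"
  proof -
    have "e p \<noteq> o' q" for p q
      by (cases p; cases q) (simp add: e_def o'_def, presburger)
    then show ?thesis by blast
  qed
  ultimately have "mset_set (?D (merge (R, S))) = mset_set (e ` ?D R) + mset_set (o' ` ?D S)"
    using fin' by (simp add: mset_set_Union)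
  also have "\<dots> = image_mset e (mset_set (?D R)) + image_mset o' (mset_set (?D S))"
    by (simp only: image_mset_mset_set[OF inj(1)] image_mset_mset_set[OF inj(2)])
  finally show ?thesis
    by (simp add: family_weight_def image_mset.compositionality comp_def e_def o'_def case_prod_unfold)
qed

lemma bij_betw_merge:
  "bij_betw merge (families 1 (\<lambda>j. n (2 * j)) \<times> families 1 (\<lambda>j. n (2 * j + 1))) (families 2 n)"
proof (rule bij_betw_byWitness[where f' = "\<lambda>R. (\<lambda>j. R (2 * j), \<lambda>j. R (2 * j + 1))"])
  have split: "merge (\<lambda>j. R (2 * j), \<lambda>j. R (2 * j + 1)) = R" for R
    by (auto simp: merge_def fun_eq_iff)
  then show "\<forall>R\<in>families 2 n. merge (\<lambda>j. R (2 * j), \<lambda>j. R (2 * j + 1)) = R"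
    by blast
  show "\<forall>p\<in>families 1 (\<lambda>j. n (2 * j)) \<times> families 1 (\<lambda>j. n (2 * j + 1)).
      (\<lambda>j. merge p (2 * j), \<lambda>j. merge p (2 * j + 1)) = p"
    by (auto simp: merge_def)
  show "merge ` (families 1 (\<lambda>j. n (2 * j)) \<times> families 1 (\<lambda>j. n (2 * j + 1))) \<subseteq> families 2 n"
    using merge_in_families_iff by blast
  show "(\<lambda>R. (\<lambda>j. R (2 * j), \<lambda>j. R (2 * j + 1))) ` families 2 n
      \<subseteq> families 1 (\<lambda>j. n (2 * j)) \<times> families 1 (\<lambda>j. n (2 * j + 1))"
  proof (rule image_subsetI)
    fix R assume "R \<in> families 2 n"
    then show "(\<lambda>j. R (2 * j), \<lambda>j. R (2 * j + 1))
        \<in> families 1 (\<lambda>j. n (2 * j)) \<times> families 1 (\<lambda>j. n (2 * j + 1))"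
      using merge_in_families_iff[of "\<lambda>j. R (2 * j)" "\<lambda>j. R (2 * j + 1)" n] unfolding split by blast
  qed
qed

section \<open>The bijection between shifted domino tableaux and families\<close>

context domino_filling
begin

lemma lower_part_eq_Some_iff: "lower_part T d = Some e \<longleftrightarrow> (\<exists>a. e = Letter a \<and> T d = Some (Letter a))"
proof (cases "d \<in> down_dominoes (dom T)")
  case True
  then have "\<exists>a\<in>alphabet. T d = Some (Letter a)"
    using filling by (simp add: shifted_domino_fillings_def)
  with True show ?thesis
    by (auto simp: lower_part_def)
next
  case False
  have "T d \<noteq> Some (Letter a)" for a
  proof
    assume a: "T d = Some (Letter a)"
    then have "d \<in> dom T" "0 \<le> position d"
      using letter_iff[of d] by auto
    then have "d \<in> down_dominoes (dom T)"
      using mem_up_dominoes_iff[OF domino, of d "dom T"] by (simp add: down_dominoes_def)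
    with False show False by simp
  qed
  with False show ?thesis
    by (simp add: lower_part_def)
qed

lemma ranks_at_lower_part: "ranks_at position (lower_part T) = R"
  by (simp add: ranks_at_def lower_part_eq_Some_iff fun_eq_iff)

lemma position_inj:
  assumes "T d = Some (Letter a)" "T e = Some (Letter a)" "position d = position e"
  shows "d = e"
  using domino_eq[OF assms(1)] domino_eq[OF assms(2)] assms(3) by metis

lemma weight_lower_part: "weight (lower_part T) = family_weight (ranks_at position (lower_part T))"
proof (rule weight_eq_family_weight)
  fix d a assume "lower_part T d = Some (Letter a)"
  then show "0 \<le> position d"
    using letter_iff[of d] by (auto simp: lower_part_eq_Some_iff)
next
  fix d e a assume "lower_part T d = Some (Letter a)" "lower_part T e = Some (Letter a)"
    "position d = position e"
  then show "d = e"
    using position_inj by (simp add: lower_part_eq_Some_iff)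
qed

end

context shifted_shape
begin

text \<open>A label of \<open>T\<close> has a counterpart in \<open>T'\<close> with the same
  position and letter, and \<open>domino_eq\<close> rebuilds both dominoes from the same
  data.\<close>

lemma lower_part_le:
  assumes T: "T \<in> shifted_domino_fillings lam" and T': "T' \<in> shifted_domino_fillings lam"
    and eq: "ranks_at position T = ranks_at position T'" and d: "lower_part T d = Some e"
  shows "lower_part T' d = Some e"
proof -
  interpret T: domino_filling lam n T
    by unfold_locales (rule T)
  interpret T': domino_filling lam n T'
    by unfold_locales (rule T')
  obtain a where a: "e = Letter a" "T d = Some (Letter a)"
    using d by (auto simp: T.lower_part_eq_Some_iff)
  define i where "i = nat (position d)"
  have pos: "position d = int i"
    using T.letter_iff[of d] a(2) by (auto simp: i_def)
  have "rank a \<in> ranks_at position T i"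
    unfolding ranks_at_def using a(2) pos by blast
  then obtain b d' where b: "T' d' = Some (Letter b)" "position d' = int i" "rank a = rank b"
    unfolding eq unfolding ranks_at_def by blast
  have "d' = d"
    using T.domino_eq[OF a(2)] T'.domino_eq[OF b(1)] pos b(2,3) eq by metis
  then show ?thesis
    using b a by (simp add: T'.lower_part_eq_Some_iff rank_inject)
qed

lemma bij_betw_domino:
  "bij_betw (ranks_at position) (shifted_domino_tableaux lam) (families 2 n)"
  unfolding bij_betw_def
proof
  have filling: "domino_filling lam n T" if "T \<in> shifted_domino_fillings lam" for T
    by unfold_locales (rule that)
  show "inj_on (ranks_at position) (shifted_domino_tableaux lam)"
  proof (rule inj_onI)
    fix U U' assume "U \<in> shifted_domino_tableaux lam" "U' \<in> shifted_domino_tableaux lam"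
      and eq: "ranks_at position U = ranks_at position U'"
    then obtain T T' where T: "T \<in> shifted_domino_fillings lam" "U = lower_part T"
      and T': "T' \<in> shifted_domino_fillings lam" "U' = lower_part T'"
      by (auto simp: shifted_domino_tableaux_def)
    have eq': "ranks_at position T = ranks_at position T'"
      using eq domino_filling.ranks_at_lower_part[OF filling[OF T(1)]]
        domino_filling.ranks_at_lower_part[OF filling[OF T'(1)]] T(2) T'(2) by simp
    show "U = U'"
    proof
      fix d
      show "U d = U' d"
        using lower_part_le[OF T(1) T'(1) eq', of d] lower_part_le[OF T'(1) T(1) eq'[symmetric], of d]
        unfolding T(2) T'(2) by (metis option.exhaust)
    qed
  qed
  show "ranks_at position ` shifted_domino_tableaux lam = families 2 n"
  proof (intro equalityI subsetI)
    fix R assume "R \<in> ranks_at position ` shifted_domino_tableaux lam"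
    then obtain T where T: "T \<in> shifted_domino_fillings lam" "R = ranks_at position (lower_part T)"
      by (auto simp: shifted_domino_tableaux_def)
    then show "R \<in> families 2 n"
      using domino_filling.R_in_families[OF filling[OF T(1)]]
        domino_filling.ranks_at_lower_part[OF filling[OF T(1)]] by simp
  next
    fix R assume "R \<in> families 2 n"
    then obtain T where T: "T \<in> shifted_domino_fillings lam" "ranks_at position T = R"
      by (rule ex_filling)
    then have "R = ranks_at position (lower_part T)"
      using domino_filling.ranks_at_lower_part[OF filling[OF T(1)]] by simp
    moreover have "lower_part T \<in> shifted_domino_tableaux lam"
      using T(1) by (simp add: shifted_domino_tableaux_def)
    ultimately show "R \<in> ranks_at position ` shifted_domino_tableaux lam"
      by (rule image_eqI)
  qed
qed

lemma gen_series_domino_tableaux: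
  "gen_series (shifted_domino_tableaux lam) m = int (card {R \<in> families 2 n. family_weight R = m})"
proof -
  have "weight U = family_weight (ranks_at position U)" if U: "U \<in> shifted_domino_tableaux lam" for U
  proof -
    obtain T where T: "T \<in> shifted_domino_fillings lam" "U = lower_part T"
      using U by (auto simp: shifted_domino_tableaux_def)
    interpret domino_filling lam n T
      by unfold_locales (rule T(1))
    show ?thesis
      unfolding T(2) by (rule weight_lower_part)
  qed
  then show ?thesis
    using bij_betw_card_filter[OF bij_betw_domino, of weight family_weight m]
    by (simp add: gen_series_def)
qed

lemma gen_series_eq_Q_times_Q:
  assumes mu: "sorted_wrt (\<ge>) mu" "\<And>j. diag_length mu j = n (2 * j)"
    and nu: "sorted_wrt (\<ge>) nu" "\<And>j. diag_length nu j = n (2 * j + 1)"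
  shows "gen_series (shifted_domino_tableaux lam) = Q mu \<star> Q nu"
proof
  fix m
  let ?F = "families 1 (diag_length mu)" and ?G = "families 1 (diag_length nu)"
  define N where "N = mu ! 0 + nu ! 0"
  have zero: "diag_length mu j = 0 \<and> diag_length nu j = 0" if "N \<le> j" for j
  proof -
    have "(j + 0, 0) \<notin> diagram mu" "(j + 0, 0) \<notin> diagram nu"
      using that by (simp_all add: diagram_def N_def)
    then show ?thesis
      using mem_diagram_iff[OF mu(1), of j 0] mem_diagram_iff[OF nu(1), of j 0] by simp
  qed
  have weight: "family_weight (merge p) = family_weight (fst p) + family_weight (snd p)"
    if p: "p \<in> ?F \<times> ?G" for p
  proof -
    obtain R S where RS: "p = (R, S)" by (cases p)
    then have fin: "finite (R j)" "finite (S j)" "card (R j) = diag_length mu j" "card (S j) = diag_length nu j" for j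
      using p by (auto simp: families_def)
    then have "R j = {} \<and> S j = {}" if "N \<le> j" for j
      using zero[OF that] by (metis card_eq_0_iff)
    with fin show ?thesis
      unfolding RS fst_conv snd_conv by (intro family_weight_merge[of _ _ N]) auto
  qed
  have "(\<lambda>j. n (2 * j)) = diag_length mu" "(\<lambda>j. n (2 * j + 1)) = diag_length nu"
    using mu(2) nu(2) by auto
  then have "bij_betw merge (?F \<times> ?G) (families 2 n)"
    using bij_betw_merge[of n] by simp
  from bij_betw_card_filter[OF this, of "\<lambda>p. family_weight (fst p) + family_weight (snd p)" family_weight m] weight
  have "card {R \<in> families 2 n. family_weight R = m}
      = card {p \<in> ?F \<times> ?G. family_weight (fst p) + family_weight (snd p) = m}"
    by simp
  also have "{p \<in> ?F \<times> ?G. family_weight (fst p) + family_weight (snd p) = m}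
      = {(R, S). R \<in> ?F \<and> S \<in> ?G \<and> family_weight R + family_weight S = m}"
    by auto
  finally have "gen_series (shifted_domino_tableaux lam) m
      = int (card {(R, S). R \<in> ?F \<and> S \<in> ?G \<and> family_weight R + family_weight S = m})"
    by (simp add: gen_series_domino_tableaux)
  also have "\<dots> = ((\<lambda>m. int (card {R \<in> ?F. family_weight R = m})) \<star> (\<lambda>m. int (card {S \<in> ?G. family_weight S = m}))) m"
    by (rule series_times_card[symmetric]) (use Q_eq_card_families(2) mu(1) nu(1) in blast)+
  also have "(\<lambda>m. int (card {R \<in> ?F. family_weight R = m})) = Q mu"
    using Q_eq_card_families(1)[OF mu(1)] by auto
  also have "(\<lambda>m. int (card {S \<in> ?G. family_weight S = m})) = Q nu"
    using Q_eq_card_families(1)[OF nu(1)] by auto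
  finally show "gen_series (shifted_domino_tableaux lam) m = (Q mu \<star> Q nu) m" .
qed

end

section \<open>Diagonals of the 2-quotient\<close>

lemma nth_descending_gap:
  assumes "sorted_wrt (>) (B :: nat list)" "i \<le> j" "j < length B"
  shows "B ! j + (j - i) \<le> B ! i"
  using assms(2,3)
proof (induction j rule: dec_induct)
  case (step j)
  have "B ! Suc j < B ! j"
    using assms(1) step.prems by (simp add: sorted_wrt_iff_nth_less)
  with step show ?case by simp
qed simp

lemma less_card_ge_iff:
  assumes "sorted_wrt (>) (B :: nat list)"
  shows "y < card {b \<in> set B. k \<le> b} \<longleftrightarrow> y < length B \<and> k \<le> B ! y"
proof -
  let ?I = "{i. i < length B \<and> k \<le> B ! i}"
  have "{b \<in> set B. k \<le> b} = (!) B ` ?I"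
    by (auto simp: in_set_conv_nth)
  moreover have "inj_on ((!) B) ?I"
    using assms by (intro inj_onI) (metis (mono_tags, lifting) linorder_neqE_nat mem_Collect_eq order_less_irrefl sorted_wrt_iff_nth_less)
  ultimately have "card {b \<in> set B. k \<le> b} = card ?I"
    by (simp add: card_image)
  moreover have "y \<in> ?I \<longleftrightarrow> y < card ?I"
  proof (rule mem_iff_less_card)
    fix i j assume "i \<in> ?I" "j \<le> i"
    then show "j \<in> ?I"
      using nth_descending_gap[OF assms, of j i] by auto
  qed simp
  ultimately show ?thesis by simp
qed

text \<open>The inverse of taking beta-numbers: the rows, possibly zero, of the partition whose
  beta-numbers are the given strictly decreasing list.\<close>

fun beta_parts :: "nat list \<Rightarrow> nat list" where
  "beta_parts [] = []"
| "beta_parts (b # bs) = (b - length bs) # beta_parts bs"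

lemma length_beta_parts [simp]: "length (beta_parts B) = length B"
  by (induction B) auto

lemma nth_beta_parts: "y < length B \<Longrightarrow> beta_parts B ! y = B ! y - (length B - Suc y)"
proof (induction B arbitrary: y)
  case (Cons b B)
  then show ?case by (cases y) auto
qed simp

lemma sorted_beta_parts:
  assumes "sorted_wrt (>) B" shows "sorted_wrt (\<ge>) (beta_parts B)"
  unfolding sorted_wrt_iff_nth_less
proof (intro allI impI)
  fix i j assume "i < j" "j < length (beta_parts B)"
  then show "beta_parts B ! j \<le> beta_parts B ! i"
    using nth_descending_gap[OF assms, of i j] by (simp add: nth_beta_parts)
qed

lemma mem_diagram_Cons:
  "(x, y) \<in> diagram (a # mu) \<longleftrightarrow> (case y of 0 \<Rightarrow> x < a | Suc y' \<Rightarrow> (x, y') \<in> diagram mu)"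
  by (cases y) (auto simp: diagram_def)

lemma diagram_filter_nonzero:
  "sorted_wrt (\<ge>) mu \<Longrightarrow> diagram (filter (\<lambda>k. k \<noteq> 0) mu) = diagram mu"
proof (induction mu)
  case (Cons a mu)
  show ?case
  proof (cases "a = 0")
    case True
    with Cons.prems have zero: "\<forall>b\<in>set mu. b = 0" by simp
    then have "filter (\<lambda>k. k \<noteq> 0) mu = []" by simp
    moreover have "(a # mu) ! y = 0" if "y < length (a # mu)" for y
      using zero True that nth_mem[OF that] by auto
    ultimately show ?thesis
      using True by (auto simp: diagram_def)
  next
    case False
    then show ?thesis
      using Cons by (auto simp: mem_diagram_Cons split: nat.splits)
  qed
qed simp

definition partition_of_beta :: "nat list \<Rightarrow> nat list" where
  "partition_of_beta B = filter (\<lambda>k. k \<noteq> 0) (beta_parts B)"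

lemma sorted_partition_of_beta: "sorted_wrt (>) B \<Longrightarrow> sorted_wrt (\<ge>) (partition_of_beta B)"
  unfolding partition_of_beta_def by (rule sorted_wrt_filter[OF sorted_beta_parts])

text \<open>Row \<open>y\<close> reaches beyond \<open>x\<close> when entry \<open>y\<close> of
  \<open>B\<close> is at least \<open>length B + x - y\<close>, and in a descending list this is a
  statement about a count. The additive form avoids truncation and shows that the counted set
  depends on the diagonal alone.\<close>

lemma mem_diagram_beta:
  assumes "sorted_wrt (>) B"
  shows "(x, y) \<in> diagram (partition_of_beta B) \<longleftrightarrow> y < card {b \<in> set B. length B + x \<le> b + y}"
proof -
  have "(x, y) \<in> diagram (partition_of_beta B) \<longleftrightarrow> y < length B \<and> x < B ! y - (length B - Suc y)"
    unfolding partition_of_beta_def diagram_filter_nonzero[OF sorted_beta_parts[OF assms]]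
    by (auto simp: diagram_def nth_beta_parts)
  also have "\<dots> \<longleftrightarrow> y < length B \<and> length B + x - y \<le> B ! y"
    using nth_descending_gap[OF assms, of y "length B - 1"] by auto
  also have "\<dots> \<longleftrightarrow> y < card {b \<in> set B. length B + x - y \<le> b}"
    by (rule less_card_ge_iff[OF assms, symmetric])
  also have "{b \<in> set B. length B + x - y \<le> b} = {b \<in> set B. length B + x \<le> b + y}"
    by auto
  finally show ?thesis .
qed

lemma diag_length_beta:
  assumes "sorted_wrt (>) B"
  shows "diag_length (partition_of_beta B) c = card {b \<in> set B. length B + c \<le> b}"
proof -
  have "y < diag_length (partition_of_beta B) c \<longleftrightarrow> y < card {b \<in> set B. length B + c \<le> b}" for y
    using mem_diagram_iff[OF sorted_partition_of_beta[OF assms], of c y] mem_diagram_beta[OF assms, of "c + y" y]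
    by (simp add: add.assoc[symmetric])
  then show ?thesis by (metis linorder_neqE_nat less_irrefl)
qed

text \<open>Every row \<open>y\<close> of a shiftable partition has more than \<open>y\<close>
  cells, so for \<open>s \<le> y\<close> the cell \<open>(y - s, y)\<close> is present exactly when
  the row exists. The indices \<open>y < s\<close> are always counted, since entry \<open>y\<close>
  of \<open>B\<close> is at least \<open>length B - 1 - y\<close>. For \<open>s = 0\<close> the
  count is the number of parts.\<close>

lemma shiftable_beta:
  assumes B: "sorted_wrt (>) B" and shiftable: "shiftable (partition_of_beta B)" and "s \<le> length B"
  shows "card {b \<in> set B. length B \<le> b + s} = max s (card {b \<in> set B. length B \<le> b})"
proof -
  let ?mu = "partition_of_beta B"
  have mu: "?mu ! y > y - s" if "y < length ?mu" for y s
  proof -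
    have "?mu \<noteq> []" using that by auto
    then have "length ?mu \<le> ?mu ! (length ?mu - 1)"
      using shiftable by (simp add: shiftable_def last_conv_nth)
    also have "\<dots> \<le> ?mu ! y"
      using sorted_nth_mono[OF sorted_partition_of_beta[OF B], of y "length ?mu - 1"] that by simp
    finally show ?thesis using that by simp
  qed
  have "y < card {b \<in> set B. length B \<le> b + s} \<longleftrightarrow> y < s \<or> y < length ?mu" if "s \<le> length B" for y s
  proof (cases "y < s")
    case True
    have "B ! (length B - 1) + (length B - 1 - y) \<le> B ! y"
      by (rule nth_descending_gap[OF B]) (use True that in auto)
    then have "length B - s \<le> B ! y"
      using True that by linarith
    then have "y < card {b \<in> set B. length B - s \<le> b}"
      using less_card_ge_iff[OF B, of y "length B - s"] True that by simp
    moreover have "{b \<in> set B. length B - s \<le> b} = {b \<in> set B. length B \<le> b + s}"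
      by auto
    ultimately show ?thesis using True by simp
  next
    case False
    then have "{b \<in> set B. length B \<le> b + s} = {b \<in> set B. length B + (y - s) \<le> b + y}"
      by auto
    then have "y < card {b \<in> set B. length B \<le> b + s} \<longleftrightarrow> (y - s, y) \<in> diagram ?mu"
      using mem_diagram_beta[OF B, of "y - s" y] by simp
    also have "\<dots> \<longleftrightarrow> y < length ?mu"
      using mu by (auto simp: diagram_def)
    finally show ?thesis using False by simp
  qed
  note * = this[OF \<open>s \<le> length B\<close>] this[of 0]
  have "y < card {b \<in> set B. length B \<le> b + s} \<longleftrightarrow> y < max s (card {b \<in> set B. length B \<le> b})" for y
    using *(1)[of y] *(2)[of y] by auto
  then show ?thesis by (metis linorder_neqE_nat less_irrefl)
qed

section \<open>The 2-quotient through halved beta-numbers\<close>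

lemma quotient_L_Cons: "quotient_L (a # lam) = (a + length lam) # quotient_L lam"
proof -
  have "quotient_L (a # lam) = map (\<lambda>i. (a # lam) ! i + (length (a # lam) - Suc i)) (0 # map Suc [0..<length lam])"
    unfolding quotient_L_def by (simp add: upt_conv_Cons map_Suc_upt del: upt_Suc)
  then show ?thesis
    by (simp add: quotient_L_def comp_def)
qed

lemma length_quotient_L [simp]: "length (quotient_L lam) = length lam"
  by (simp add: quotient_L_def)

lemma beta_parts_quotient_L: "beta_parts (quotient_L lam) = lam"
  by (induction lam) (simp_all add: quotient_L_Cons, simp add: quotient_L_def)

lemma sorted_quotient_L: "sorted_wrt (\<ge>) lam \<Longrightarrow> sorted_wrt (>) (quotient_L lam)"
  unfolding sorted_wrt_iff_nth_less
proof (intro allI impI)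
  fix i j assume *: "\<forall>i j. i < j \<longrightarrow> j < length lam \<longrightarrow> lam ! j \<le> lam ! i"
    and ij: "i < j" "j < length (quotient_L lam)"
  then have "lam ! j \<le> lam ! i" by simp
  with ij show "quotient_L lam ! j < quotient_L lam ! i"
    by (simp add: quotient_L_def)
qed

lemma partition_of_beta_quotient_L:
  assumes "is_partition lam" shows "partition_of_beta (quotient_L lam) = lam"
  using assms unfolding partition_of_beta_def beta_parts_quotient_L is_partition_def
  by (intro filter_True ballI notI) simp

definition halves :: "(nat \<Rightarrow> bool) \<Rightarrow> nat list \<Rightarrow> nat list" where
  "halves P L = map (\<lambda>l. l div 2) (filter P L)"

text \<open>\<open>quotient_M\<close> replaces an entry by its residue plus twice the number of
  later entries of its parity. Halving the difference removes the residue and leaves the subtraction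
  made by \<open>beta_parts\<close> on the halved entries.\<close>

lemma parts_eq_beta_parts:
  assumes "P = even \<or> P = odd"
  shows "map (\<lambda>(l, m). (l - m) div 2) (filter (\<lambda>(l, m). P l) (zip L (quotient_M L))) = beta_parts (halves P L)"
proof (induction L)
  case (Cons a L)
  have "(a - (a mod 2 + 2 * k)) div 2 = a div 2 - k" for k
  proof -
    have "a - (a mod 2 + 2 * k) = 2 * (a div 2) - 2 * k"
      by (metis diff_diff_left minus_mod_eq_mult_div)
    then show ?thesis
      by (metis diff_mult_distrib2 nonzero_mult_div_cancel_left zero_neq_numeral)
  qed
  moreover have "filter (\<lambda>b. even b = even a) L = filter P L" if "P a"
    using assms that by (auto intro!: filter_cong)
  ultimately show ?case
    using Cons by (auto simp: halves_def)
qed (simp add: halves_def)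

lemma two_quotient_eq:
  "two_quotient lam = (partition_of_beta (halves even (quotient_L lam)), partition_of_beta (halves odd (quotient_L lam)))"
  using parts_eq_beta_parts[of even] parts_eq_beta_parts[of odd]
  by (simp add: two_quotient_def Let_def partition_of_beta_def)

lemma sorted_halves:
  assumes "sorted_wrt (>) L" "P = even \<or> P = odd"
  shows "sorted_wrt (>) (halves P L)"
proof -
  have "sorted_wrt (\<lambda>a b. b div 2 < a div 2) (filter P L)"
  proof (rule sorted_wrt_mono_rel[OF _ sorted_wrt_filter[OF assms(1)]])
    fix a b assume "a \<in> set (filter P L)" "b \<in> set (filter P L)" "b < a"
    then show "b div 2 < a div 2"
      using assms(2) by (elim disjE) (auto elim!: evenE oddE)
  qed
  then show ?thesis
    by (simp add: halves_def sorted_wrt_map)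
qed

lemma card_halves:
  assumes "P = even \<or> P = odd"
  shows "card {b \<in> set (halves P L). C b} = card {l \<in> set L. P l \<and> C (l div 2)}"
proof -
  have "{b \<in> set (halves P L). C b} = (\<lambda>l. l div 2) ` {l \<in> set L. P l \<and> C (l div 2)}"
    by (auto simp: halves_def)
  moreover have "inj_on (\<lambda>l. l div 2) {l \<in> set L. P l \<and> C (l div 2)}"
  proof (rule inj_onI)
    fix a b assume "a \<in> {l \<in> set L. P l \<and> C (l div 2)}" "b \<in> {l \<in> set L. P l \<and> C (l div 2)}"
      and eq: "a div 2 = b div 2"
    then have "even a = even b"
      using assms by auto
    with eq show "a = b" by presburger
  qed
  ultimately show ?thesis by (simp add: card_image)
qed

section \<open>Chessboard colouring and the balance of even and odd beta-numbers\<close>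

definition cell_sign :: "cell \<Rightarrow> int" where
  "cell_sign p = (- 1) ^ (fst p + snd p)"

lemma sum_cell_sign_domino: "domino d \<Longrightarrow> sum cell_sign d = 0"
  by (auto simp: domino_def horizontal_domino_def vertical_domino_def cell_sign_def)

text \<open>A domino covers one cell of each colour, so the signed sum is invariant under
  removals.\<close>

lemma sum_cell_sign_remove:
  assumes "remove_domino\<^sup>*\<^sup>* A B" "finite A"
  shows "sum cell_sign A = sum cell_sign B \<and> finite B"
  using assms
proof (induction rule: rtranclp_induct)
  case (step B C)
  then obtain d where d: "domino d" "d \<subseteq> B" "C = B - d"
    by (auto simp: remove_domino_def removable_def)
  then show ?case
    using step sum_cell_sign_domino[OF d(1)] by (simp add: sum_diff)
qed simp

lemma sum_cell_sign_pavable: "pavable lam \<Longrightarrow> sum cell_sign (diagram lam) = 0"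
  using sum_cell_sign_remove[of "diagram lam" "{}"]
  by (simp add: pavable_def is_two_core_def finite_diagram)

lemma sum_cell_sign_Cons:
  "sum cell_sign (diagram (a # lam)) = int (a mod 2) - sum cell_sign (diagram lam)"
proof -
  let ?row = "(\<lambda>x. (x, 0 :: nat)) ` {..<a}" and ?up = "(\<lambda>(x, y). (x, Suc y)) ` diagram lam"
  have eq: "diagram (a # lam) = ?row \<union> ?up"
  proof (intro equalityI subsetI)
    fix p assume "p \<in> diagram (a # lam)"
    then show "p \<in> ?row \<union> ?up"
      by (cases p; cases "snd p") (auto simp: mem_diagram_Cons)
  qed (auto simp: mem_diagram_Cons)
  have "sum cell_sign (diagram (a # lam)) = sum cell_sign ?row + sum cell_sign ?up"
    unfolding eq by (rule sum.union_disjoint) (auto simp: finite_diagram)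
  also have "sum cell_sign ?row = (\<Sum>x<a. (- 1) ^ x)"
    by (subst sum.reindex) (auto simp: inj_on_def cell_sign_def)
  also have "\<dots> = int (a mod 2)"
  proof (induction a)
    case (Suc a)
    then show ?case by (cases "even a") (auto simp: mod2_eq_if)
  qed simp
  also have "sum cell_sign ?up = - sum cell_sign (diagram lam)"
    by (subst sum.reindex) (auto simp: inj_on_def cell_sign_def sum_negf[symmetric] intro!: sum.cong)
  finally show ?thesis by simp
qed

text \<open>A new first row adds one beta-number of the parity of \<open>a + length lam\<close> and
  lifts the old diagram by one, which flips its signs; the power of -1 absorbs the flip. The term
  \<open>length lam mod 2\<close> is the difference for the beta-numbers 0, ...,
  \<open>length lam - 1\<close> of the empty partition.\<close>

lemma length_halves_diff:
  "int (length (halves even (quotient_L lam))) - int (length (halves odd (quotient_L lam)))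
    = int (length lam mod 2) + 2 * (- 1) ^ length lam * sum cell_sign (diagram lam)"
proof (induction lam)
  case Nil
  then show ?case by (simp add: halves_def quotient_L_def diagram_def)
next
  case (Cons a lam)
  define l where "l = length lam"
  have "int (length (halves even (quotient_L (a # lam)))) - int (length (halves odd (quotient_L (a # lam))))
      = int (length (halves even (quotient_L lam))) - int (length (halves odd (quotient_L lam)))
        + (if even (a + l) then 1 else - 1)"
    by (simp add: halves_def quotient_L_Cons l_def)
  also have "\<dots> = int (l mod 2) + 2 * (- 1) ^ l * sum cell_sign (diagram lam) + (if even (a + l) then 1 else - 1)"
    unfolding Cons.IH l_def ..
  also have "\<dots> = int (Suc l mod 2) + 2 * (- 1) ^ Suc l * (int (a mod 2) - sum cell_sign (diagram lam))"
    by (cases "even a"; cases "even l") (auto simp: mod2_eq_if algebra_simps)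
  finally show ?case
    unfolding sum_cell_sign_Cons by (simp add: l_def)
qed

lemma length_halves_add:
  "length (halves even L) + length (halves odd L) = length L"
  using sum_length_filter_compl[of even L] by (simp add: halves_def)

text \<open>Pavability enters through the vanishing signed sum: each parity class is as large as for
  the empty partition with the same number of rows.\<close>

lemma length_halves_pavable:
  assumes "pavable lam"
  shows "length (halves even (quotient_L lam)) = (length lam + 1) div 2"
    and "length (halves odd (quotient_L lam)) = length lam div 2"
proof -
  have "int (length (halves even (quotient_L lam))) - int (length (halves odd (quotient_L lam))) = int (length lam mod 2)"
    unfolding length_halves_diff sum_cell_sign_pavable[OF assms] by simp
  moreover have "length (halves even (quotient_L lam)) + length (halves odd (quotient_L lam)) = length lam"
    using length_halves_add[of "quotient_L lam"] by simp
  moreover have "e = (l + 1) div 2 \<and> k = l div 2"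
    if "int e - int k = int (l mod 2)" "e + k = l" for e k l
    using that by (cases "even l") (auto elim!: evenE oddE)
  ultimately show "length (halves even (quotient_L lam)) = (length lam + 1) div 2"
    and "length (halves odd (quotient_L lam)) = length lam div 2"
    by blast+
qed

text \<open>The number of dominoes at position \<open>i\<close> in a paving. Adding such a domino
  raises a beta-number from \<open>length lam + i - 2\<close> to \<open>length lam + i\<close>, and
  the initial beta-numbers are all below \<open>length lam\<close>, so the raises are counted by the
  final beta-numbers of this parity that are at least \<open>length lam + i\<close>.\<close>

definition beta_count :: "nat list \<Rightarrow> nat \<Rightarrow> nat" where
  "beta_count lam i = card {l \<in> set (quotient_L lam). length lam + i \<le> l \<and> even (length lam + i + l)}"

lemma card_split_parity:
  fixes S :: "nat set"
  assumes "finite S"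
  shows "card S = card {l \<in> S. even l} + card {l \<in> S. odd l}"
proof -
  have "card ({l \<in> S. even l} \<union> {l \<in> S. odd l}) = card {l \<in> S. even l} + card {l \<in> S. odd l}"
    using assms by (intro card_Un_disjoint) auto
  moreover have "{l \<in> S. even l} \<union> {l \<in> S. odd l} = S" by auto
  ultimately show ?thesis by simp
qed

text \<open>A beta-number that is at least \<open>length lam + c\<close> but of the other parity is
  at least \<open>length lam + Suc c\<close>.\<close>

lemma diag_length_eq_beta_count:
  assumes "is_partition lam"
  shows "diag_length lam c = beta_count lam c + beta_count lam (Suc c)"
proof -
  let ?k = "length lam + c" and ?L = "set (quotient_L lam)"
  have sorted: "sorted_wrt (>) (quotient_L lam)"
    using assms by (intro sorted_quotient_L) (simp add: is_partition_def)
  have "diag_length lam c = card {l \<in> ?L. ?k \<le> l}"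
    using diag_length_beta[OF sorted, of c] by (simp add: partition_of_beta_quotient_L[OF assms])
  also have "\<dots> = card ({l \<in> ?L. ?k \<le> l \<and> even (?k + l)} \<union> {l \<in> ?L. Suc ?k \<le> l \<and> even (Suc ?k + l)})"
  proof (rule arg_cong[where f = card])
    have "?k \<le> l \<longleftrightarrow> ?k \<le> l \<and> even (?k + l) \<or> Suc ?k \<le> l \<and> even (Suc ?k + l)" for l
      by (cases "?k = l") auto
    then show "{l \<in> ?L. ?k \<le> l} = {l \<in> ?L. ?k \<le> l \<and> even (?k + l)} \<union> {l \<in> ?L. Suc ?k \<le> l \<and> even (Suc ?k + l)}"
      by blast
  qed
  also have "\<dots> = beta_count lam c + beta_count lam (Suc c)"
    unfolding beta_count_def by (subst card_Un_disjoint) auto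
  finally show ?thesis .
qed

text \<open>The quotient partitions correspond to the even and the odd positions of the dominoes; which is
  which depends on the parity of the length.\<close>

definition beta_classes :: "nat list \<Rightarrow> nat list \<times> nat list" where
  "beta_classes lam =
     (let e = halves even (quotient_L lam); k = halves odd (quotient_L lam)
      in if even (length lam) then (e, k) else (k, e))"

text \<open>By the balance, the threshold \<open>length B + j\<close> for halved numbers corresponds
  exactly to \<open>length lam + 2 * j\<close> before halving, and \<open>length B' + j\<close> to
  \<open>length lam + 2 * j + 1\<close>. In the last equation the threshold is lowered by
  \<open>k\<close>; halving rounds \<open>k\<close> down in the class of the parity of
  \<open>length lam\<close> and up in the other.\<close>

lemma beta_classes:
  assumes lam: "is_partition lam" "pavable lam" and B: "beta_classes lam = (B, B')"
  shows "sorted_wrt (>) B" "sorted_wrt (>) B'"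
    and "length B = length lam div 2" "length B' = Suc (length lam) div 2"
    and "card {b \<in> set B. length B + j \<le> b} = beta_count lam (2 * j)"
    and "card {b \<in> set B'. length B' + j \<le> b} = beta_count lam (2 * j + 1)"
    and "card {l \<in> set (quotient_L lam). length lam \<le> l + k} =
      card {b \<in> set B. length B \<le> b + k div 2} + card {b \<in> set B'. length B' \<le> b + Suc k div 2}"
proof -
  let ?L = "set (quotient_L lam)" and ?n = "length lam"
  have "sorted_wrt (>) (quotient_L lam)"
    using lam(1) by (intro sorted_quotient_L) (simp add: is_partition_def)
  then have sorted: "sorted_wrt (>) (halves even (quotient_L lam))" "sorted_wrt (>) (halves odd (quotient_L lam))"
    by (simp_all add: sorted_halves)
  note len = length_halves_pavable[OF lam(2)]
  have card_even: "card {b \<in> set (halves even (quotient_L lam)). C b} = card {l \<in> ?L. even l \<and> C (l div 2)}" for C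
    by (rule card_halves) simp
  have card_odd: "card {b \<in> set (halves odd (quotient_L lam)). C b} = card {l \<in> ?L. odd l \<and> C (l div 2)}" for C
    by (rule card_halves) simp
  have split: "card {l \<in> ?L. ?n \<le> l + k} = card {l \<in> ?L. even l \<and> ?n \<le> l + k} + card {l \<in> ?L. odd l \<and> ?n \<le> l + k}"
    using card_split_parity[of "{l \<in> ?L. ?n \<le> l + k}"] by (simp add: conj_commute conj_left_commute)
  note defs = beta_classes_def Let_def
  show "sorted_wrt (>) B" "sorted_wrt (>) B'"
    using B sorted by (auto simp: defs split: if_splits)
  show lenB: "length B = ?n div 2" "length B' = Suc ?n div 2"
    using B len by (auto simp: defs split: if_splits)
  have C1: "even l \<and> ?n div 2 + j \<le> l div 2 \<longleftrightarrow> ?n + 2 * j \<le> l \<and> even (?n + 2 * j + l)" if "even ?n" for l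
    using that by (cases "even l") (auto elim!: evenE oddE)
  have C2: "odd l \<and> ?n div 2 + j \<le> l div 2 \<longleftrightarrow> ?n + 2 * j \<le> l \<and> even (?n + 2 * j + l)" if "odd ?n" for l
    using that by (cases "even l") (auto elim!: evenE oddE)
  have C3: "odd l \<and> Suc ?n div 2 + j \<le> l div 2 \<longleftrightarrow> ?n + (2 * j + 1) \<le> l \<and> even (?n + (2 * j + 1) + l)" if "even ?n" for l
    using that by (cases "even l") (auto elim!: evenE oddE)
  have C4: "even l \<and> Suc ?n div 2 + j \<le> l div 2 \<longleftrightarrow> ?n + (2 * j + 1) \<le> l \<and> even (?n + (2 * j + 1) + l)" if "odd ?n" for l
    using that by (cases "even l") (auto elim!: evenE oddE)
  show "card {b \<in> set B. length B + j \<le> b} = beta_count lam (2 * j)"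
  proof (cases "even ?n")
    case True
    then have "B = halves even (quotient_L lam)" using B by (simp add: defs)
    then show ?thesis
      unfolding lenB beta_count_def using card_even[of "\<lambda>b. ?n div 2 + j \<le> b"] C1[OF True] by simp
  next
    case False
    then have "B = halves odd (quotient_L lam)" using B by (simp add: defs)
    then show ?thesis
      unfolding lenB beta_count_def using card_odd[of "\<lambda>b. ?n div 2 + j \<le> b"] C2[OF False] by simp
  qed
  show "card {b \<in> set B'. length B' + j \<le> b} = beta_count lam (2 * j + 1)"
  proof (cases "even ?n")
    case True
    then have "B' = halves odd (quotient_L lam)" using B by (simp add: defs)
    then show ?thesis
      unfolding lenB beta_count_def using card_odd[of "\<lambda>b. Suc ?n div 2 + j \<le> b"] C3[OF True] by simp
  next
    case False
    then have "B' = halves even (quotient_L lam)" using B by (simp add: defs)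
    then show ?thesis
      unfolding lenB beta_count_def using card_even[of "\<lambda>b. Suc ?n div 2 + j \<le> b"] C4[OF False] by simp
  qed
  show "card {l \<in> ?L. ?n \<le> l + k} =
      card {b \<in> set B. length B \<le> b + k div 2} + card {b \<in> set B'. length B' \<le> b + Suc k div 2}"
  proof -
    have aux: "2 * p \<le> 2 * q + k \<longleftrightarrow> p \<le> q + k div 2" "2 * p \<le> 2 * q + 1 + k \<longleftrightarrow> p \<le> q + Suc k div 2" for p q
      by presburger+
    show ?thesis
    proof (cases "even ?n")
      case True
      then obtain p where p: "?n = 2 * p" by (rule evenE)
      from True have BB: "B = halves even (quotient_L lam)" "B' = halves odd (quotient_L lam)"
        using B by (simp_all add: defs)
      have "even l \<and> ?n \<le> l + k \<longleftrightarrow> even l \<and> ?n div 2 \<le> l div 2 + k div 2"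
        "odd l \<and> ?n \<le> l + k \<longleftrightarrow> odd l \<and> Suc ?n div 2 \<le> l div 2 + Suc k div 2" for l
        using aux[of p "l div 2"] by (cases "even l"; auto simp: p elim!: evenE oddE)+
      then show ?thesis
        unfolding split lenB using BB card_even[of "\<lambda>b. ?n div 2 \<le> b + k div 2"]
          card_odd[of "\<lambda>b. Suc ?n div 2 \<le> b + Suc k div 2"] by simp
    next
      case False
      then obtain p where p: "?n = 2 * p + 1" by (rule oddE)
      from False have BB: "B = halves odd (quotient_L lam)" "B' = halves even (quotient_L lam)"
        using B by (simp_all add: defs)
      have "odd l \<and> ?n \<le> l + k \<longleftrightarrow> odd l \<and> ?n div 2 \<le> l div 2 + k div 2"
        "even l \<and> ?n \<le> l + k \<longleftrightarrow> even l \<and> Suc ?n div 2 \<le> l div 2 + Suc k div 2" for l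
        using aux(1)[of p "l div 2"] aux(2)[of "Suc p" "l div 2"] by (cases "even l"; auto simp: p elim!: evenE oddE)+
      then show ?thesis
        unfolding split lenB using BB card_odd[of "\<lambda>b. ?n div 2 \<le> b + k div 2"]
          card_even[of "\<lambda>b. Suc ?n div 2 \<le> b + Suc k div 2"] by simp
    qed
  qed
qed

text \<open>By shiftability the two classes contribute \<open>max (k div 2) ?n0\<close> and
  \<open>max (Suc k div 2) ?n1\<close> beta-numbers. Subtracting
  \<open>k = k div 2 + Suc k div 2\<close> turns the maxima into the truncated differences that also
  arise from dropping the smallest times in \<open>extension\<close>.\<close>

lemma upper_diagram_iff:
  assumes lam: "is_partition lam" "pavable lam" and B: "beta_classes lam = (B, B')"
    and shiftable: "shiftable (partition_of_beta B)" "shiftable (partition_of_beta B')" and "0 < k"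
  shows "(x, x + k) \<in> diagram lam \<longleftrightarrow>
    x < (beta_count lam (k mod 2) - Suc k div 2) + (beta_count lam (Suc k mod 2) - k div 2)"
proof -
  note classes = beta_classes[OF lam B]
  let ?n0 = "beta_count lam 0" and ?n1 = "beta_count lam 1"
  have n0: "card {b \<in> set B. length B \<le> b} = ?n0" and n1: "card {b \<in> set B'. length B' \<le> b} = ?n1"
    using classes(5)[of 0] classes(6)[of 0] by simp_all
  have rhs: "(beta_count lam (k mod 2) - Suc k div 2) + (beta_count lam (Suc k mod 2) - k div 2)
      = (?n0 - k div 2) + (?n1 - Suc k div 2)"
    by (cases "even k") (auto simp: mod2_eq_if)
  have sorted: "sorted_wrt (>) (quotient_L lam)"
    using lam(1) by (intro sorted_quotient_L) (simp add: is_partition_def)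
  show ?thesis
  proof (cases "k \<le> length lam")
    case True
    have "(x, x + k) \<in> diagram lam \<longleftrightarrow> x + k < card {l \<in> set (quotient_L lam). length lam + x \<le> l + (x + k)}"
      using mem_diagram_beta[OF sorted, of x "x + k"] by (simp add: partition_of_beta_quotient_L[OF lam(1)])
    also have "{l \<in> set (quotient_L lam). length lam + x \<le> l + (x + k)} = {l \<in> set (quotient_L lam). length lam \<le> l + k}"
      by auto
    also have "card \<dots> = max (k div 2) ?n0 + max (Suc k div 2) ?n1"
    proof -
      have "k div 2 \<le> length B" "Suc k div 2 \<le> length B'"
        unfolding classes(3,4) using True by (simp_all add: div_le_mono)
      then show ?thesis
        unfolding classes(7) using shiftable_beta[OF classes(1) shiftable(1), of "k div 2"]
          shiftable_beta[OF classes(2) shiftable(2), of "Suc k div 2"] n0 n1 by simp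
    qed
    also have "x + k < max (k div 2) ?n0 + max (Suc k div 2) ?n1 \<longleftrightarrow> x < (?n0 - k div 2) + (?n1 - Suc k div 2)"
    proof -
      have "k = k div 2 + Suc k div 2" by presburger
      then show ?thesis by linarith
    qed
    finally show ?thesis unfolding rhs .
  next
    case False
    \<comment> \<open>A diagonal starting above the last row is empty, and both differences vanish
      because the counts are bounded by the sizes of the classes.\<close>
    have "?n0 \<le> length B" "?n1 \<le> length B'"
      unfolding n0[symmetric] n1[symmetric]
      by (rule order_trans[OF card_mono card_length], simp, blast)+
    then have "?n0 \<le> k div 2" "?n1 \<le> Suc k div 2"
      unfolding classes(3,4) using False by (meson div_le_mono le_trans nat_le_linear Suc_le_mono)+
    moreover have "(x, x + k) \<notin> diagram lam"
      using False by (simp add: diagram_def)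
    ultimately show ?thesis unfolding rhs by simp
  qed
qed

theorem theorem3p2:
  fixes lam mu nu :: "nat list"
  assumes "shifted_pavable lam"
    and "two_quotient lam = (mu, nu)"
  shows "gen_series (shifted_domino_tableaux lam) = Q mu \<star> Q nu"
proof -
  have lam: "is_partition lam" "pavable lam" and shiftable: "shiftable mu" "shiftable nu"
    using assms by (simp_all add: shifted_pavable_def)
  obtain B B' where B: "beta_classes lam = (B, B')" by fastforce
  \<comment> \<open>\<open>B\<close> and \<open>B'\<close> follow the parity of positions,
    \<open>mu\<close> and \<open>nu\<close> that of beta-numbers, so an odd number of rows exchanges
    them; commutativity of the product absorbs the exchange.\<close>
  have quotient: "(mu, nu) = (if even (length lam) then (partition_of_beta B, partition_of_beta B')
      else (partition_of_beta B', partition_of_beta B))"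
    using B assms(2) by (auto simp: two_quotient_eq beta_classes_def Let_def split: if_splits)
  then have shiftable': "shiftable (partition_of_beta B)" "shiftable (partition_of_beta B')"
    using shiftable by (auto split: if_splits)
  note classes = beta_classes[OF lam B]
  interpret shifted_shape lam "beta_count lam"
  proof
    show "sorted_wrt (\<ge>) lam" using lam(1) by (simp add: is_partition_def)
    show "diag_length lam c = beta_count lam c + beta_count lam (Suc c)" for c
      by (rule diag_length_eq_beta_count[OF lam(1)])
    show "(x, x + k) \<in> diagram lam \<longleftrightarrow>
        x < (beta_count lam (k mod 2) - Suc k div 2) + (beta_count lam (Suc k mod 2) - k div 2)"
      if "0 < k" for x k
      by (rule upper_diagram_iff[OF lam B shiftable' that])
  qed
  have "gen_series (shifted_domino_tableaux lam) = Q (partition_of_beta B) \<star> Q (partition_of_beta B')"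
    by (rule gen_series_eq_Q_times_Q)
      (simp_all add: sorted_partition_of_beta diag_length_beta classes(1,2) classes(5,6)[simplified])
  then show ?thesis
    using quotient series_times_commute by (auto split: if_splits)
qed

end
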